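(* Let $C$ be either a polytopal complex in $\mathbb{R}^d$ with $d\ge 3$, or a simplicial complex in $\mathbb{R}^2$ (in which case $d=2$). If the underlying space $|C|$ is star-shaped, then the $(d-2)$-nd iterated derived subdivision $\operatorname{sd}^{d-2}C$ is non-evasive, and in particular collapsible.
   Context: A polytopal complex in $\mathbb{R}^d$ is a finite collection of convex polytopes closed under taking faces such that any two intersect in a common face; $|C|$ is the union of its faces. A set $X\subset\mathbb{R}^d$ is star-shaped if there is $x\in X$ with $[x,y]\subset X$ for all $y\in X$. A derived subdivision $\operatorname{sd}C$ of a polytopal $d$-complex is obtained by stellarly subdividing (inserting a new vertex in the relative interior and coning) first all $d$-faces, then all $(d-1)$-faces, etc.; it is a simplicial complex combinatorially equivalent to the order complex of the poset of nonempty faces. $\operatorname{sd}^0C=C$, $\operatorname{sd}^{r+1}C=\operatorname{sd}(\operatorname{sd}^rC)$. An elementary collapse removes a free face, i.e. a nonempty face strictly contained in exactly one other face; a complex is collapsible if a sequence of elementary collapses reduces it to a single vertex. A $0$-dimensional simplicial complex is non-evasive iff it is a single point; a simplicial complex of positive dimension is non-evasive iff it has a vertex $v$ such that both the link of $v$ and the deletion of $v$ (the subcomplex of faces not containing $v$) are non-evasive. *)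

theory Defs
  imports "HOL-Analysis.Analysis"
begin

definition polytopal_complex :: "'a::euclidean_space set set \<Rightarrow> bool" where
  "polytopal_complex C \<longleftrightarrow>
     finite C \<and>
     (\<forall>P\<in>C. polytope P) \<and>
     (\<forall>P\<in>C. \<forall>F. F face_of P \<longrightarrow> F \<in> C) \<and>
     (\<forall>P\<in>C. \<forall>Q\<in>C. (P \<inter> Q) face_of P \<and> (P \<inter> Q) face_of Q)"

definition simplicial_complex :: "'a::euclidean_space set set \<Rightarrow> bool" where
  "simplicial_complex C \<longleftrightarrow> polytopal_complex C \<and> (\<forall>P\<in>C. \<exists>n. n simplex P)"

definition underlying :: "'a set set \<Rightarrow> 'a set" where
  "underlying C = \<Union>C"

text \<open>D is a derived subdivision of C: a point p F is chosen in the relative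
interior of every nonempty face F, and the faces of D are the convex hulls of the
chosen points of chains of nonempty faces of C (this is the result of stellarly
subdividing all faces in order of decreasing dimension).\<close>
definition derived_subdivision :: "'a::euclidean_space set set \<Rightarrow> 'a set set \<Rightarrow> bool" where
  "derived_subdivision C D \<longleftrightarrow>
     (\<exists>p. (\<forall>F\<in>C. F \<noteq> {} \<longrightarrow> p F \<in> rel_interior F) \<and>
          D = {convex hull (p ` S) | S. S \<subseteq> C - {{}} \<and>
                                        (\<forall>A\<in>S. \<forall>B\<in>S. A \<subseteq> B \<or> B \<subseteq> A)})"

inductive iter_derived :: "nat \<Rightarrow> 'a::euclidean_space set set \<Rightarrow> 'a set set \<Rightarrow> bool" where
  iter0: "iter_derived 0 C C"
| iterSuc: "iter_derived r C D \<Longrightarrow> derived_subdivision D E \<Longrightarrow> iter_derived (Suc r) C E"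

text \<open>An abstract simplicial complex is given as a set of finite vertex sets
(including the empty face).\<close>

definition asc_vertices :: "'v set set \<Rightarrow> 'v set" where
  "asc_vertices K = \<Union>K"

definition asc_link :: "'v \<Rightarrow> 'v set set \<Rightarrow> 'v set set" where
  "asc_link v K = {\<sigma>\<in>K. v \<notin> \<sigma> \<and> insert v \<sigma> \<in> K}"

definition asc_deletion :: "'v \<Rightarrow> 'v set set \<Rightarrow> 'v set set" where
  "asc_deletion v K = {\<sigma>\<in>K. v \<notin> \<sigma>}"

definition asc_pos_dim :: "'v set set \<Rightarrow> bool" where
  "asc_pos_dim K \<longleftrightarrow> (\<exists>\<sigma>\<in>K. 2 \<le> card \<sigma>)"

inductive nonevasive :: "'v set set \<Rightarrow> bool" where
  point: "nonevasive {{}, {v}}"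
| step: "asc_pos_dim K \<Longrightarrow> v \<in> asc_vertices K \<Longrightarrow>
         nonevasive (asc_link v K) \<Longrightarrow> nonevasive (asc_deletion v K) \<Longrightarrow> nonevasive K"

definition elementary_collapse :: "'v set set \<Rightarrow> 'v set set \<Rightarrow> bool" where
  "elementary_collapse K K' \<longleftrightarrow>
     (\<exists>\<sigma> \<tau>. \<sigma> \<in> K \<and> \<sigma> \<noteq> {} \<and> \<tau> \<in> K \<and> \<sigma> \<subset> \<tau> \<and>
            (\<forall>\<rho>\<in>K. \<sigma> \<subset> \<rho> \<longrightarrow> \<rho> = \<tau>) \<and> K' = K - {\<sigma>, \<tau>})"

definition collapsible :: "'v set set \<Rightarrow> bool" where
  "collapsible K \<longleftrightarrow> (\<exists>v. elementary_collapse\<^sup>*\<^sup>* K {{}, {v}})"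

definition vertex_scheme :: "'a::real_vector set set \<Rightarrow> 'a set set" where
  "vertex_scheme D = (\<lambda>S. {v. v extreme_point_of S}) ` D"

end

theory Submission
  imports Defs
begin

text \<open>
  The central claim is stronger than the theorem for dimension at least 3: the order complex of the
  faces of a star-shaped complex of (possibly unbounded) polyhedra is non-evasive, so one derived
  subdivision suffices, and the others only replace \<open>C\<close> by another polytopal complex with the
  same underlying space.

  The claim is proved by induction on the dimension. Choose a hyperplane through the star centre
  whose defining functional is constant on no cell other than a vertex, and remove the cells whose relative
  interior misses the hyperplane, those farthest away first. A cell that is not a vertex has a cone
  as its link when its turn comes, with the point of the cell closest to the hyperplane as apex.
  The link of a vertex consists of the cells at this vertex that come closer to the hyperplane; cutting
  their tangent cones by a parallel hyperplane gives a complex of polyhedra of lower dimension, star-shaped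
  from the direction of the centre. Admitting unbounded polyhedra is what makes this
  induction work without further subdivision. The cells that remain correspond to the slice by the
  hyperplane, which is again star-shaped.

  In the plane no subdivision is available, but the claim still shows that \<open>C\<close> is connected
  and has vanishing first cohomology. A planar complex with these properties has two vertices whose
  link is a path: either every vertex link is connected, and a highest and a lowest vertex will do, or
  some vertex cuts the complex into smaller ones of the same kind. Deleting such a vertex
  preserves both properties.
\<close>

section \<open>Order complexes and non-evasiveness\<close>

text \<open>The obstacle is the link of a vertex: it is naturally a spherical complex, whose lower
  part lives in an open hemisphere. Central projection of that hemisphere to an affine hyperplane
  makes it polyhedral again, but cells reaching the rim become unbounded. Compactness is thereby
  lost and has to be replaced in one place only: a cell whose relative interior misses the
  hyperplane lies on one side of it, so the functional is bounded there, and a bounded functional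
  attains its extremum on a polyhedron. Genericity makes the extremal point unique and a vertex.
  Star-shapedness passes to the link since, seen from the vertex, a segment from the centre to a
  nearby point covers the directions between those of its ends. In the plane, vertices of
  \<open>C\<close> itself must be deleted, which destroys star-shapedness; what survives a deletion
  is the vanishing of cohomology in degrees 0 and 1, and coefficients in two elements avoid
  orientations. Two removable vertices are sought because, in a piece cut off at a vertex, one of
  them may be the cut vertex, whose link in the whole complex is larger.\<close>

definition order_complex :: "'a set set \<Rightarrow> 'a set set set" where
  "order_complex P = {S. S \<subseteq> P \<and> (\<forall>A\<in>S. \<forall>B\<in>S. A \<subseteq> B \<or> B \<subseteq> A)}"

definition down_closed :: "'v set set \<Rightarrow> bool" where
  "down_closed K \<longleftrightarrow> (\<forall>\<sigma>\<in>K. \<forall>\<tau>. \<tau> \<subseteq> \<sigma> \<longrightarrow> \<tau> \<in> K)"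

lemma down_closedD: "down_closed K \<Longrightarrow> \<sigma> \<in> K \<Longrightarrow> \<tau> \<subseteq> \<sigma> \<Longrightarrow> \<tau> \<in> K"
  by (auto simp: down_closed_def)

lemma nonevasive_vertex:
  assumes "nonevasive K"
  shows "\<exists>v. {v} \<in> K"
  using assms
proof (induction)
  case (step K v)
  then show ?case by (auto simp: asc_deletion_def)
qed auto

text \<open>The side conditions of \<open>step\<close> come for free: a non-evasive link has a
  vertex \<open>w\<close>, and \<open>{v, w}\<close> is then a face of \<open>K\<close> with two
  elements.\<close>

lemma nonevasive_link_deletion:
  assumes l: "nonevasive (asc_link v K)" and d: "nonevasive (asc_deletion v K)"
  shows "nonevasive K"
proof (rule nonevasive.step[OF _ _ l d])
  obtain w where w: "{w} \<in> asc_link v K" using nonevasive_vertex[OF l] by blast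
  then have "v \<noteq> w" "{v, w} \<in> K" by (auto simp: asc_link_def)
  then show "asc_pos_dim K" unfolding asc_pos_dim_def
    by (intro bexI[of _ "{v, w}"]) auto
  show "v \<in> asc_vertices K" using \<open>{v, w} \<in> K\<close> by (auto simp: asc_vertices_def)
qed

lemma down_closed_link: "down_closed K \<Longrightarrow> down_closed (asc_link v K)"
  unfolding down_closed_def asc_link_def
  by (smt (verit) insert_mono mem_Collect_eq subset_eq)

lemma down_closed_deletion: "down_closed K \<Longrightarrow> down_closed (asc_deletion v K)"
  unfolding down_closed_def asc_deletion_def by (smt (verit) mem_Collect_eq subset_eq)

text \<open>Link and deletion of a vertex other than the apex \<open>c\<close> are again cones with
  apex \<open>c\<close>, so all other vertices can be removed one by one.\<close>

lemma nonevasive_cone: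
  assumes "down_closed K" "finite (\<Union>K)" "{c} \<in> K" "\<And>\<sigma>. \<sigma> \<in> K \<Longrightarrow> insert c \<sigma> \<in> K"
  shows "nonevasive K"
  using assms
proof (induction "card (\<Union>K)" arbitrary: K rule: less_induct)
  case less
  show ?case
  proof (cases "\<Union>K = {c}")
    case True
    have "K = {{}, {c}}"
      using True less.prems(1,3) down_closedD[OF less.prems(1), of "{c}" "{}"] by auto
    then show ?thesis by (simp add: nonevasive.point)
  next
    case False
    then obtain w where w: "w \<in> \<Union>K" "w \<noteq> c" using less.prems(3) by blast
    have wK: "{w} \<in> K" using w down_closedD[OF less.prems(1)] by blast
    have sub: "\<Union>(asc_link w K) \<subset> \<Union>K" "\<Union>(asc_deletion w K) \<subset> \<Union>K"
      using w by (auto simp: asc_link_def asc_deletion_def)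
    have cw: "{c, w} \<in> K" using less.prems(4)[OF wK] by simp
    have "nonevasive (asc_link w K)"
    proof (rule less.hyps)
      show "card (\<Union>(asc_link w K)) < card (\<Union>K)" by (rule psubset_card_mono[OF less.prems(2)]) (use sub in simp)
      show "down_closed (asc_link w K)" by (rule down_closed_link[OF less.prems(1)])
      show "finite (\<Union>(asc_link w K))" by (rule finite_subset[OF _ less.prems(2)]) (use sub in blast)
      show "{c} \<in> asc_link w K" using w cw less.prems(3) by (auto simp: asc_link_def insert_commute)
      show "insert c \<sigma> \<in> asc_link w K" if "\<sigma> \<in> asc_link w K" for \<sigma>
        using that less.prems(4) w by (auto simp: asc_link_def insert_commute)
    qed
    moreover have "nonevasive (asc_deletion w K)"
    proof (rule less.hyps)
      show "card (\<Union>(asc_deletion w K)) < card (\<Union>K)" by (rule psubset_card_mono[OF less.prems(2)]) (use sub in simp)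
      show "down_closed (asc_deletion w K)" by (rule down_closed_deletion[OF less.prems(1)])
      show "finite (\<Union>(asc_deletion w K))" by (rule finite_subset[OF _ less.prems(2)]) (use sub in blast)
      show "{c} \<in> asc_deletion w K" using w less.prems(3) by (auto simp: asc_deletion_def)
      show "insert c \<sigma> \<in> asc_deletion w K" if "\<sigma> \<in> asc_deletion w K" for \<sigma>
        using that less.prems(4) w by (auto simp: asc_deletion_def)
    qed
    ultimately show ?thesis
      by (rule nonevasive_link_deletion)
  qed
qed

lemma nonevasive_image:
  assumes "nonevasive K" "inj_on f V" "\<Union>K \<subseteq> V"
  shows "nonevasive ((`) f ` K)"
  using assms
proof (induction)
  case (point v)
  then show ?case using nonevasive.point[of "f v"] by simp
next
  case (step K v)
  have vV: "v \<in> V" using step by (auto simp: asc_vertices_def)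
  have fs: "f v \<in> f ` \<sigma> \<longleftrightarrow> v \<in> \<sigma>" if "\<sigma> \<subseteq> V" for \<sigma>
    using inj_on_image_mem_iff[OF step.prems(1) vV that] .
  have KV: "\<sigma> \<subseteq> V" if "\<sigma> \<in> K" for \<sigma> using that step.prems(2) by blast
  have del: "asc_deletion (f v) ((`) f ` K) = (`) f ` asc_deletion v K"
    using fs KV by (auto simp: asc_deletion_def)
  have link: "asc_link (f v) ((`) f ` K) = (`) f ` asc_link v K"
  proof (intro equalityI subsetI)
    fix x assume "x \<in> asc_link (f v) ((`) f ` K)"
    then obtain \<sigma> \<tau> where s: "\<sigma> \<in> K" "x = f ` \<sigma>" "f v \<notin> x" "\<tau> \<in> K" "insert (f v) x = f ` \<tau>"
      by (auto simp: asc_link_def)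
    then have "f ` (insert v \<sigma>) = f ` \<tau>" by simp
    then have "insert v \<sigma> = \<tau>"
      using inj_on_image_eq_iff[OF step.prems(1), of "insert v \<sigma>" \<tau>] KV s vV by auto
    then have "\<sigma> \<in> asc_link v K" using s by (auto simp: asc_link_def)
    then show "x \<in> (`) f ` asc_link v K" using s by blast
  next
    fix x assume "x \<in> (`) f ` asc_link v K"
    then obtain \<sigma> where s: "\<sigma> \<in> K" "v \<notin> \<sigma>" "insert v \<sigma> \<in> K" "x = f ` \<sigma>" by (auto simp: asc_link_def)
    have "f v \<notin> x" using s fs KV by simp
    moreover have "insert (f v) x \<in> (`) f ` K"
      using s by (metis image_eqI image_insert)
    ultimately show "x \<in> asc_link (f v) ((`) f ` K)" using s by (auto simp: asc_link_def)
  qed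
  have "\<Union>(asc_link v K) \<subseteq> V" "\<Union>(asc_deletion v K) \<subseteq> V"
    using step.prems(2) by (auto simp: asc_link_def asc_deletion_def)
  then have 1: "nonevasive (asc_link (f v) ((`) f ` K))" "nonevasive (asc_deletion (f v) ((`) f ` K))"
    unfolding link del using step.IH step.prems by auto
  have 2: "asc_pos_dim ((`) f ` K)"
  proof -
    obtain \<sigma> where "\<sigma> \<in> K" "2 \<le> card \<sigma>" using step.hyps(1) by (auto simp: asc_pos_dim_def)
    then show ?thesis unfolding asc_pos_dim_def
      using card_image[OF inj_on_subset[OF step.prems(1) KV]] by force
  qed
  have 3: "f v \<in> asc_vertices ((`) f ` K)"
    using step.hyps(2) by (auto simp: asc_vertices_def)
  show ?case by (rule nonevasive.step[OF 2 3 1])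
qed

lemma order_complex_down_closed: "down_closed (order_complex P)"
  by (auto simp: down_closed_def order_complex_def)

lemma Union_order_complex: "\<Union>(order_complex P) = P"
proof (intro equalityI subsetI)
  fix A assume "A \<in> P"
  then have "{A} \<in> order_complex P" by (simp add: order_complex_def)
  then show "A \<in> \<Union>(order_complex P)" by blast
qed (auto simp: order_complex_def)

lemma order_complex_deletion: "asc_deletion A (order_complex P) = order_complex (P - {A})"
  by (auto simp: order_complex_def asc_deletion_def)

lemma order_complex_link:
  assumes "A \<in> P"
  shows "asc_link A (order_complex P) = order_complex {B \<in> P - {A}. B \<subseteq> A \<or> A \<subseteq> B}"
  using assms by (auto simp: order_complex_def asc_link_def)

lemma order_complex_remove:
  assumes "A \<in> P"
    and "nonevasive (order_complex {B \<in> P - {A}. B \<subseteq> A \<or> A \<subseteq> B})"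
    and "nonevasive (order_complex (P - {A}))"
  shows "nonevasive (order_complex P)"
  using assms nonevasive_link_deletion[of A "order_complex P"]
  by (simp add: order_complex_link order_complex_deletion)

lemma order_complex_cone:
  assumes "finite P" "A \<in> P" "\<And>B. B \<in> P \<Longrightarrow> A \<subseteq> B"
  shows "nonevasive (order_complex P)"
proof (rule nonevasive_cone[where c = A])
  show "insert A S \<in> order_complex P" if "S \<in> order_complex P" for S
    using that assms by (auto simp: order_complex_def)
  show "{A} \<in> order_complex P" using assms by (auto simp: order_complex_def)
qed (use assms in \<open>simp_all add: order_complex_down_closed Union_order_complex\<close>)

text \<open>Preserving and reflecting inclusion makes \<open>f\<close> injective on \<open>P\<close>
  and lets chains correspond, so non-evasiveness is pulled back along its inverse. This allows cells
  to be exchanged for their slices, and vertex sets for their convex hulls.\<close>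

lemma order_complex_image:
  assumes ord: "\<And>A B. A \<in> P \<Longrightarrow> B \<in> P \<Longrightarrow> f A \<subseteq> f B \<longleftrightarrow> A \<subseteq> B"
    and ne: "nonevasive (order_complex (f ` P))"
  shows "nonevasive (order_complex P)"
proof -
  have inj: "inj_on f P" by (rule inj_onI) (use ord in blast)
  have chain: "f ` T \<in> order_complex (f ` P) \<longleftrightarrow> T \<in> order_complex P" if TP: "T \<subseteq> P" for T
  proof -
    have "(\<forall>A\<in>f ` T. \<forall>B\<in>f ` T. A \<subseteq> B \<or> B \<subseteq> A)
        \<longleftrightarrow> (\<forall>A\<in>T. \<forall>B\<in>T. f A \<subseteq> f B \<or> f B \<subseteq> f A)"
      by simp
    also have "\<dots> \<longleftrightarrow> (\<forall>A\<in>T. \<forall>B\<in>T. A \<subseteq> B \<or> B \<subseteq> A)"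
      using ord TP by (meson in_mono)
    finally show ?thesis using TP by (simp add: order_complex_def image_mono)
  qed
  let ?g = "inv_into P f"
  have g: "inj_on ?g (f ` P)" by (simp add: inj_on_inv_into)
  have "order_complex P = (`) ?g ` order_complex (f ` P)"
  proof (intro equalityI subsetI)
    fix S assume S: "S \<in> order_complex P"
    then have SP: "S \<subseteq> P" by (auto simp: order_complex_def)
    have "f ` S \<in> order_complex (f ` P)" using S chain[OF SP] by simp
    moreover have "?g ` f ` S = S"
      using SP inj by (simp add: inv_into_image_cancel)
    ultimately show "S \<in> (`) ?g ` order_complex (f ` P)"
      by (intro image_eqI[of _ _ "f ` S"]) auto
  next
    fix S assume "S \<in> (`) ?g ` order_complex (f ` P)"
    then obtain S' where S': "S' \<in> order_complex (f ` P)" "S = ?g ` S'" by blast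
    then obtain T where T: "T \<subseteq> P" "S' = f ` T" by (auto simp: order_complex_def subset_image_iff)
    then have "S = T" using S' inj by (simp add: inv_into_image_cancel)
    then show "S \<in> order_complex P" using S' T chain by simp
  qed
  then show ?thesis using nonevasive_image[OF ne g] by (simp add: Union_order_complex)
qed

text \<open>A face above \<open>insert v \<sigma>\<close> contains \<open>v\<close> and therefore
  comes from a face of \<open>L\<close>; so a free pair of \<open>L\<close> stays free when
  \<open>v\<close> is added to both of its members.\<close>

lemma elementary_collapse_cone_lift:
  assumes el: "elementary_collapse L L'" and L: "L \<subseteq> asc_link v K"
  shows "elementary_collapse (asc_deletion v K \<union> insert v ` L) (asc_deletion v K \<union> insert v ` L')"
proof -
  obtain \<sigma> \<tau> where st: "\<sigma> \<in> L" "\<sigma> \<noteq> {}" "\<tau> \<in> L" "\<sigma> \<subset> \<tau>" "\<And>\<rho>. \<rho> \<in> L \<Longrightarrow> \<sigma> \<subset> \<rho> \<Longrightarrow> \<rho> = \<tau>"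
    and L': "L' = L - {\<sigma>, \<tau>}"
    using el unfolding elementary_collapse_def by metis
  have v: "v \<notin> \<rho>" if "\<rho> \<in> L" for \<rho> using that L by (auto simp: asc_link_def)
  have inj: "insert v \<rho> = insert v \<rho>' \<longleftrightarrow> \<rho> = \<rho>'" if "\<rho> \<in> L" "\<rho>' \<in> L" for \<rho> \<rho>'
    by (rule insert_ident[OF v v]) (use that in auto)
  show ?thesis unfolding elementary_collapse_def
  proof (intro exI conjI ballI impI)
    show "insert v \<sigma> \<in> asc_deletion v K \<union> insert v ` L"
      "insert v \<tau> \<in> asc_deletion v K \<union> insert v ` L" using st(1,3) by simp_all
    show "insert v \<sigma> \<noteq> {}" by simp
    have "insert v \<sigma> \<noteq> insert v \<tau>" using st(4) inj[OF st(1,3)] by blast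
    then show "insert v \<sigma> \<subset> insert v \<tau>" using st(4) by blast
    show "\<rho> = insert v \<tau>"
      if \<rho>: "\<rho> \<in> asc_deletion v K \<union> insert v ` L" "insert v \<sigma> \<subset> \<rho>" for \<rho>
    proof -
      have "v \<in> \<rho>" using \<rho>(2) by blast
      then obtain \<rho>' where r: "\<rho>' \<in> L" "\<rho> = insert v \<rho>'"
        using \<rho>(1) unfolding asc_deletion_def by blast
      then have "\<sigma> \<subset> \<rho>'" using \<rho>(2) v[OF st(1)] by blast
      then show ?thesis using st(5) r by blast
    qed
    show "asc_deletion v K \<union> insert v ` L' =
      asc_deletion v K \<union> insert v ` L - {insert v \<sigma>, insert v \<tau>}"
    proof -
      have "insert v ` (L - {\<sigma>, \<tau>}) = insert v ` L - {insert v \<sigma>, insert v \<tau>}"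
        using inj st(1,3) by blast
      moreover have "asc_deletion v K - {insert v \<sigma>, insert v \<tau>} = asc_deletion v K"
        by (auto simp: asc_deletion_def)
      ultimately show ?thesis unfolding L' by (simp only: Un_Diff)
    qed
  qed
qed

text \<open>\<open>K\<close> is the deletion of \<open>v\<close> glued to the cone over the link.
  Collapsing the link to a point \<open>w\<close> lifts to the cone and leaves only
  \<open>{v}\<close> and \<open>{v, w}\<close> beyond the deletion; removing this pair reaches the
  deletion, which collapses by induction.\<close>

lemma nonevasive_imp_collapsible:
  assumes "nonevasive K" "down_closed K"
  shows "collapsible K"
  using assms
proof (induction)
  case (point v)
  then show ?case by (auto simp: collapsible_def)
next
  case (step K v)
  let ?D = "asc_deletion v K" and ?L = "asc_link v K"
  obtain w where w: "elementary_collapse\<^sup>*\<^sup>* ?L {{}, {w}}"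
    using step.IH(1) down_closed_link[OF step.prems] by (auto simp: collapsible_def)
  have lift: "L' \<subseteq> ?L \<and> elementary_collapse\<^sup>*\<^sup>* (?D \<union> insert v ` ?L) (?D \<union> insert v ` L')"
    if "elementary_collapse\<^sup>*\<^sup>* ?L L'" for L'
    using that
  proof (induction rule: rtranclp_induct)
    case (step L L')
    then have "L' \<subseteq> L" by (auto simp: elementary_collapse_def)
    then show ?case
      using elementary_collapse_cone_lift[OF step(2)] step(3)
      by (meson order_trans rtranclp.rtrancl_into_rtrancl)
  qed simp
  have K: "?D \<union> insert v ` ?L = K"
  proof (intro equalityI subsetI)
    fix \<sigma> assume s: "\<sigma> \<in> K"
    show "\<sigma> \<in> ?D \<union> insert v ` ?L"
    proof (cases "v \<in> \<sigma>")
      case True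
      then have "insert v (\<sigma> - {v}) = \<sigma>" by auto
      moreover have "\<sigma> - {v} \<in> ?L"
        using s True down_closedD[OF step.prems s] calculation by (auto simp: asc_link_def)
      ultimately show ?thesis by (metis UnI2 imageI)
    qed (use s in \<open>auto simp: asc_deletion_def\<close>)
  qed (auto simp: asc_deletion_def asc_link_def)
  have wv: "w \<noteq> v" "{w} \<in> K" using lift[OF w] by (auto simp: asc_link_def)
  have "elementary_collapse (?D \<union> insert v ` {{}, {w}}) ?D"
    unfolding elementary_collapse_def
    by (rule exI[of _ "{v}"], rule exI[of _ "{v, w}"]) (use wv in \<open>auto simp: asc_deletion_def\<close>)
  with lift[OF w] have "elementary_collapse\<^sup>*\<^sup>* K ?D"
    unfolding K by (meson rtranclp.rtrancl_into_rtrancl)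
  moreover obtain u where "elementary_collapse\<^sup>*\<^sup>* ?D {{}, {u}}"
    using step.IH(2) down_closed_deletion[OF step.prems] by (auto simp: collapsible_def)
  ultimately show ?case unfolding collapsible_def by (meson rtranclp_trans)
qed

section \<open>Star-shaped polyhedral complexes\<close>

text \<open>Cells outside \<open>R\<close> are removed by decreasing \<open>h\<close>, larger cells
  first among those of equal \<open>h\<close>. The first alternative makes the link of
  \<open>S\<close> a cone with apex \<open>M\<close>; in the second, \<open>S\<close> is minimal and
  its link consists of the cells above it that are still present.\<close>

lemma order_complex_sweep:
  fixes h :: "'a set \<Rightarrow> real"
  assumes fin: "finite C" and RC: "R \<subseteq> C" and R: "nonevasive (order_complex R)"
    and step: "\<And>S. S \<in> C - R \<Longrightarrow>
      (\<exists>M\<in>C. M \<subset> S \<and> (M \<in> R \<or> h M = h S) \<and>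
          (\<forall>T\<in>C. T \<subset> S \<longrightarrow> T \<in> R \<or> h T \<le> h S \<longrightarrow> M \<subseteq> T)) \<or>
      (\<forall>T\<in>C. \<not> T \<subset> S) \<and> nonevasive (order_complex {T\<in>C. S \<subset> T \<and> (T \<in> R \<or> h T < h S)})"
  shows "nonevasive (order_complex C)"
proof -
  \<comment> \<open>\<open>P\<close> is a state of the sweep: it contains \<open>R\<close> and, with
    each cell outside \<open>R\<close>, every cell scheduled for later removal.\<close>
  have "nonevasive (order_complex P)"
    if "R \<subseteq> P" "P \<subseteq> C"
      and "\<And>S T. S \<in> P - R \<Longrightarrow> T \<in> C - R \<Longrightarrow> h T < h S \<or> h T = h S \<and> T \<subseteq> S \<Longrightarrow> T \<in> P"
    for P
    using that
  proof (induction "card (P - R)" arbitrary: P rule: less_induct)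
    case less
    have finP: "finite P" using less.prems(2) fin finite_subset by metis
    show ?case
    proof (cases "P = R")
      case False
      define Z where "Z = {S \<in> P - R. \<forall>T\<in>P - R. h T \<le> h S}"
      have "P - R \<noteq> {}" using False less.prems(1) by blast
      then have "Max (h ` (P - R)) \<in> h ` (P - R)" using finP by simp
      then obtain S0 where "S0 \<in> P - R" "h S0 = Max (h ` (P - R))" by force
      then have "S0 \<in> Z" using finP by (simp add: Z_def)
      moreover have "finite Z" using finP by (simp add: Z_def)
      \<comment> \<open>Breaking ties by inclusion has two effects: present cells above
        \<open>S\<close> outside \<open>R\<close> have strictly smaller \<open>h\<close>, and an
        apex \<open>M\<close> with \<open>h M = h S\<close> has not been removed yet.\<close>
      ultimately obtain S where SZ: "S \<in> Z" and Smax: "\<And>T. T \<in> Z \<Longrightarrow> S \<subseteq> T \<Longrightarrow> T = S"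
        using finite_has_maximal2[of Z S0] by metis
      have SP: "S \<in> P" "S \<notin> R" and hmax: "\<And>T. T \<in> P - R \<Longrightarrow> h T \<le> h S"
        using SZ by (simp_all add: Z_def)
      have SC: "S \<in> C - R" using SP less.prems(2) by blast
      have Sup: "h T < h S" if "T \<in> P - R" "S \<subset> T" for T
      proof (rule ccontr)
        assume "\<not> h T < h S"
        then have "T \<in> Z" using that(1) hmax by (force simp: Z_def)
        then show False using Smax that(2) by blast
      qed
      have del: "nonevasive (order_complex (P - {S}))"
      proof (rule less.hyps)
        have "P - {S} - R = (P - R) - {S}" by blast
        then show "card (P - {S} - R) < card (P - R)"
          using SP finP by (metis DiffI card_Diff1_less finite_Diff)
        show "R \<subseteq> P - {S}" using SP less.prems(1) by blast
        show "P - {S} \<subseteq> C" using less.prems(2) by blast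
        show "T \<in> P - {S}" if "S' \<in> P - {S} - R" "T \<in> C - R" "h T < h S' \<or> h T = h S' \<and> T \<subseteq> S'" for S' T
        proof -
          have S': "S' \<in> P - R" "S' \<noteq> S" using that(1) by blast+
          have "T \<in> P" using less.prems(3)[OF S'(1) that(2,3)] .
          moreover have "T \<noteq> S"
          proof
            assume "T = S"
            then show False using that(3) S' hmax[OF S'(1)] Sup[OF S'(1)] by force
          qed
          ultimately show ?thesis by blast
        qed
      qed
      show ?thesis
      proof (rule order_complex_remove[OF SP(1) _ del])
        let ?Q = "{B \<in> P - {S}. B \<subseteq> S \<or> S \<subseteq> B}"
        show "nonevasive (order_complex ?Q)"
        proof (rule disjE[OF step[OF SC]])
          assume "\<exists>M\<in>C. M \<subset> S \<and> (M \<in> R \<or> h M = h S) \<and>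
            (\<forall>T\<in>C. T \<subset> S \<longrightarrow> T \<in> R \<or> h T \<le> h S \<longrightarrow> M \<subseteq> T)"
          then obtain M where M: "M \<in> C" "M \<subset> S" "M \<in> R \<or> h M = h S"
            and below: "\<forall>T\<in>C. T \<subset> S \<longrightarrow> T \<in> R \<or> h T \<le> h S \<longrightarrow> M \<subseteq> T"
            by (elim bexE conjE) (rule that)
          have MP: "M \<in> P"
          proof (cases "M \<in> R")
            case True
            then show ?thesis using less.prems(1) by blast
          next
            case False
            then show ?thesis using less.prems(3)[of S M] SC SP M by blast
          qed
          show ?thesis
          proof (rule order_complex_cone)
            show "finite ?Q" using finP by simp
            show "M \<in> ?Q" using MP M(2) by blast
            show "M \<subseteq> B" if "B \<in> ?Q" for B
            proof (cases "S \<subseteq> B")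
              case True
              then show ?thesis using M(2) by blast
            next
              case False
              then have "B \<in> P" "B \<subset> S" using that by blast+
              then show ?thesis using below hmax[of B] less.prems(2) by blast
            qed
          qed
        next
          assume minS: "(\<forall>T\<in>C. \<not> T \<subset> S) \<and>
            nonevasive (order_complex {T\<in>C. S \<subset> T \<and> (T \<in> R \<or> h T < h S)})"
          have "?Q = {T\<in>C. S \<subset> T \<and> (T \<in> R \<or> h T < h S)}"
          proof (intro equalityI subsetI)
            fix B assume B: "B \<in> ?Q"
            then have BC: "B \<in> C" using less.prems(2) by blast
            then have SB: "S \<subset> B" using B minS by blast
            then show "B \<in> {T\<in>C. S \<subset> T \<and> (T \<in> R \<or> h T < h S)}"
              using BC Sup[of B] B by blast
          next
            fix B assume B: "B \<in> {T\<in>C. S \<subset> T \<and> (T \<in> R \<or> h T < h S)}"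
            then have "B \<in> P" using less.prems(1) less.prems(3)[of S B] SP by blast
            then show "B \<in> ?Q" using B by blast
          qed
          then show ?thesis using minS by simp
        qed
      qed
    qed (use R in simp)
  qed
  then show ?thesis using RC by blast
qed

text \<open>A functional that works for \<open>W\<close> is moved in the direction of the new vector
  \<open>w\<close>; each vector rules out at most one parameter \<open>t\<close>, and finitely many
  values cannot exhaust the reals.\<close>

lemma exists_generic_functional:
  fixes W :: "'a::real_inner set"
  assumes "finite W" "0 \<notin> W"
  shows "\<exists>a. \<forall>w\<in>W. a \<bullet> w \<noteq> 0"
  using assms
proof (induction W)
  case (insert w W)
  then obtain a where a: "\<forall>x\<in>W. a \<bullet> x \<noteq> 0" by auto
  let ?bad = "\<lambda>x. {t. (a + t *\<^sub>R w) \<bullet> x = 0}"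
  have fin: "finite (?bad x)" if x: "x \<in> insert w W" for x
  proof -
    have "t = s" if "(a + t *\<^sub>R w) \<bullet> x = 0" "(a + s *\<^sub>R w) \<bullet> x = 0" for s t
    proof -
      have "w \<bullet> x \<noteq> 0"
      proof (cases "x = w")
        case False
        then have "a \<bullet> x \<noteq> 0" using x a by blast
        then show ?thesis using that(1) by (auto simp: inner_add_left)
      qed (use insert.prems in auto)
      moreover have "t * (w \<bullet> x) = s * (w \<bullet> x)"
        using that unfolding inner_add_left inner_scaleR_left by linarith
      ultimately show ?thesis by simp
    qed
    then have "?bad x \<subseteq> {SOME t. t \<in> ?bad x}" by (auto intro: someI2)
    then show ?thesis using finite_subset by blast
  qed
  then have "finite (\<Union>x\<in>insert w W. ?bad x)" using insert.hyps by blast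
  then obtain t where "t \<notin> (\<Union>x\<in>insert w W. ?bad x)"
    using ex_new_if_finite[OF infinite_UNIV_char_0] by blast
  then show ?case by blast
qed simp

text \<open>Cells may be unbounded, and a cell contained in another one need not be a face of it: all
  that matters is that the relative interiors partition every cell.\<close>
definition cell_complex :: "'a::euclidean_space set set \<Rightarrow> bool" where
  "cell_complex C \<longleftrightarrow> finite C \<and> (\<forall>S\<in>C. polyhedron S \<and> S \<noteq> {}) \<and>
     (\<forall>S\<in>C. \<forall>y\<in>S. \<exists>T\<in>C. T \<subseteq> S \<and> y \<in> rel_interior T) \<and>
     (\<forall>S\<in>C. \<forall>T\<in>C. rel_interior S \<inter> T \<noteq> {} \<longrightarrow> S \<subseteq> T)"

section \<open>Cells, carriers and minima of linear functionals\<close>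

context
  fixes C :: "'a::euclidean_space set set"
  assumes C: "cell_complex C"
begin

lemma cells_finite: "finite C"
  and cell_polyhedron: "S \<in> C \<Longrightarrow> polyhedron S"
  and cell_nonempty: "S \<in> C \<Longrightarrow> S \<noteq> {}"
  and cell_carrier: "S \<in> C \<Longrightarrow> y \<in> S \<Longrightarrow> \<exists>T\<in>C. T \<subseteq> S \<and> y \<in> rel_interior T"
  and cell_subset: "S \<in> C \<Longrightarrow> T \<in> C \<Longrightarrow> y \<in> rel_interior S \<Longrightarrow> y \<in> T \<Longrightarrow> S \<subseteq> T"
  using C unfolding cell_complex_def by blast+

lemma cell_convex: "S \<in> C \<Longrightarrow> convex S"
  and cell_closed: "S \<in> C \<Longrightarrow> closed S"
  using cell_polyhedron polyhedron_imp_convex polyhedron_imp_closed by blast+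

lemma cell_extend:
  assumes "S \<in> C" "y \<in> rel_interior S" "x \<in> S"
  shows "\<exists>e>1. (1 - e) *\<^sub>R x + e *\<^sub>R y \<in> S"
  using assms convex_rel_interior_iff[OF cell_convex cell_nonempty] by blast

text \<open>From a point of the relative interior one can follow a decreasing ray until it leaves the
  cell through a smaller cell; so the minimum is already attained on the smaller cells.\<close>
lemma cell_attains_min:
  assumes "S \<in> C" "\<And>y. y \<in> S \<Longrightarrow> b \<le> a \<bullet> y"
  shows "\<exists>z\<in>S. \<forall>y\<in>S. a \<bullet> z \<le> a \<bullet> y"
  using assms
proof (induction "card {T\<in>C. T \<subset> S}" arbitrary: S rule: less_induct)
  case less
  let ?F = "{T\<in>C. T \<subset> S}"
  have finF: "finite ?F" using cells_finite by simp
  show ?case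
  proof (cases "\<forall>y\<in>S. \<forall>z\<in>S. a \<bullet> y = a \<bullet> z")
    case True
    then show ?thesis using cell_nonempty[OF less.prems(1)] by (metis ex_in_conv order_refl)
  next
    case nonconst: False
    have lower: "\<exists>T\<in>?F. \<exists>z\<in>T. a \<bullet> z \<le> a \<bullet> y" if y: "y \<in> S" for y
    proof (cases "y \<in> rel_interior S")
      case False
      then show ?thesis using cell_carrier[OF less.prems(1) y] rel_interior_subset by blast
    next
      case True
      obtain x where x: "x \<in> S" "a \<bullet> x \<noteq> a \<bullet> y" using nonconst by metis
      \<comment> \<open>If the value at \<open>x\<close> is larger than at \<open>y\<close>, the
        segment from \<open>x\<close> is prolonged beyond \<open>y\<close>, which is possible inside
        \<open>S\<close> because \<open>y\<close> is in the relative interior.\<close>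
      obtain x' where x': "x' \<in> S" "a \<bullet> x' < a \<bullet> y"
      proof (cases "a \<bullet> x < a \<bullet> y")
        case False
        then have gt: "a \<bullet> y < a \<bullet> x" using x by simp
        obtain e where e: "e > 1" "(1 - e) *\<^sub>R x + e *\<^sub>R y \<in> S"
          using cell_extend[OF less.prems(1) True x(1)] by blast
        have "a \<bullet> ((1 - e) *\<^sub>R x + e *\<^sub>R y) - a \<bullet> y = (e - 1) * (a \<bullet> y - a \<bullet> x)"
          by (simp add: inner_add_right algebra_simps)
        also have "\<dots> < 0" using e gt by (simp add: mult_less_0_iff)
        finally show ?thesis using that e(2) by simp
      qed (use x that in blast)
      define r where "r t = y + t *\<^sub>R (x' - y)" for t :: real
      define d where "d = a \<bullet> y - a \<bullet> x'"
      have d: "d > 0" using x' by (simp add: d_def)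
      have ar: "a \<bullet> r t = a \<bullet> y - t * d" for t
        by (simp add: r_def d_def inner_add_right inner_diff_right algebra_simps)
      let ?T = "{0..} \<inter> r -` S"
      have "closed ?T"
        using cell_closed[OF less.prems(1)]
        by (intro closed_Int closed_vimage) (auto simp: r_def intro!: continuous_intros)
      moreover have "t \<le> (a \<bullet> y - b) / d" if "t \<in> ?T" for t
        using less.prems(2)[of "r t"] that d by (simp add: ar field_simps)
      then have "?T \<subseteq> {0..(a \<bullet> y - b) / d}" by auto
      then have "bounded ?T" by (rule bounded_subset[OF bounded_closed_interval])
      ultimately have "compact ?T" by (simp add: compact_eq_bounded_closed)
      moreover have T1: "1 \<in> ?T" using x' by (simp add: r_def)
      then have "?T \<noteq> {}" by blast
      ultimately obtain t where t: "t \<in> ?T" "\<And>s. s \<in> ?T \<Longrightarrow> s \<le> t"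
        using compact_attains_sup[of ?T] by blast
      have t1: "t \<ge> 1" using t(2)[OF T1] .
      have rtS: "r t \<in> S" using t by simp
      obtain T where T: "T \<in> C" "T \<subseteq> S" "r t \<in> rel_interior T"
        using cell_carrier[OF less.prems(1) rtS] by blast
      \<comment> \<open>If \<open>r t\<close> were in the relative interior of \<open>S\<close>, the
        ray could be prolonged beyond it, against the choice of \<open>t\<close> as the last
        parameter.\<close>
      have "T \<noteq> S"
      proof
        assume "T = S"
        then obtain e where e: "e > 1" "(1 - e) *\<^sub>R y + e *\<^sub>R r t \<in> S"
          using cell_extend[of S "r t" y] T y by blast
        have "(1 - e) *\<^sub>R y + e *\<^sub>R r t = r (e * t)" by (simp add: r_def algebra_simps)
        then have "e * t \<in> ?T" using e t1 by simp
        then have "e * t \<le> 1 * t" using t(2) by simp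
        then show False using e(1) t1 by simp
      qed
      then have "T \<in> ?F" using T by blast
      moreover have "r t \<in> T" using T(3) rel_interior_subset by blast
      moreover have "a \<bullet> r t \<le> a \<bullet> y" using d t1 by (simp add: ar)
      ultimately show ?thesis by blast
    qed
    have "\<exists>z\<in>T. \<forall>y\<in>T. a \<bullet> z \<le> a \<bullet> y" if T: "T \<in> ?F" for T
    proof (rule less.hyps)
      have "{T'\<in>C. T' \<subset> T} \<subset> ?F" using T by blast
      then show "card {T'\<in>C. T' \<subset> T} < card ?F" by (rule psubset_card_mono[OF finF])
      show "T \<in> C" using T by simp
      show "b \<le> a \<bullet> y" if "y \<in> T" for y using T that less.prems(2) by blast
    qed
    then obtain z where z: "\<And>T. T \<in> ?F \<Longrightarrow> z T \<in> T \<and> (\<forall>y\<in>T. a \<bullet> z T \<le> a \<bullet> y)" by metis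
    let ?Z = "(\<lambda>T. a \<bullet> z T) ` ?F"
    have "?F \<noteq> {}" using lower cell_nonempty[OF less.prems(1)] by blast
    then have "Min ?Z \<in> ?Z" using finF by (intro Min_in) auto
    then obtain T0 where T0: "T0 \<in> ?F" "a \<bullet> z T0 = Min ?Z" by force
    have min: "a \<bullet> z T0 \<le> a \<bullet> z T" if "T \<in> ?F" for T
      unfolding T0(2) by (rule Min_le) (use finF that in auto)
    have "a \<bullet> z T0 \<le> a \<bullet> y" if "y \<in> S" for y
      using lower[OF that] min z by (meson order_trans)
    moreover have "z T0 \<in> S" using z[OF T0(1)] T0(1) by blast
    ultimately show ?thesis by blast
  qed
qed

text \<open>A minimum point lies in the relative interior of some cell, and prolonging segments
  through it shows that the functional is constant on that cell, which by \<open>gen\<close> is a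
  point. A second minimum point would give a whole segment of them, hence infinitely many
  cells.\<close>

lemma cell_min_vertex:
  assumes gen: "\<And>T. T \<in> C \<Longrightarrow> (\<forall>y\<in>T. \<forall>z\<in>T. a \<bullet> y = a \<bullet> z) \<Longrightarrow> \<exists>v. T = {v}"
    and S: "S \<in> C" "\<And>y. y \<in> S \<Longrightarrow> b \<le> a \<bullet> y"
  shows "\<exists>v. {v} \<in> C \<and> v \<in> S \<and> (\<forall>y\<in>S. y \<noteq> v \<longrightarrow> a \<bullet> v < a \<bullet> y)"
proof -
  obtain z where z: "z \<in> S" "\<And>y. y \<in> S \<Longrightarrow> a \<bullet> z \<le> a \<bullet> y"
    using cell_attains_min[OF S] by blast
  define M where "M = S \<inter> {y. a \<bullet> y = a \<bullet> z}"
  have vertex: "{y} \<in> C" if "y \<in> M" for y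
  proof -
    have y: "y \<in> S" "a \<bullet> y = a \<bullet> z" using that by (auto simp: M_def)
    obtain T where T: "T \<in> C" "T \<subseteq> S" "y \<in> rel_interior T" using cell_carrier[OF S(1) y(1)] by blast
    have "a \<bullet> x = a \<bullet> y" if x: "x \<in> T" for x
    proof (rule ccontr)
      assume "a \<bullet> x \<noteq> a \<bullet> y"
      then have gt: "a \<bullet> y < a \<bullet> x" using z(2)[of x] T(2) x y by force
      obtain e where e: "e > 1" "(1 - e) *\<^sub>R x + e *\<^sub>R y \<in> T" using cell_extend[OF T(1,3) x] by blast
      have "a \<bullet> ((1 - e) *\<^sub>R x + e *\<^sub>R y) - a \<bullet> y = (e - 1) * (a \<bullet> y - a \<bullet> x)"
        by (simp add: inner_add_right algebra_simps)
      also have "\<dots> < 0" using e gt by (simp add: mult_less_0_iff)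
      finally show False using z(2)[of "(1 - e) *\<^sub>R x + e *\<^sub>R y"] e(2) T(2) y by auto
    qed
    then obtain w where "T = {w}" using gen[OF T(1)] by metis
    then show ?thesis using T(1,3) rel_interior_subset by blast
  qed
  have "y = z" if "y \<in> M" for y
  proof -
    have "convex M"
      unfolding M_def by (intro convex_Int convex_hyperplane cell_convex S)
    then have "closed_segment y z \<subseteq> M"
      using that z(1) by (intro closed_segment_subset) (auto simp: M_def)
    then have "(\<lambda>y. {y}) ` closed_segment y z \<subseteq> C" using vertex by blast
    then have "finite ((\<lambda>y. {y}) ` closed_segment y z)" using cells_finite finite_subset by blast
    then have "finite (closed_segment y z)" by (rule finite_imageD) simp
    then show ?thesis by simp
  qed
  then have "a \<bullet> z < a \<bullet> y" if "y \<in> S" "y \<noteq> z" for y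
    using that z(2)[OF that(1)] by (force simp: M_def)
  moreover have "{z} \<in> C" using vertex z(1) by (simp add: M_def)
  ultimately show ?thesis using z(1) by blast
qed

end

text \<open>From a point \<open>w\<close> of the relative interior, walk towards whichever of
  \<open>y\<close> and \<open>z\<close> lies on the other side: all points before the end stay in
  the relative interior.\<close>

lemma rel_interior_meets_hyperplane:
  fixes S :: "'a::euclidean_space set"
  assumes "convex S" "y \<in> S" "z \<in> S" "a \<bullet> y < c" "c < a \<bullet> z"
  shows "rel_interior S \<inter> {x. a \<bullet> x = c} \<noteq> {}"
proof -
  have seg: "rel_interior S \<inter> {x. a \<bullet> x = c} \<noteq> {}"
    if w: "w \<in> rel_interior S" and p: "p \<in> S" and lt: "(a \<bullet> w < c \<and> c < a \<bullet> p) \<or> (a \<bullet> p < c \<and> c < a \<bullet> w)" for w p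
  proof -
    define t where "t = (c - a \<bullet> w) / (a \<bullet> p - a \<bullet> w)"
    have t: "0 < t" "t < 1" using lt by (auto simp: t_def field_simps)
    have "w \<noteq> p" using lt by auto
    then have "(1 - t) *\<^sub>R w + t *\<^sub>R p \<in> open_segment w p" using t by (auto simp: in_segment)
    then have "(1 - t) *\<^sub>R w + t *\<^sub>R p \<in> rel_interior S"
      using rel_interior_closure_convex_segment[OF assms(1) w, of p] p closure_subset by blast
    moreover have "a \<bullet> ((1 - t) *\<^sub>R w + t *\<^sub>R p) = a \<bullet> w + t * (a \<bullet> p - a \<bullet> w)"
      by (simp add: inner_add_right algebra_simps)
    then have "a \<bullet> ((1 - t) *\<^sub>R w + t *\<^sub>R p) = c" using lt by (auto simp: t_def)
    ultimately show ?thesis by blast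
  qed
  obtain w where w: "w \<in> rel_interior S" using assms(1,2) rel_interior_eq_empty by blast
  consider "a \<bullet> w < c" | "a \<bullet> w = c" | "c < a \<bullet> w" by linarith
  then show ?thesis
    using seg[OF w assms(3)] seg[OF w assms(2)] w assms(4,5) by cases auto
qed

text \<open>Where \<open>H\<close> meets a relative interior, slicing commutes with taking it, so
  the relative interiors of the slices still partition. Cells that meet \<open>H\<close> only in
  their relative boundary are dropped: those points are covered by slices of smaller cells. A point
  of a sliced relative interior also recovers the inclusion of cells from that of slices.\<close>

lemma cell_complex_slice:
  fixes C :: "'a::euclidean_space set set" and a :: 'a and c :: real
  assumes C: "cell_complex C"
  defines "H \<equiv> {x. a \<bullet> x = c}"
  defines "R \<equiv> {S\<in>C. rel_interior S \<inter> H \<noteq> {}}"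
  shows "cell_complex ((\<lambda>S. S \<inter> H) ` R)"
    and "\<Union>((\<lambda>S. S \<inter> H) ` R) = \<Union>C \<inter> H"
    and "\<And>S T. S \<in> R \<Longrightarrow> T \<in> R \<Longrightarrow> S \<inter> H \<subseteq> T \<inter> H \<longleftrightarrow> S \<subseteq> T"
proof -
  have H: "affine H" "polyhedron H" by (simp_all add: H_def affine_hyperplane polyhedron_hyperplane)
  have ri: "rel_interior (S \<inter> H) = rel_interior S \<inter> H" if "S \<in> R" for S
    using that convex_affine_rel_interior_Int[OF cell_convex[OF C] H(1)] by (auto simp: R_def)
  have RC: "S \<in> C" if "S \<in> R" for S using that by (simp add: R_def)
  have carrier: "\<exists>T\<in>R. T \<subseteq> S \<and> y \<in> rel_interior (T \<inter> H)" if S: "S \<in> C" and y: "y \<in> S" "y \<in> H" for S y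
  proof -
    obtain T where T: "T \<in> C" "T \<subseteq> S" "y \<in> rel_interior T" using cell_carrier[OF C S y(1)] by blast
    then have "T \<in> R" using y(2) by (auto simp: R_def)
    then show ?thesis using T y(2) ri by blast
  qed
  have sub: "S \<subseteq> T" if "S \<in> R" "T \<in> R" "y \<in> rel_interior (S \<inter> H)" "y \<in> T \<inter> H" for S T y
    using that ri cell_subset[OF C RC RC] by blast
  show "cell_complex ((\<lambda>S. S \<inter> H) ` R)"
    unfolding cell_complex_def
  proof (intro conjI ballI impI)
    show "finite ((\<lambda>S. S \<inter> H) ` R)" using cells_finite[OF C] by (simp add: R_def)
  next
    fix S' assume "S' \<in> (\<lambda>S. S \<inter> H) ` R"
    then obtain S where S: "S \<in> R" "S' = S \<inter> H" by blast
    then show "polyhedron S'" using cell_polyhedron[OF C RC] H by simp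
    show "S' \<noteq> {}" using S rel_interior_subset by (auto simp: R_def)
    show "\<exists>T\<in>(\<lambda>S. S \<inter> H) ` R. T \<subseteq> S' \<and> y \<in> rel_interior T" if y: "y \<in> S'" for y
    proof -
      have "y \<in> S" "y \<in> H" using y S(2) by simp_all
      then obtain T where T: "T \<in> R" "T \<subseteq> S" "y \<in> rel_interior (T \<inter> H)"
        using carrier[OF RC[OF S(1)]] by metis
      moreover have "T \<inter> H \<subseteq> S'" using T(2) S(2) by blast
      ultimately show ?thesis by blast
    qed
  next
    fix S' T' assume "S' \<in> (\<lambda>S. S \<inter> H) ` R" "T' \<in> (\<lambda>S. S \<inter> H) ` R"
      and ne: "rel_interior S' \<inter> T' \<noteq> {}"
    then obtain S T where ST: "S \<in> R" "S' = S \<inter> H" "T \<in> R" "T' = T \<inter> H" by (elim imageE)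
    obtain y where y: "y \<in> rel_interior (S \<inter> H)" "y \<in> T \<inter> H" using ne ST by blast
    show "S' \<subseteq> T'" using sub[OF ST(1,3) y] ST(2,4) by blast
  qed
  show "\<Union>((\<lambda>S. S \<inter> H) ` R) = \<Union>C \<inter> H"
  proof (intro equalityI subsetI)
    fix y assume "y \<in> \<Union>C \<inter> H"
    then obtain S where "S \<in> C" "y \<in> S" "y \<in> H" by blast
    then obtain T where "T \<in> R" "y \<in> rel_interior (T \<inter> H)" using carrier by blast
    then show "y \<in> \<Union>((\<lambda>S. S \<inter> H) ` R)" using rel_interior_subset by blast
  qed (use RC in blast)
  show "S \<inter> H \<subseteq> T \<inter> H \<longleftrightarrow> S \<subseteq> T" if ST: "S \<in> R" "T \<in> R" for S T
  proof
    assume le: "S \<inter> H \<subseteq> T \<inter> H"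
    obtain y where "y \<in> rel_interior S" "y \<in> H" using ST(1) by (auto simp: R_def)
    then show "S \<subseteq> T"
      using sub[OF ST] ri[OF ST(1)] le rel_interior_subset by blast
  qed blast
qed

section \<open>Tangent cones and lower links of vertices\<close>

definition tangent_cone :: "'a::real_vector \<Rightarrow> 'a set \<Rightarrow> 'a set" where
  "tangent_cone v S = {u. \<exists>e>0. v + e *\<^sub>R u \<in> S}"

lemma convex_point_between:
  fixes u :: "'a::real_vector"
  assumes "convex S" "v \<in> S" "v + e *\<^sub>R u \<in> S" "0 \<le> t" "t \<le> e"
  shows "v + t *\<^sub>R u \<in> S"
proof (cases "e = 0")
  case False
  then have e: "e > 0" using assms by simp
  have "(1 - t / e) *\<^sub>R v + (t / e) *\<^sub>R (v + e *\<^sub>R u) \<in> S"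
    using assms e by (intro convexD) (auto simp: field_simps)
  also have "(1 - t / e) *\<^sub>R v + (t / e) *\<^sub>R (v + e *\<^sub>R u) = v + t *\<^sub>R u"
    using e by (simp add: algebra_simps)
  finally show ?thesis .
qed (use assms in simp)

text \<open>Only the half-spaces active at \<open>v\<close> constrain the directions, and they do so
  homogeneously; the finitely many others hold strictly at \<open>v\<close> and so survive a common
  small step.\<close>

lemma polyhedron_tangent_cone:
  fixes S :: "'a::euclidean_space set"
  assumes "polyhedron S" "v \<in> S"
  shows "polyhedron (tangent_cone v S)"
proof -
  obtain F where F: "finite F" "S = \<Inter>F" "\<And>h. h \<in> F \<Longrightarrow> \<exists>a b. a \<noteq> 0 \<and> h = {x. a \<bullet> x \<le> b}"
    using assms(1) unfolding polyhedron_def by metis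
  then obtain A B where AB: "\<And>h. h \<in> F \<Longrightarrow> h = {x. A h \<bullet> x \<le> B h}" by metis
  have v: "A h \<bullet> v \<le> B h" if "h \<in> F" for h using that assms(2) F(2) AB by blast
  let ?G = "{h\<in>F. A h \<bullet> v = B h}"
  have "tangent_cone v S = \<Inter>((\<lambda>h. {u. A h \<bullet> u \<le> 0}) ` ?G)"
  proof (intro equalityI subsetI)
    fix u assume "u \<in> tangent_cone v S"
    then obtain e where e: "e > 0" "v + e *\<^sub>R u \<in> S" by (auto simp: tangent_cone_def)
    have "A h \<bullet> u \<le> 0" if "h \<in> ?G" for h
    proof -
      have "A h \<bullet> (v + e *\<^sub>R u) \<le> B h" using that e(2) F(2) AB by blast
      then have "e * (A h \<bullet> u) \<le> 0" using that by (simp add: inner_add_right)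
      then show ?thesis using e(1) by (simp add: mult_le_0_iff)
    qed
    then show "u \<in> \<Inter>((\<lambda>h. {u. A h \<bullet> u \<le> 0}) ` ?G)" by blast
  next
    fix u assume u: "u \<in> \<Inter>((\<lambda>h. {u. A h \<bullet> u \<le> 0}) ` ?G)"
    have "eventually (\<lambda>t. v + t *\<^sub>R u \<in> h) (at_right 0)" if h: "h \<in> F" for h
    proof (cases "A h \<bullet> u \<le> 0")
      case True
      have "v + t *\<^sub>R u \<in> h" if "t > 0" for t
      proof -
        have "t * (A h \<bullet> u) \<le> 0" using True that by (simp add: mult_le_0_iff)
        then have "A h \<bullet> (v + t *\<^sub>R u) \<le> B h"
          using v[OF h] by (simp add: inner_add_right)
        then show ?thesis using AB[OF h] by blast
      qed
      then show ?thesis by (auto simp: eventually_at_right_field intro: exI[of _ 1])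
    next
      case False
      then have pos: "A h \<bullet> u > 0" by simp
      then have "h \<notin> ?G" using u by force
      then have lt: "A h \<bullet> v < B h" using v[OF h] h by simp
      have "v + t *\<^sub>R u \<in> h" if "0 < t" "t < (B h - A h \<bullet> v) / (A h \<bullet> u)" for t
      proof -
        have "t * (A h \<bullet> u) < B h - A h \<bullet> v" using that(2) pos by (simp add: field_simps)
        then have "A h \<bullet> (v + t *\<^sub>R u) \<le> B h" by (simp add: inner_add_right)
        then show ?thesis using AB[OF h] by blast
      qed
      moreover have "(B h - A h \<bullet> v) / (A h \<bullet> u) > 0" using lt pos by simp
      ultimately show ?thesis unfolding eventually_at_right_field by blast
    qed
    then have "eventually (\<lambda>t. \<forall>h\<in>F. v + t *\<^sub>R u \<in> h) (at_right 0)"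
      using F(1) by (intro eventually_ball_finite) auto
    then obtain b where "b > 0" "\<And>t. 0 < t \<Longrightarrow> t < b \<Longrightarrow> \<forall>h\<in>F. v + t *\<^sub>R u \<in> h"
      unfolding eventually_at_right_field by blast
    then have "v + (b / 2) *\<^sub>R u \<in> S" "b / 2 > 0" using F(2) by simp_all
    then show "u \<in> tangent_cone v S" unfolding tangent_cone_def by blast
  qed
  moreover have "polyhedron (\<Inter>((\<lambda>h. {u. A h \<bullet> u \<le> 0}) ` ?G))"
    using F(1) by (intro polyhedron_Inter) (auto simp: polyhedron_halfspace_le)
  ultimately show ?thesis by simp
qed

text \<open>The lower link at a vertex \<open>v\<close>: the tangent cones are cut by the hyperplane one unit below
  the apex, which leaves (possibly unbounded) polyhedra one dimension lower.\<close>
definition lower_slice :: "'a::real_inner \<Rightarrow> 'a \<Rightarrow> 'a set \<Rightarrow> 'a set" where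
  "lower_slice a v S = tangent_cone v S \<inter> {u. a \<bullet> u = -1}"

lemma lower_slice_nonempty:
  assumes "y \<in> S" "a \<bullet> y < a \<bullet> v"
  shows "(1 / (a \<bullet> v - a \<bullet> y)) *\<^sub>R (y - v) \<in> lower_slice a v S"
proof -
  define d where "d = a \<bullet> v - a \<bullet> y"
  have d: "d > 0" using assms(2) by (simp add: d_def)
  have "a \<bullet> (y - v) = - d" by (simp add: d_def inner_diff_right)
  then have "a \<bullet> ((1 / d) *\<^sub>R (y - v)) = -1" using d by simp
  moreover have "v + d *\<^sub>R ((1 / d) *\<^sub>R (y - v)) \<in> S" using assms(1) d by simp
  ultimately show ?thesis
    using d unfolding lower_slice_def tangent_cone_def d_def[symmetric] by blast
qed

lemma convex_rel_interior_between:
  fixes u :: "'a::euclidean_space"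
  assumes "convex S" "v \<in> S" "v + e *\<^sub>R u \<in> rel_interior S" "0 < t" "t \<le> e"
  shows "v + t *\<^sub>R u \<in> rel_interior S"
proof (cases "t = e \<or> u = 0")
  case False
  have "(1 - (1 - t / e)) *\<^sub>R (v + e *\<^sub>R u) + (1 - t / e) *\<^sub>R v = v + t *\<^sub>R u"
    using assms(4,5) by (simp add: algebra_simps)
  moreover have "(1 - (1 - t / e)) *\<^sub>R (v + e *\<^sub>R u) + (1 - t / e) *\<^sub>R v \<in> open_segment (v + e *\<^sub>R u) v"
    unfolding in_segment using assms(4,5) False by (intro conjI exI[of _ "1 - t / e"]) auto
  ultimately show ?thesis
    using rel_interior_closure_convex_segment[OF assms(1,3), of v] assms(2) closure_subset by auto
qed (use assms in auto)

text \<open>Points of a relative interior are those beyond which every segment can be prolonged, and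
  prolongations in the slice and in \<open>S\<close> correspond under scaling from
  \<open>v\<close>.\<close>

lemma rel_interior_lower_slice:
  fixes S :: "'a::euclidean_space set"
  assumes S: "polyhedron S" "v \<in> S" and low: "\<exists>y\<in>S. a \<bullet> y < a \<bullet> v"
  shows "z \<in> rel_interior (lower_slice a v S) \<longleftrightarrow>
    a \<bullet> z = -1 \<and> (\<exists>e>0. v + e *\<^sub>R z \<in> rel_interior S)"
proof -
  let ?L = "lower_slice a v S"
  have cS: "convex S" using S polyhedron_imp_convex by blast
  have pL: "polyhedron ?L"
    unfolding lower_slice_def by (intro polyhedron_Int polyhedron_tangent_cone S polyhedron_hyperplane)
  then have cL: "convex ?L" using polyhedron_imp_convex by blast
  have neL: "?L \<noteq> {}" using low lower_slice_nonempty by blast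
  show ?thesis
  proof
    assume z: "z \<in> rel_interior ?L"
    then have zL: "z \<in> ?L" using rel_interior_subset by blast
    obtain y where y: "y \<in> S" "a \<bullet> y < a \<bullet> v" using low by blast
    \<comment> \<open>The open half-space below \<open>v\<close> meets \<open>S\<close>, hence also
      the relative interior, which is dense in \<open>S\<close>.\<close>
    obtain y0 where y0: "y0 \<in> rel_interior S" "a \<bullet> y0 < a \<bullet> v"
    proof -
      have "y \<in> closure (rel_interior S)"
        using y(1) convex_closure_rel_interior[OF cS] closure_subset by blast
      moreover have "open {x. a \<bullet> x < a \<bullet> v}" by (simp add: open_halfspace_lt)
      ultimately have "rel_interior S \<inter> {x. a \<bullet> x < a \<bullet> v} \<noteq> {}"
        using y(2) open_Int_closure_eq_empty[of "{x. a \<bullet> x < a \<bullet> v}" "rel_interior S"] by blast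
      then show ?thesis using that by blast
    qed
    define d where "d = a \<bullet> v - a \<bullet> y0"
    define x where "x = (1 / d) *\<^sub>R (y0 - v)"
    have d: "d > 0" using y0 by (simp add: d_def)
    have xL: "x \<in> ?L"
      using lower_slice_nonempty[of y0 S a v] y0 rel_interior_subset by (auto simp: x_def d_def)
    have vx: "v + d *\<^sub>R x \<in> rel_interior S" using d y0 by (simp add: x_def)
    obtain e where e: "e > 1" "(1 - e) *\<^sub>R x + e *\<^sub>R z \<in> ?L"
      using z xL convex_rel_interior_iff[OF cL neL] by blast
    define w where "w = (1 - e) *\<^sub>R x + e *\<^sub>R z"
    obtain f where f: "f > 0" "v + f *\<^sub>R w \<in> S"
      using e(2) by (auto simp: lower_slice_def tangent_cone_def w_def)
    define t where "t = min d f"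
    have t: "t > 0" using d f by (simp add: t_def)
    have p: "v + t *\<^sub>R x \<in> rel_interior S" using convex_rel_interior_between[OF cS S(2) vx, of t] t by (simp add: t_def)
    have q: "v + t *\<^sub>R w \<in> S"
      by (rule convex_point_between[OF cS S(2) f(2)]) (use t in \<open>auto simp: t_def\<close>)
    \<comment> \<open>\<open>w\<close> was found beyond \<open>z\<close> as seen from
      \<open>x\<close>, so at the common scale \<open>t\<close> the point for \<open>z\<close> lies
      between one in the relative interior and one in \<open>S\<close>.\<close>
    have zw: "v + t *\<^sub>R z = (1 - 1 / e) *\<^sub>R (v + t *\<^sub>R x) + (1 / e) *\<^sub>R (v + t *\<^sub>R w)"
      using e(1) by (simp add: w_def algebra_simps)
    have "v + t *\<^sub>R z \<in> rel_interior S"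
    proof (cases "v + t *\<^sub>R x = v + t *\<^sub>R w")
      case True
      have "v + t *\<^sub>R z = ((1 - 1 / e) + 1 / e) *\<^sub>R (v + t *\<^sub>R x)"
        unfolding zw True[symmetric] by (simp only: scaleR_left_distrib)
      then have "v + t *\<^sub>R z = v + t *\<^sub>R x" by simp
      then show ?thesis using p by metis
    next
      case False
      have "v + t *\<^sub>R z \<in> open_segment (v + t *\<^sub>R x) (v + t *\<^sub>R w)"
        unfolding in_segment zw using False e(1) by (intro conjI exI[of _ "1 / e"]) auto
      then show ?thesis
        using rel_interior_closure_convex_segment[OF cS p, of "v + t *\<^sub>R w"] q closure_subset by blast
    qed
    then show "a \<bullet> z = -1 \<and> (\<exists>e>0. v + e *\<^sub>R z \<in> rel_interior S)"
      using zL t by (auto simp: lower_slice_def)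
  next
    assume "a \<bullet> z = -1 \<and> (\<exists>e>0. v + e *\<^sub>R z \<in> rel_interior S)"
    then obtain f where z: "a \<bullet> z = -1" and f: "f > 0" "v + f *\<^sub>R z \<in> rel_interior S" by blast
    have "\<exists>e>1. (1 - e) *\<^sub>R x + e *\<^sub>R z \<in> ?L" if x: "x \<in> ?L" for x
    proof -
      obtain d' where d': "d' > 0" "v + d' *\<^sub>R x \<in> S" using x by (auto simp: lower_slice_def tangent_cone_def)
      \<comment> \<open>Capping by \<open>f\<close> keeps \<open>s\<close>, the drop of the
        prolonged point below \<open>v\<close>, positive: it is at least \<open>f\<close>.\<close>
      define d where "d = min d' f"
      have d: "d > 0" "d \<le> f" using d' f by (simp_all add: d_def)
      have dx: "v + d *\<^sub>R x \<in> S"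
        by (rule convex_point_between[OF cS S(2) d'(2)]) (use d in \<open>auto simp: d_def\<close>)
      obtain e where e: "e > 1" "(1 - e) *\<^sub>R (v + d *\<^sub>R x) + e *\<^sub>R (v + f *\<^sub>R z) \<in> S"
        using f(2) dx convex_rel_interior_iff[OF cS] S(2) by (metis empty_iff)
      define s where "s = (1 - e) * d + e * f"
      have s: "s > 0"
      proof -
        have "s = f + (e - 1) * (f - d)" by (simp add: s_def algebra_simps)
        moreover have "(e - 1) * (f - d) \<ge> 0" using e d by simp
        ultimately show ?thesis using f(1) by linarith
      qed
      \<comment> \<open>Dividing the displacement of the prolonged point from \<open>v\<close> by
        \<open>s\<close> brings it to height -1; the result prolongs the segment from
        \<open>x\<close> through \<open>z\<close> by the factor \<open>g\<close>.\<close>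
      define g where "g = e * f / s"
      have g1: "g > 1"
      proof -
        have "e * f - s = (e - 1) * d" by (simp add: s_def algebra_simps)
        moreover have "(e - 1) * d > 0" using e d by simp
        ultimately show ?thesis using s by (simp add: g_def)
      qed
      have sg: "s * g = e * f" "s * (1 - g) = (1 - e) * d" using s by (simp_all add: g_def s_def field_simps)
      have "(1 - e) *\<^sub>R (v + d *\<^sub>R x) + e *\<^sub>R (v + f *\<^sub>R z) = v + ((1 - e) * d) *\<^sub>R x + (e * f) *\<^sub>R z"
        by (simp add: algebra_simps)
      also have "\<dots> = v + s *\<^sub>R ((1 - g) *\<^sub>R x + g *\<^sub>R z)"
        unfolding sg[symmetric] by (simp add: scaleR_right_distrib)
      finally have "v + s *\<^sub>R ((1 - g) *\<^sub>R x + g *\<^sub>R z) \<in> S" using e(2) by simp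
      moreover have "a \<bullet> ((1 - g) *\<^sub>R x + g *\<^sub>R z) = -1"
        using x z by (simp add: inner_add_right lower_slice_def)
      ultimately have "(1 - g) *\<^sub>R x + g *\<^sub>R z \<in> ?L"
        using s by (auto simp: lower_slice_def tangent_cone_def)
      then show ?thesis using g1 by blast
    qed
    then show "z \<in> rel_interior ?L" using convex_rel_interior_iff[OF cL neL] by blast
  qed
qed

text \<open>The cells avoiding \<open>v\<close> have a closed union, so a small ball around
  \<open>v\<close> meets only cells through \<open>v\<close>. Using \<open>norm u + 1\<close> keeps
  the denominator of \<open>d\<close> positive.\<close>

lemma cells_along_ray:
  fixes C :: "'a::euclidean_space set set"
  assumes C: "cell_complex C"
  shows "\<exists>d>0. \<forall>t. 0 < t \<and> t \<le> d \<longrightarrow> (\<forall>T\<in>C. v + t *\<^sub>R u \<in> T \<longrightarrow> v \<in> T)"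
proof -
  let ?U = "\<Union>{T\<in>C. v \<notin> T}"
  have "closed ?U" using cells_finite[OF C] cell_closed[OF C] by (intro closed_Union) auto
  then have "open (- ?U)" by (simp add: open_closed)
  then obtain r where r: "r > 0" "ball v r \<subseteq> - ?U" by (rule openE[of _ v]) auto
  define d where "d = r / (2 * (norm u + 1))"
  have "v \<in> T" if "0 < t" "t \<le> d" "T \<in> C" "v + t *\<^sub>R u \<in> T" for t T
  proof -
    have n: "r / (2 * k) * k = r / 2" if "k > 0" for k :: real using that by simp
    have "norm (t *\<^sub>R u) \<le> d * (norm u + 1)"
      using that(1,2) by (simp add: mult_mono)
    also have "\<dots> = r / 2" unfolding d_def by (rule n) (simp add: add_nonneg_pos)
    also have "\<dots> < r" using r by simp
    finally have "v + t *\<^sub>R u \<in> ball v r" by (simp add: dist_norm)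
    then show ?thesis using r(2) that(3,4) by blast
  qed
  moreover have "d > 0" using r by (simp add: d_def add_nonneg_pos)
  ultimately show ?thesis by blast
qed

lemma lower_slice_mono: "S \<subseteq> T \<Longrightarrow> lower_slice a v S \<subseteq> lower_slice a v T"
  by (auto simp: lower_slice_def tangent_cone_def)

text \<open>Every condition at a direction is tested at a point of the ray from \<open>v\<close>
  close to \<open>v\<close>: there only cells through \<open>v\<close> occur, and by
  \<open>rel_interior_lower_slice\<close> the relative interiors of a cell and of its slice agree
  along the ray, so the axioms carry over from \<open>C\<close>.\<close>

lemma cell_complex_link:
  fixes C :: "'a::euclidean_space set set" and a v :: 'a
  assumes C: "cell_complex C"
  defines "N \<equiv> {S\<in>C. v \<in> S \<and> (\<exists>y\<in>S. a \<bullet> y < a \<bullet> v)}"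
  shows "cell_complex (lower_slice a v ` N)"
    and "\<And>S T. S \<in> N \<Longrightarrow> T \<in> N \<Longrightarrow> lower_slice a v S \<subseteq> lower_slice a v T \<longleftrightarrow> S \<subseteq> T"
proof -
  let ?L = "lower_slice a v"
  have N: "S \<in> C" "v \<in> S" "\<exists>y\<in>S. a \<bullet> y < a \<bullet> v" "polyhedron S" "convex S" if "S \<in> N" for S
    using that cell_polyhedron[OF C] cell_convex[OF C] by (auto simp: N_def)
  have ri: "z \<in> rel_interior (?L S) \<longleftrightarrow> a \<bullet> z = -1 \<and> (\<exists>e>0. v + e *\<^sub>R z \<in> rel_interior S)"
    if "S \<in> N" for S z
    by (rule rel_interior_lower_slice[OF N(4)[OF that] N(2)[OF that] N(3)[OF that]])
  have poly: "polyhedron (?L S)" "?L S \<noteq> {}" if "S \<in> N" for S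
  proof -
    show "polyhedron (?L S)"
      unfolding lower_slice_def
      by (intro polyhedron_Int polyhedron_tangent_cone N[OF that] polyhedron_hyperplane)
    show "?L S \<noteq> {}" using lower_slice_nonempty N(3)[OF that] by blast
  qed
  have carrier: "\<exists>T\<in>N. T \<subseteq> S \<and> u \<in> rel_interior (?L T)" if S: "S \<in> N" and u: "u \<in> ?L S" for S u
  proof -
    obtain e where e: "e > 0" "v + e *\<^sub>R u \<in> S" and au: "a \<bullet> u = -1"
      using u by (auto simp: lower_slice_def tangent_cone_def)
    obtain d where d: "d > 0" "\<And>t T. 0 < t \<Longrightarrow> t \<le> d \<Longrightarrow> T \<in> C \<Longrightarrow> v + t *\<^sub>R u \<in> T \<Longrightarrow> v \<in> T"
      using cells_along_ray[OF C, of v u] by blast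
    define t where "t = min d e"
    have t: "t > 0" "t \<le> d" "t \<le> e" using d(1) e(1) by (simp_all add: t_def)
    have "v + t *\<^sub>R u \<in> S"
      by (rule convex_point_between[OF N(5)[OF S] N(2)[OF S] e(2)]) (use t in auto)
    then obtain T where T: "T \<in> C" "T \<subseteq> S" "v + t *\<^sub>R u \<in> rel_interior T"
      using cell_carrier[OF C N(1)[OF S]] by blast
    then have vT: "v + t *\<^sub>R u \<in> T" using rel_interior_subset by blast
    moreover have "a \<bullet> (v + t *\<^sub>R u) < a \<bullet> v" using au t by (simp add: inner_add_right)
    ultimately have "T \<in> N" unfolding N_def using T(1) d(2)[OF t(1,2) T(1) vT] by blast
    moreover have "u \<in> rel_interior (?L T)" using ri[OF calculation] au t(1) T(3) by blast
    ultimately show ?thesis using T(2) by blast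
  qed
  have sub: "S \<subseteq> T" if S: "S \<in> N" and T: "T \<in> N" and z: "z \<in> rel_interior (?L S)" "z \<in> ?L T" for S T z
  proof -
    obtain e f where e: "e > 0" "v + e *\<^sub>R z \<in> rel_interior S" and f: "f > 0" "v + f *\<^sub>R z \<in> T"
      using z ri[OF S] by (auto simp: lower_slice_def tangent_cone_def)
    define t where "t = min e f"
    have t: "t > 0" "t \<le> e" "t \<le> f" using e(1) f(1) by (simp_all add: t_def)
    have "v + t *\<^sub>R z \<in> rel_interior S"
      by (rule convex_rel_interior_between[OF N(5)[OF S] N(2)[OF S] e(2)]) (use t in auto)
    moreover have "v + t *\<^sub>R z \<in> T"
      by (rule convex_point_between[OF N(5)[OF T] N(2)[OF T] f(2)]) (use t in auto)
    ultimately show ?thesis using cell_subset[OF C N(1)[OF S] N(1)[OF T]] by blast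
  qed
  show "cell_complex (?L ` N)"
    unfolding cell_complex_def
  proof (intro conjI ballI impI)
    show "finite (?L ` N)" using cells_finite[OF C] by (simp add: N_def)
  next
    fix S' assume "S' \<in> ?L ` N"
    then obtain S where S: "S \<in> N" "S' = ?L S" by (elim imageE)
    then show "polyhedron S'" "S' \<noteq> {}" using poly by simp_all
    show "\<exists>T\<in>?L ` N. T \<subseteq> S' \<and> y \<in> rel_interior T" if y: "y \<in> S'" for y
    proof -
      obtain T where T: "T \<in> N" "T \<subseteq> S" "y \<in> rel_interior (?L T)" using carrier[OF S(1)] y S(2) by blast
      then have "?L T \<subseteq> S'" using lower_slice_mono S(2) by simp
      then show ?thesis using T by blast
    qed
  next
    fix S' T' assume "S' \<in> ?L ` N" "T' \<in> ?L ` N" and ne: "rel_interior S' \<inter> T' \<noteq> {}"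
    then obtain S T where ST: "S \<in> N" "S' = ?L S" "T \<in> N" "T' = ?L T" by (elim imageE)
    obtain y where y: "y \<in> rel_interior (?L S)" "y \<in> ?L T" using ne ST by blast
    show "S' \<subseteq> T'" using sub[OF ST(1,3) y] ST(2,4) by (simp add: lower_slice_mono)
  qed
  show "?L S \<subseteq> ?L T \<longleftrightarrow> S \<subseteq> T" if ST: "S \<in> N" "T \<in> N" for S T
  proof
    assume le: "?L S \<subseteq> ?L T"
    have "rel_interior (?L S) \<noteq> {}"
      using poly[OF ST(1)] polyhedron_imp_convex rel_interior_eq_empty by blast
    then obtain z where "z \<in> rel_interior (?L S)" by blast
    then show "S \<subseteq> T" using sub[OF ST] le rel_interior_subset by blast
  qed (rule lower_slice_mono)
qed

text \<open>The new centre is \<open>w\<close>, the direction from \<open>v\<close> to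
  \<open>x\<close> scaled to drop by one. A point near \<open>v\<close> in a direction between
  \<open>u\<close> and \<open>w\<close> lies on a segment from \<open>x\<close> to a point in
  direction \<open>u\<close> from \<open>v\<close>, and such segments stay in the union of
  \<open>C\<close>.\<close>

lemma starlike_link:
  fixes C :: "'a::euclidean_space set set" and a v :: 'a
  assumes C: "cell_complex C"
    and x: "x \<in> \<Union>C" "\<And>y. y \<in> \<Union>C \<Longrightarrow> closed_segment x y \<subseteq> \<Union>C" "a \<bullet> x < a \<bullet> v"
    and v: "v \<in> \<Union>C"
  shows "starlike (\<Union>(lower_slice a v ` {S\<in>C. v \<in> S \<and> (\<exists>y\<in>S. a \<bullet> y < a \<bullet> v)}))"
proof -
  define W where "W = \<Union>(lower_slice a v ` {S\<in>C. v \<in> S \<and> (\<exists>y\<in>S. a \<bullet> y < a \<bullet> v)})"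
  define d where "d = a \<bullet> v - a \<bullet> x"
  define w where "w = (1 / d) *\<^sub>R (x - v)"
  have d: "d > 0" using x(3) by (simp add: d_def)
  have "a \<bullet> (x - v) = - d" by (simp add: d_def inner_diff_right)
  then have aw: "a \<bullet> w = -1" using d by (simp add: w_def)
  have xw: "x = v + d *\<^sub>R w" using d by (simp add: w_def)
  have WI: "q \<in> W" if q: "a \<bullet> q = -1" and e: "e > 0" "\<And>t. 0 < t \<Longrightarrow> t \<le> e \<Longrightarrow> v + t *\<^sub>R q \<in> \<Union>C" for q e
  proof -
    obtain b where b: "b > 0" "\<And>t T. 0 < t \<Longrightarrow> t \<le> b \<Longrightarrow> T \<in> C \<Longrightarrow> v + t *\<^sub>R q \<in> T \<Longrightarrow> v \<in> T"
      using cells_along_ray[OF C, of v q] by blast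
    define t where "t = min b e"
    have t: "t > 0" "t \<le> b" "t \<le> e" using b(1) e(1) by (simp_all add: t_def)
    obtain T where T: "T \<in> C" "v + t *\<^sub>R q \<in> T" using e(2)[OF t(1,3)] by blast
    have vT: "v \<in> T" using b(2)[OF t(1,2) T] .
    have "a \<bullet> (v + t *\<^sub>R q) < a \<bullet> v" using q t by (simp add: inner_add_right)
    moreover have "q \<in> lower_slice a v T"
      using T(2) t(1) q by (auto simp: lower_slice_def tangent_cone_def)
    ultimately show ?thesis unfolding W_def using T vT by blast
  qed
  have comb: "(1 - l) *\<^sub>R u + l *\<^sub>R w \<in> W"
    if au: "a \<bullet> u = -1" and S: "S \<in> C" "v \<in> S" and e: "e > 0" "v + e *\<^sub>R u \<in> S"
      and l: "0 \<le> l" "l \<le> 1" for l u S e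
  proof (rule WI)
    show "a \<bullet> ((1 - l) *\<^sub>R u + l *\<^sub>R w) = -1" using au aw by (simp add: inner_add_right)
    \<comment> \<open>The two bounds serve \<open>s \<le> 1 / 2\<close> and \<open>f \<le> e\<close>
      below.\<close>
    show "min (d / 2) (e / 2) > 0" using d e by simp
    show "v + t *\<^sub>R ((1 - l) *\<^sub>R u + l *\<^sub>R w) \<in> \<Union>C" if t: "0 < t" "t \<le> min (d / 2) (e / 2)" for t
    proof -
      \<comment> \<open>Solving \<open>s * d = t * l\<close> and
        \<open>(1 - s) * f = t * (1 - l)\<close> expresses the point as a combination of
        \<open>x\<close> with weight \<open>s\<close> and the point at distance \<open>f\<close> in
        direction \<open>u\<close> with weight \<open>1 - s\<close>.\<close>
      define s where "s = t * l / d"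
      have s0: "0 \<le> s" using t l d by (simp add: s_def)
      have "t * l \<le> (d / 2) * 1" using t l d by (intro mult_mono) auto
      then have s1: "s \<le> 1 / 2" using d by (simp add: s_def field_simps)
      define f where "f = t * (1 - l) / (1 - s)"
      have f0: "0 \<le> f" using t l s1 by (simp add: f_def)
      have "t * (1 - l) \<le> (e / 2) * 1" using t l e by (intro mult_mono) auto
      also have "\<dots> \<le> e * (1 - s)" using s1 e by (simp add: field_simps)
      finally have fe: "f \<le> e" using s1 by (simp add: f_def field_simps)
      have "v + f *\<^sub>R u \<in> S"
        by (rule convex_point_between[OF cell_convex[OF C S(1)] S(2) e(2) f0 fe])
      then have "closed_segment x (v + f *\<^sub>R u) \<subseteq> \<Union>C" using x(2) S(1) by blast
      moreover have "(1 - (1 - s)) *\<^sub>R x + (1 - s) *\<^sub>R (v + f *\<^sub>R u) \<in> closed_segment x (v + f *\<^sub>R u)"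
        unfolding in_segment using s0 s1 by (intro exI[of _ "1 - s"]) auto
      moreover have "(1 - (1 - s)) *\<^sub>R x + (1 - s) *\<^sub>R (v + f *\<^sub>R u) = v + t *\<^sub>R ((1 - l) *\<^sub>R u + l *\<^sub>R w)"
      proof -
        have "(1 - s) * f = t * (1 - l)" using s1 by (simp add: f_def)
        moreover have "s * d = t * l" using d by (simp add: s_def)
        moreover have "(1 - (1 - s)) *\<^sub>R x + (1 - s) *\<^sub>R (v + f *\<^sub>R u)
            = v + ((1 - s) * f) *\<^sub>R u + (s * d) *\<^sub>R w"
          unfolding xw by (simp add: algebra_simps)
        ultimately show ?thesis by (simp add: scaleR_right_distrib)
      qed
      ultimately show ?thesis by (metis subsetD)
    qed
  qed
  have "w \<in> W"
  proof (rule WI[OF aw d])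
    show "v + t *\<^sub>R w \<in> \<Union>C" if "0 < t" "t \<le> d" for t
    proof -
      have "(1 - (1 - t / d)) *\<^sub>R x + (1 - t / d) *\<^sub>R v \<in> closed_segment x v"
        unfolding in_segment using that by (intro exI[of _ "1 - t / d"]) auto
      moreover have "(1 - (1 - t / d)) *\<^sub>R x + (1 - t / d) *\<^sub>R v = v + t *\<^sub>R w"
        using d by (simp add: xw algebra_simps)
      ultimately show ?thesis using x(2)[OF v] by (metis subsetD)
    qed
  qed
  moreover have "closed_segment w u \<subseteq> W" if u: "u \<in> W" for u
  proof
    fix q assume "q \<in> closed_segment w u"
    then obtain l where l: "0 \<le> l" "l \<le> 1" "q = (1 - l) *\<^sub>R u + l *\<^sub>R w"
      unfolding closed_segment_commute[of w u] in_segment by blast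
    obtain S e where "S \<in> C" "v \<in> S" "a \<bullet> u = -1" "e > 0" "v + e *\<^sub>R u \<in> S"
      using u by (auto simp: W_def lower_slice_def tangent_cone_def)
    then show "q \<in> W" unfolding l(3) using comb l(1,2) by blast
  qed
  ultimately show ?thesis unfolding starlike_def W_def by blast
qed

text \<open>All directions lie in the span \<open>L\<close> of the differences from
  \<open>v\<close>, cut by a hyperplane that misses the origin and so does not contain
  \<open>L\<close>; there the dimension drops.\<close>

lemma aff_dim_link:
  fixes U :: "'a::euclidean_space set"
  assumes v: "v \<in> U" and W: "W \<subseteq> {u. a \<bullet> u = -1 \<and> (\<exists>e>0. v + e *\<^sub>R u \<in> U)}"
  shows "aff_dim W < aff_dim U"
proof -
  define L where "L = span ((\<lambda>y. - v + y) ` U)"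
  have dimU: "aff_dim U = int (dim L)" using aff_dim_eq_dim[of v U] v hull_inc by (force simp: L_def)
  have L: "subspace L" by (simp add: L_def)
  have "u \<in> L" if u: "u \<in> W" for u
  proof -
    obtain e where e: "e > 0" "v + e *\<^sub>R u \<in> U" using u W by blast
    have "- v + (v + e *\<^sub>R u) \<in> L" unfolding L_def using e(2) by (intro span_base imageI)
    then have "e *\<^sub>R u \<in> L" by simp
    then show ?thesis using e(1) subspace_scale[OF L, of "e *\<^sub>R u" "1 / e"] by simp
  qed
  then have "aff_dim W \<le> aff_dim (L \<inter> {u. a \<bullet> u = -1})" using W by (intro aff_dim_subset) blast
  also have "\<dots> < aff_dim L"
  proof -
    have "0 \<in> L" using L subspace_0 by blast
    then have "\<not> L \<subseteq> {u. a \<bullet> u = -1}" by force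
    moreover have "aff_dim L \<ge> 0" using \<open>0 \<in> L\<close> by (metis aff_dim_negative_iff empty_iff linorder_not_less)
    ultimately show ?thesis
      using aff_dim_affine_Int_hyperplane[OF subspace_imp_affine[OF L], of a "-1"] by auto
  qed
  also have "\<dots> = aff_dim U" by (simp add: dimU aff_dim_subspace[OF L])
  finally show ?thesis .
qed

lemma aff_dim_slice:
  fixes U :: "'a::euclidean_space set"
  assumes "y \<in> U" "z \<in> U" "a \<bullet> y \<noteq> a \<bullet> z"
  shows "aff_dim (U \<inter> {x. a \<bullet> x = c}) < aff_dim U"
proof -
  have yz: "y \<in> affine hull U" "z \<in> affine hull U" using assms by (simp_all add: hull_inc)
  have "aff_dim (U \<inter> {x. a \<bullet> x = c}) \<le> aff_dim (affine hull U \<inter> {x. a \<bullet> x = c})"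
    using hull_subset[of U affine] by (intro aff_dim_subset) blast
  also have "\<dots> < aff_dim (affine hull U)"
  proof -
    have "\<not> affine hull U \<subseteq> {x. a \<bullet> x = c}" using yz assms(3) by auto
    moreover have "aff_dim (affine hull U) \<ge> 0"
      using yz by (metis aff_dim_negative_iff empty_iff linorder_not_less)
    ultimately show ?thesis
      using aff_dim_affine_Int_hyperplane[OF affine_affine_hull, of U a c] by (auto simp del: aff_dim_affine_hull)
  qed
  finally show ?thesis by simp
qed

theorem cell_complex_nonevasive:
  fixes C :: "'a::euclidean_space set set"
  assumes "cell_complex C" "starlike (\<Union>C)"
  shows "nonevasive (order_complex C)"
  using assms
proof (induction "nat (aff_dim (\<Union>C))" arbitrary: C rule: less_induct)
  case less
  note C = less.prems(1)
  obtain x where x: "x \<in> \<Union>C" and star: "\<And>y. y \<in> \<Union>C \<Longrightarrow> closed_segment x y \<subseteq> \<Union>C"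
    using less.prems(2) unfolding starlike_def by blast
  have U0: "aff_dim (\<Union>C) \<ge> 0" using x by (metis aff_dim_negative_iff empty_iff linorder_not_less)
  have IH: "nonevasive (order_complex D)"
    if "cell_complex D" "starlike (\<Union>D)" "aff_dim (\<Union>D) < aff_dim (\<Union>C)"
    for D :: "'a set set"
  proof (rule less.hyps[OF _ that(1,2)])
    have "\<Union>D \<noteq> {}" using that(2) unfolding starlike_def by blast
    then have "aff_dim (\<Union>D) \<ge> 0" by (metis aff_dim_negative_iff linorder_not_less)
    then show "nat (aff_dim (\<Union>D)) < nat (aff_dim (\<Union>C))" using that(3) by simp
  qed
  show ?case
  proof (cases "\<forall>S\<in>C. \<exists>v. S = {v}")
    case True
    \<comment> \<open>A finite star-shaped set is a single point, since a non-degenerate segment is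
      infinite.\<close>
    have "finite (\<Union>C)" using True cells_finite[OF C] by (intro finite_Union) auto
    then have "y = x" if "y \<in> \<Union>C" for y
      using star[OF that] finite_subset finite_closed_segment by metis
    then have "S = {x}" if "S \<in> C" for S using True that by blast
    then have "S = T" if "S \<in> C" "T \<in> C" for S T using that by metis
    then show ?thesis
      using x order_complex_cone[OF cells_finite[OF C]] by (metis UnionE order_refl)
  next
    case False
    define N where "N = {S\<in>C. \<not> (\<exists>v. S = {v})}"
    have "\<exists>y z. y \<in> S \<and> z \<in> S \<and> y \<noteq> z" if "S \<in> N" for S
      using that cell_nonempty[OF C, of S] unfolding N_def by blast
    \<comment> \<open>Each cell that is not a vertex contributes two distinct points; a functional
      separating each such pair is non-constant on all these cells.\<close>
    then obtain Y Z where YZ: "\<And>S. S \<in> N \<Longrightarrow> Y S \<in> S \<and> Z S \<in> S \<and> Y S \<noteq> Z S" by metis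
    have "finite ((\<lambda>S. Y S - Z S) ` N)" using cells_finite[OF C] by (simp add: N_def)
    moreover have "0 \<notin> (\<lambda>S. Y S - Z S) ` N" using YZ by auto
    ultimately have "\<exists>a. \<forall>w\<in>(\<lambda>S. Y S - Z S) ` N. a \<bullet> w \<noteq> 0"
      by (rule exists_generic_functional)
    then obtain a where a: "\<And>S. S \<in> N \<Longrightarrow> a \<bullet> (Y S - Z S) \<noteq> 0" by blast
    have gen: "\<exists>v. T = {v}" if "T \<in> C" "\<forall>y\<in>T. \<forall>z\<in>T. a \<bullet> y = a \<bullet> z" for T
    proof (rule ccontr)
      assume "\<not> ?thesis"
      then have "T \<in> N" using that(1) by (simp add: N_def)
      then show False using that(2) a[of T] YZ[of T] by (simp add: inner_diff_right)
    qed
    define c where "c = a \<bullet> x"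
    define H where "H = {x. a \<bullet> x = c}"
    define R where "R = {S\<in>C. rel_interior S \<inter> H \<noteq> {}}"
    note slice = cell_complex_slice[OF C, where a = a and c = c, folded H_def, folded R_def]
    have xH: "x \<in> H" by (simp add: H_def c_def)
    have R: "nonevasive (order_complex R)"
    proof (rule order_complex_image[OF slice(3)])
      show "nonevasive (order_complex ((\<lambda>S. S \<inter> H) ` R))"
      proof (rule IH[OF slice(1)])
        have "closed_segment x y \<subseteq> \<Union>C \<inter> H" if "y \<in> \<Union>C \<inter> H" for y
        proof -
          have "convex H" by (simp add: H_def convex_hyperplane)
          then show ?thesis using star[of y] that xH closed_segment_subset[of x H y] by blast
        qed
        then show "starlike (\<Union>((\<lambda>S. S \<inter> H) ` R))"
          unfolding slice(2) starlike_def using x xH by blast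
        obtain S where S: "S \<in> N" using False unfolding N_def by blast
        then have "S \<in> C" by (simp add: N_def)
        then show "aff_dim (\<Union>((\<lambda>S. S \<inter> H) ` R)) < aff_dim (\<Union>C)"
          unfolding slice(2) unfolding H_def using a[OF S] YZ[OF S]
          by (intro aff_dim_slice[of "Y S" _ "Z S"]) (auto simp: inner_diff_right)
      qed
    qed
    have link: "nonevasive (order_complex {S\<in>C. v \<in> S \<and> (\<exists>y\<in>S. b \<bullet> y < b \<bullet> v)})"
      if v: "{v} \<in> C" and bx: "b \<bullet> x < b \<bullet> v" for b v
    proof (rule order_complex_image[OF cell_complex_link(2)[OF C]])
      let ?D = "lower_slice b v ` {S\<in>C. v \<in> S \<and> (\<exists>y\<in>S. b \<bullet> y < b \<bullet> v)}"
      have vU: "v \<in> \<Union>C" using v by blast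
      show "nonevasive (order_complex ?D)"
      proof (rule IH)
        show "cell_complex ?D" by (rule cell_complex_link(1)[OF C])
        show "starlike (\<Union>?D)" by (rule starlike_link[OF C x star bx vU])
        show "aff_dim (\<Union>?D) < aff_dim (\<Union>C)"
          by (rule aff_dim_link[OF vU, of _ b]) (auto simp: lower_slice_def tangent_cone_def)
      qed
    qed
    \<comment> \<open>The distance to the hyperplane as measured by \<open>a\<close>; an infimum,
      since attainment is known only for cells on one side of it.\<close>
    define h where "h S = Inf ((\<lambda>y. \<bar>a \<bullet> y - c\<bar>) ` S)" for S
    have h_le: "h S \<le> \<bar>a \<bullet> y - c\<bar>" if "y \<in> S" for S y
      unfolding h_def by (rule cInf_lower) (use that in \<open>auto intro!: bdd_belowI[of _ 0]\<close>)
    have h_less: "\<exists>y\<in>S. \<bar>a \<bullet> y - c\<bar> < r" if "h S < r" "S \<in> C" for S r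
      using cInf_lessD[of "(\<lambda>y. \<bar>a \<bullet> y - c\<bar>) ` S" r] that cell_nonempty[OF C] by (auto simp: h_def)
    have h_eq: "h S = \<bar>a \<bullet> v - c\<bar>" if "v \<in> S" "\<And>y. y \<in> S \<Longrightarrow> \<bar>a \<bullet> v - c\<bar> \<le> \<bar>a \<bullet> y - c\<bar>" for S v
      unfolding h_def by (rule cInf_eq_minimum) (use that in auto)
    \<comment> \<open>Taking \<open>b\<close> as \<open>a\<close> or \<open>- a\<close> treats both
      sides at once: in terms of \<open>b\<close> the cell \<open>S\<close> never lies below the
      hyperplane.\<close>
    have one_side: "(\<exists>M\<in>C. M \<subset> S \<and> (M \<in> R \<or> h M = h S) \<and>
          (\<forall>T\<in>C. T \<subset> S \<longrightarrow> T \<in> R \<or> h T \<le> h S \<longrightarrow> M \<subseteq> T)) \<or>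
        (\<forall>T\<in>C. \<not> T \<subset> S) \<and> nonevasive (order_complex {T\<in>C. S \<subset> T \<and> (T \<in> R \<or> h T < h S)})"
      if S: "S \<in> C - R" and b: "b = a \<or> b = - a" and pos: "\<And>y. y \<in> S \<Longrightarrow> b \<bullet> x \<le> b \<bullet> y" for S b
    proof -
      have abs: "\<bar>a \<bullet> y - c\<bar> = \<bar>b \<bullet> y - b \<bullet> x\<bar>" for y using b by (auto simp: c_def)
      have H: "y \<in> H \<longleftrightarrow> b \<bullet> y = b \<bullet> x" for y using b by (auto simp: H_def c_def)
      have genb: "\<exists>v. T = {v}" if "T \<in> C" "\<forall>y\<in>T. \<forall>z\<in>T. b \<bullet> y = b \<bullet> z" for T
      proof (rule gen[OF that(1)])
        have "a \<bullet> y = a \<bullet> z" if "b \<bullet> y = b \<bullet> z" for y z using b that by auto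
        then show "\<forall>y\<in>T. \<forall>z\<in>T. a \<bullet> y = a \<bullet> z" using that(2) by blast
      qed
      have vertex: "\<exists>v. {v} \<in> C \<and> v \<in> T \<and> (\<forall>y\<in>T. y \<noteq> v \<longrightarrow> b \<bullet> v < b \<bullet> y) \<and> h T = b \<bullet> v - b \<bullet> x"
        if T: "T \<in> C" "T \<subseteq> S" for T
      proof -
        have posT: "b \<bullet> x \<le> b \<bullet> y" if "y \<in> T" for y using pos T(2) that by blast
        obtain v where v: "{v} \<in> C" "v \<in> T" "\<And>y. y \<in> T \<Longrightarrow> y \<noteq> v \<Longrightarrow> b \<bullet> v < b \<bullet> y"
          using cell_min_vertex[OF C genb T(1) posT] by blast
        have "h T = \<bar>a \<bullet> v - c\<bar>"
        proof (rule h_eq[OF v(2)])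
          show "\<bar>a \<bullet> v - c\<bar> \<le> \<bar>a \<bullet> y - c\<bar>" if "y \<in> T" for y
            unfolding abs using posT[OF that] posT[OF v(2)] v(3)[OF that] by (cases "y = v") auto
        qed
        then have "h T = b \<bullet> v - b \<bullet> x" using posT[OF v(2)] by (simp add: abs)
        then show ?thesis using v by blast
      qed
      obtain v where v: "{v} \<in> C" "v \<in> S" "\<And>y. y \<in> S \<Longrightarrow> y \<noteq> v \<Longrightarrow> b \<bullet> v < b \<bullet> y"
        and hS: "h S = b \<bullet> v - b \<bullet> x"
        using vertex[of S] S by blast
      show ?thesis
      proof (cases "S = {v}")
        case True
        then have "v \<notin> H" using S by (auto simp: R_def)
        then have bv: "b \<bullet> x < b \<bullet> v" using pos[OF v(2)] H[of v] by simp
        \<comment> \<open>The cells above the vertex that are still present are exactly those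
          descending below \<open>v\<close>: one that descends past the hyperplane meets it in its
          relative interior and so belongs to \<open>R\<close>.\<close>
        have "{T\<in>C. S \<subset> T \<and> (T \<in> R \<or> h T < h S)} = {S\<in>C. v \<in> S \<and> (\<exists>y\<in>S. b \<bullet> y < b \<bullet> v)}"
        proof (intro equalityI subsetI)
          fix T assume T: "T \<in> {T\<in>C. S \<subset> T \<and> (T \<in> R \<or> h T < h S)}"
          have "\<exists>y\<in>T. b \<bullet> y < b \<bullet> v"
          proof (cases "T \<in> R")
            case True
            then obtain y where "y \<in> rel_interior T" "y \<in> H" by (auto simp: R_def)
            then have "y \<in> T" "b \<bullet> y < b \<bullet> v" using rel_interior_subset H[of y] bv by auto
            then show ?thesis by blast
          next
            case False
            then obtain y where "y \<in> T" "\<bar>a \<bullet> y - c\<bar> < h S" using T h_less by blast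
            then show ?thesis unfolding abs hS by (intro bexI[of _ y]) auto
          qed
          then show "T \<in> {S\<in>C. v \<in> S \<and> (\<exists>y\<in>S. b \<bullet> y < b \<bullet> v)}" using T v(2) by blast
        next
          fix T assume "T \<in> {S\<in>C. v \<in> S \<and> (\<exists>y\<in>S. b \<bullet> y < b \<bullet> v)}"
          then obtain y where T: "T \<in> C" "v \<in> T" "y \<in> T" "b \<bullet> y < b \<bullet> v" by blast
          have "h T < h S" if "T \<notin> R"
          proof -
            have "\<not> b \<bullet> y < b \<bullet> x"
            proof
              assume "b \<bullet> y < b \<bullet> x"
              then have "rel_interior T \<inter> {z. b \<bullet> z = b \<bullet> x} \<noteq> {}"
                by (rule rel_interior_meets_hyperplane[OF cell_convex[OF C T(1)] T(3,2) _ bv])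
              moreover have "{z. b \<bullet> z = b \<bullet> x} = H" using H by blast
              ultimately show False using that T(1) by (simp add: R_def)
            qed
            then show ?thesis using h_le[OF T(3)] T(4) unfolding abs hS by simp
          qed
          moreover have "S \<subset> T" using True T(2,3,4) by blast
          ultimately show "T \<in> {T\<in>C. S \<subset> T \<and> (T \<in> R \<or> h T < h S)}" using T(1) by blast
        qed
        moreover have "\<not> T \<subset> S" if "T \<in> C" for T using True cell_nonempty[OF C that] by blast
        ultimately show ?thesis using link[OF v(1) bv] by simp
      next
        case False
        \<comment> \<open>A smaller cell that is still present comes at least as close to the
          hyperplane as \<open>S\<close>, and \<open>v\<close> is the only point of \<open>S\<close>
          that close; so \<open>{v}\<close> is the apex of the link.\<close>
        have "v \<in> T" if T: "T \<in> C" "T \<subset> S" and or: "T \<in> R \<or> h T \<le> h S" for T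
        proof (cases "T \<in> R")
          case True
          then obtain y where y: "y \<in> rel_interior T" "y \<in> H" by (auto simp: R_def)
          then have yT: "y \<in> T" using rel_interior_subset by blast
          then show ?thesis using v(3)[of y] pos[OF v(2)] H[of y] y(2) T(2) by (cases "y = v") auto
        next
          case False
          obtain w where w: "w \<in> T" "h T = b \<bullet> w - b \<bullet> x" using vertex[of T] T by blast
          then show ?thesis using or False v(3)[of w] T(2) hS by (cases "w = v") auto
        qed
        moreover have "h {v} = h S" unfolding hS using h_eq[of v "{v}"] pos[OF v(2)] by (simp add: abs)
        moreover have "{v} \<subset> S" using False v(2) by blast
        ultimately show ?thesis using v(1) by blast
      qed
    qed
    have sides: "(\<forall>y\<in>S. a \<bullet> x \<le> a \<bullet> y) \<or> (\<forall>y\<in>S. a \<bullet> y \<le> a \<bullet> x)" if S: "S \<in> C - R" for S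
    proof (rule ccontr)
      assume "\<not> ?thesis"
      then obtain y z where yz: "y \<in> S" "a \<bullet> y < c" "z \<in> S" "c < a \<bullet> z" unfolding c_def by (meson not_le)
      have "convex S" using S cell_convex[OF C] by blast
      then have "S \<in> R"
        using rel_interior_meets_hyperplane[of S y z a c] yz S by (simp add: R_def H_def)
      then show False using S by blast
    qed
    show ?thesis
    proof (rule order_complex_sweep[OF cells_finite[OF C] _ R, where h = h])
      show "R \<subseteq> C" by (auto simp: R_def)
      fix S assume S: "S \<in> C - R"
      from sides[OF S] show "(\<exists>M\<in>C. M \<subset> S \<and> (M \<in> R \<or> h M = h S) \<and>
          (\<forall>T\<in>C. T \<subset> S \<longrightarrow> T \<in> R \<or> h T \<le> h S \<longrightarrow> M \<subseteq> T)) \<or>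
        (\<forall>T\<in>C. \<not> T \<subset> S) \<and> nonevasive (order_complex {T\<in>C. S \<subset> T \<and> (T \<in> R \<or> h T < h S)})"
      proof
        assume "\<forall>y\<in>S. a \<bullet> x \<le> a \<bullet> y"
        then show ?thesis by (intro one_side[OF S, of a]) auto
      next
        assume "\<forall>y\<in>S. a \<bullet> y \<le> a \<bullet> x"
        then show ?thesis by (intro one_side[OF S, of "- a"]) auto
      qed
    qed
  qed
qed

section \<open>Derived subdivisions of polytopal complexes\<close>

text \<open>Pass to a facet as long as the point is on the relative frontier; the dimension drops
  each time. The \<open>+ 1\<close> shifts the least dimension -1 to 0, so that \<open>nat\<close>
  keeps the inequality strict.\<close>

lemma polyhedron_carrier_face:
  fixes S :: "'a::euclidean_space set"
  assumes "polyhedron S" "y \<in> S"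
  shows "\<exists>F. F face_of S \<and> y \<in> rel_interior F"
  using assms
proof (induction "nat (aff_dim S + 1)" arbitrary: S rule: less_induct)
  case less
  have cS: "convex S" using less.prems(1) polyhedron_imp_convex by blast
  show ?case
  proof (cases "y \<in> rel_interior S")
    case True
    then show ?thesis using face_of_refl[OF cS] by blast
  next
    case False
    then have "y \<in> rel_frontier S" using less.prems(2) closure_subset by (auto simp: rel_frontier_def)
    then obtain F where F: "F facet_of S" "y \<in> F" using rel_frontier_of_polyhedron[OF less.prems(1)] by auto
    have FS: "F face_of S" using F(1) facet_of_imp_face_of by blast
    have "F \<noteq> S" using F(1) facet_of_irrefl by blast
    then have "aff_dim F < aff_dim S" by (rule face_of_aff_dim_lt[OF cS FS])
    moreover have "aff_dim F \<ge> -1" by (rule aff_dim_geq)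
    ultimately have "nat (aff_dim F + 1) < nat (aff_dim S + 1)" by simp
    then obtain G where "G face_of F" "y \<in> rel_interior G"
      using less.hyps[of F] F(2) face_of_polyhedron_polyhedron[OF less.prems(1) FS] by blast
    then show ?thesis using face_of_trans FS by blast
  qed
qed

lemma polytopal_face:
  assumes "polytopal_complex C" "S \<in> C" "T \<in> C" "S \<subseteq> T"
  shows "S face_of T"
proof -
  have "S \<inter> T = S" using assms(4) by blast
  then show ?thesis using assms(1-3) unfolding polytopal_complex_def by metis
qed

text \<open>Carriers are supplied by faces; and the face \<open>S \<inter> T\<close> of
  \<open>S\<close>, once it meets the relative interior of \<open>S\<close>, is all of
  \<open>S\<close>.\<close>

lemma polytopal_cell_complex:
  assumes C: "polytopal_complex C"
  shows "cell_complex (C - {{}})"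
proof -
  have fin: "finite C" and poly: "\<And>S. S \<in> C \<Longrightarrow> polyhedron S"
    and face: "\<And>S F. S \<in> C \<Longrightarrow> F face_of S \<Longrightarrow> F \<in> C"
    and int: "\<And>S T. S \<in> C \<Longrightarrow> T \<in> C \<Longrightarrow> S \<inter> T face_of S"
    using C polytope_imp_polyhedron unfolding polytopal_complex_def by blast+
  show ?thesis
    unfolding cell_complex_def
  proof (intro conjI ballI impI)
    fix S y assume S: "S \<in> C - {{}}" and y: "y \<in> S"
    then obtain F where F: "F face_of S" "y \<in> rel_interior F" using polyhedron_carrier_face poly by blast
    then have "F \<in> C - {{}}" using face S by auto
    then show "\<exists>T\<in>C - {{}}. T \<subseteq> S \<and> y \<in> rel_interior T" using F face_of_imp_subset by blast
  next
    fix S T assume "S \<in> C - {{}}" "T \<in> C - {{}}" and ne: "rel_interior S \<inter> T \<noteq> {}"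
    then have "(S \<inter> T) face_of S" using int by blast
    moreover have "(S \<inter> T) \<inter> rel_interior S \<noteq> {}" using ne rel_interior_subset by blast
    ultimately show "S \<subseteq> T" using subset_of_face_of[of "S \<inter> T" S S] by blast
  qed (use fin poly in auto)
qed

lemma chain_top:
  assumes "S \<in> order_complex P" "finite S" "S \<noteq> {}"
  obtains F where "F \<in> S" "\<And>A. A \<in> S \<Longrightarrow> A \<subseteq> F"
proof -
  obtain F where F: "F \<in> S" "\<And>A. A \<in> S \<Longrightarrow> F \<subseteq> A \<Longrightarrow> F = A"
    using finite_has_maximal[OF assms(2,3)] by blast
  have "A \<subseteq> F" if "A \<in> S" for A
  proof -
    have "A \<subseteq> F \<or> F \<subseteq> A" using assms(1) F(1) that unfolding order_complex_def by blast
    then show ?thesis using F(2)[OF that] by blast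
  qed
  then show ?thesis using that F(1) by blast
qed

lemma order_complex_subset: "S \<in> order_complex P \<Longrightarrow> S' \<subseteq> S \<Longrightarrow> S' \<in> order_complex P"
  by (rule down_closedD[OF order_complex_down_closed])

section \<open>Chains of faces and the simplices of a derived subdivision\<close>

context
  fixes C :: "'a::euclidean_space set set" and p :: "'a set \<Rightarrow> 'a"
  assumes C: "polytopal_complex C"
    and p: "\<And>F. F \<in> C \<Longrightarrow> F \<noteq> {} \<Longrightarrow> p F \<in> rel_interior F"
begin

abbreviation (input) face_chains :: "'a set set set" where
  "face_chains \<equiv> order_complex (C - {{}})"

lemma chain_finite: "S \<in> face_chains \<Longrightarrow> finite S"
  by (rule finite_subset[of S C]) (use C in \<open>auto simp: order_complex_def polytopal_complex_def\<close>)

lemma chain_cell: "S \<in> face_chains \<Longrightarrow> F \<in> S \<Longrightarrow> F \<in> C - {{}}"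
  unfolding order_complex_def by blast

lemma p_mem: "F \<in> C - {{}} \<Longrightarrow> p F \<in> rel_interior F"
  using p by blast

lemma face_convex: "F \<in> C \<Longrightarrow> convex F"
  using C polytope_imp_convex unfolding polytopal_complex_def by blast

lemma face_unique:
  assumes "F \<in> C - {{}}" "G \<in> C - {{}}" "y \<in> rel_interior F" "y \<in> rel_interior G"
  shows "F = G"
proof -
  note sub = cell_subset[OF polytopal_cell_complex[OF C]]
  have "y \<in> F" "y \<in> G" by (rule subsetD[OF rel_interior_subset assms(3)], rule subsetD[OF rel_interior_subset assms(4)])
  then show ?thesis using sub[OF assms(1,2,3)] sub[OF assms(2,1,4)] by simp
qed

lemma p_inj: "inj_on p (C - {{}})"
proof (rule inj_onI)
  fix A B assume AB: "A \<in> C - {{}}" "B \<in> C - {{}}" "p A = p B"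
  have "p A \<in> rel_interior A" "p A \<in> rel_interior B" using p_mem[OF AB(1)] p_mem[OF AB(2)] AB(3) by auto
  then show "A = B" by (rule face_unique[OF AB(1,2)])
qed

lemma chain_hull_subset:
  assumes S: "S \<in> face_chains" and F: "F \<in> C - {{}}" "\<And>A. A \<in> S \<Longrightarrow> A \<subseteq> F"
  shows "convex hull (p ` S) \<subseteq> F"
proof (rule hull_minimal)
  show "p ` S \<subseteq> F" using p_mem chain_cell[OF S] F(2) rel_interior_subset by blast
  show "convex F" using face_convex F(1) by blast
qed

text \<open>The largest member of the chain is a proper face of \<open>F\<close> containing all
  chosen points, and the affine hull of a proper face misses the relative interior.\<close>

lemma chain_below_disjoint:
  assumes S: "S \<in> face_chains" and F: "F \<in> C - {{}}" "\<And>A. A \<in> S \<Longrightarrow> A \<subset> F"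
  shows "affine hull (p ` S) \<inter> rel_interior F = {}"
proof (cases "S = {}")
  case False
  obtain G where G: "G \<in> S" "\<And>A. A \<in> S \<Longrightarrow> A \<subseteq> G" using chain_top[OF S chain_finite[OF S] False] by blast
  have GC: "G \<in> C - {{}}" using chain_cell[OF S G(1)] .
  have "convex hull (p ` S) \<subseteq> G" by (rule chain_hull_subset[OF S GC G(2)])
  then have "p ` S \<subseteq> G" by (rule order_trans[OF hull_subset])
  then have "affine hull (p ` S) \<subseteq> affine hull G" by (rule hull_mono)
  moreover have "affine hull G \<inter> rel_interior F = {}"
    using polytopal_face[OF C] GC F G(1) face_convex
    by (intro affine_hull_face_of_disjoint_rel_interior) blast+
  ultimately show ?thesis by blast
qed simp

text \<open>Build the chain upwards: the chosen point of a new top face is outside the affine hull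
  of the earlier ones.\<close>

lemma chain_affine_independent:
  assumes "S \<in> face_chains"
  shows "\<not> affine_dependent (p ` S)"
  using assms
proof (induction "card S" arbitrary: S rule: less_induct)
  case less
  show ?case
  proof (cases "S = {}")
    case False
    obtain F where F: "F \<in> S" "\<And>A. A \<in> S \<Longrightarrow> A \<subseteq> F"
      using chain_top[OF less.prems chain_finite[OF less.prems] False] by blast
    have S': "S - {F} \<in> face_chains" using order_complex_subset[OF less.prems] by blast
    have FC: "F \<in> C - {{}}" using chain_cell[OF less.prems F(1)] .
    have "p F \<notin> affine hull (p ` (S - {F}))"
      using chain_below_disjoint[OF S' FC] F(2) p_mem[OF FC] by blast
    moreover have "\<not> affine_dependent (p ` (S - {F}))"
      by (rule less.hyps[OF card_Diff1_less[OF chain_finite[OF less.prems] F(1)] S'])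
    moreover have "p ` S = insert (p F) (p ` (S - {F}))" using F(1) by blast
    ultimately show ?thesis by (simp add: affine_independent_insert)
  qed (simp add: affine_independent_0)
qed

text \<open>Splitting off the weight \<open>u\<close> of the top point \<open>p F\<close> gives the
  cases \<open>u = 0\<close>, \<open>u = 1\<close> and that of a point moved from \<open>b\<close>
  towards \<open>p F\<close>, which thereby enters the relative interior of
  \<open>F\<close>.\<close>

lemma chain_hull_cases:
  assumes S: "S \<in> face_chains" and F: "F \<in> S" "\<And>A. A \<in> S \<Longrightarrow> A \<subseteq> F" and y: "y \<in> convex hull (p ` S)"
  obtains "y \<in> convex hull (p ` (S - {F}))" | "y = p F"
  | u b where "0 < u" "u < 1" "b \<in> convex hull (p ` (S - {F}))" "y = b - u *\<^sub>R (b - p F)" "y \<in> rel_interior F"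
proof (cases "S - {F} = {}")
  case True
  then have "S = {F}" using F(1) by blast
  then show ?thesis using that(2) y by simp
next
  case False
  have FC: "F \<in> C - {{}}" using chain_cell[OF S F(1)] .
  have "p ` S = insert (p F) (p ` (S - {F}))" using F(1) by blast
  moreover have "p ` (S - {F}) \<noteq> {}" using False by blast
  ultimately obtain u v b where ub: "u \<ge> 0" "v \<ge> 0" "u + v = 1" "b \<in> convex hull (p ` (S - {F}))"
      "y = u *\<^sub>R p F + v *\<^sub>R b"
    using y convex_hull_insert[of "p ` (S - {F})" "p F"] by auto
  have v: "v = 1 - u" using ub(3) by simp
  have yb: "y = b - u *\<^sub>R (b - p F)" using ub(5) by (simp add: v algebra_simps)
  consider "u = 0" | "u = 1" | "0 < u" "u < 1" using ub(1-3) by linarith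
  then show ?thesis
  proof cases
    case 3
    have "convex hull (p ` (S - {F})) \<subseteq> F"
      by (rule chain_hull_subset[OF _ FC]) (use F(2) order_complex_subset[OF S] in auto)
    then have "b \<in> closure F" using ub(4) closure_subset by blast
    then have "y \<in> rel_interior F"
      unfolding yb using rel_interior_closure_convex_shrink[OF face_convex p_mem[OF FC]] FC 3 by simp
    then show ?thesis using that(3) 3 ub(4) yb by blast
  qed (use that ub yb v in auto)
qed

text \<open>A point in the relative interior of \<open>F\<close> other than \<open>p F\<close> determines the point where the ray
  from \<open>p F\<close> through it leaves \<open>F\<close>, hence its barycentric coordinates.\<close>
lemma chain_hull_Int:
  assumes "S \<in> face_chains" "T \<in> face_chains"
  shows "convex hull (p ` S) \<inter> convex hull (p ` T) = convex hull (p ` (S \<inter> T))"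
proof
  show "convex hull (p ` (S \<inter> T)) \<subseteq> convex hull (p ` S) \<inter> convex hull (p ` T)"
    by (intro Int_greatest hull_mono image_mono) auto
  have "y \<in> convex hull (p ` (S \<inter> T))" if "y \<in> convex hull (p ` S)" "y \<in> convex hull (p ` T)" for y
    using assms that
  proof (induction "card S + card T" arbitrary: S T y rule: less_induct)
    case less
    note S = less.prems(1) and T = less.prems(2)
    have ne: "S \<noteq> {}" "T \<noteq> {}" using less.prems(3,4) by auto
    obtain F where F: "F \<in> S" "\<And>A. A \<in> S \<Longrightarrow> A \<subseteq> F" using chain_top[OF S chain_finite[OF S] ne(1)] by blast
    obtain G where G: "G \<in> T" "\<And>A. A \<in> T \<Longrightarrow> A \<subseteq> G" using chain_top[OF T chain_finite[OF T] ne(2)] by blast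
    have FC: "F \<in> C - {{}}" and GC: "G \<in> C - {{}}" using chain_cell S T F(1) G(1) by blast+
    have S': "S - {F} \<in> face_chains" and T': "T - {G} \<in> face_chains"
      using order_complex_subset S T by blast+
    have cS: "card (S - {F}) < card S" and cT: "card (T - {G}) < card T"
      by (rule card_Diff1_less[OF chain_finite[OF S] F(1)], rule card_Diff1_less[OF chain_finite[OF T] G(1)])
    have mono: "y \<in> convex hull (p ` (S \<inter> T))"
      if "y \<in> convex hull (p ` (S1 \<inter> T1))" "S1 \<subseteq> S" "T1 \<subseteq> T" for S1 T1 y
    proof -
      have "p ` (S1 \<inter> T1) \<subseteq> p ` (S \<inter> T)" using that(2,3) by blast
      then show ?thesis using that(1) hull_mono by blast
    qed
    show ?case
    proof (cases "y \<in> convex hull (p ` (S - {F})) \<or> y \<in> convex hull (p ` (T - {G}))")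
      case True
      then show ?thesis
      proof
        assume "y \<in> convex hull (p ` (S - {F}))"
        then have "y \<in> convex hull (p ` ((S - {F}) \<inter> T))" using less.hyps[OF _ S' T] cS less.prems(4) by simp
        then show ?thesis by (rule mono) auto
      next
        assume "y \<in> convex hull (p ` (T - {G}))"
        then have "y \<in> convex hull (p ` (S \<inter> (T - {G})))" using less.hyps[OF _ S T'] cT less.prems(3) by simp
        then show ?thesis by (rule mono) auto
      qed
    next
      case False
      \<comment> \<open>A point with positive weight on both top points lies in the relative
        interior of both top faces, which must therefore coincide.\<close>
      have yF: "y \<in> rel_interior F"
        by (rule chain_hull_cases[OF S F less.prems(3)]) (use False p_mem[OF FC] in auto)
      have yG: "y \<in> rel_interior G"
        by (rule chain_hull_cases[OF T G less.prems(4)]) (use False p_mem[OF GC] in auto)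
      have FG: "F = G" by (rule face_unique[OF FC GC yF yG])
      have pI: "p F \<in> convex hull (p ` (S \<inter> T))" using F(1) G(1) FG by (intro hull_inc) blast
      show ?thesis
      proof (cases "y = p F")
        case False
        obtain u b where u: "0 < u" "u < 1" "b \<in> convex hull (p ` (S - {F}))" "y = b - u *\<^sub>R (b - p F)"
          using chain_hull_cases[OF S F less.prems(3)] False \<open>\<not> (_ \<or> _)\<close> by metis
        obtain u' b' where u': "0 < u'" "u' < 1" "b' \<in> convex hull (p ` (T - {F}))" "y = b' - u' *\<^sub>R (b' - p F)"
          using chain_hull_cases[OF T G less.prems(4)] False \<open>\<not> (_ \<or> _)\<close> FG by metis
        have outside: "c \<notin> rel_interior F" "c \<in> closure F"
          if R: "R \<in> face_chains" "\<And>A. A \<in> R \<Longrightarrow> A \<subset> F" and c: "c \<in> convex hull (p ` R)" for R c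
        proof -
          show "c \<notin> rel_interior F"
            using chain_below_disjoint[OF R(1) FC R(2)] convex_hull_subset_affine_hull c by blast
          have "convex hull (p ` R) \<subseteq> F" by (rule chain_hull_subset[OF R(1) FC]) (use R(2) in blast)
          then show "c \<in> closure F" using c closure_subset by blast
        qed
        have b: "b \<notin> rel_interior F" "b \<in> closure F" using outside[OF S' _ u(3)] F(2) by blast+
        have b': "b' \<notin> rel_interior F" "b' \<in> closure F"
          using outside[of "T - {F}" b'] T' u'(3) G(2) FG by blast+
        \<comment> \<open>Two different weights of \<open>p F\<close> are impossible: if
          \<open>s < t\<close>, then \<open>c\<close> arises by moving \<open>d\<close> towards
          \<open>p F\<close> and would be in the relative interior.\<close>
        have le: "\<not> s < t"
          if s: "0 < s" "s < 1" "c \<notin> rel_interior F" "y = c - s *\<^sub>R (c - p F)"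
            and t: "0 < t" "t < 1" "d \<in> closure F" "y = d - t *\<^sub>R (d - p F)" for s t c d
        proof
          assume st: "s < t"
          define r where "r = (1 - t) / (1 - s)"
          have r: "0 < r" "r < 1" using s t st by (simp_all add: r_def)
          have e1: "y - p F = (1 - s) *\<^sub>R (c - p F)" unfolding s(4) by (simp add: algebra_simps)
          have e2: "y - p F = (1 - t) *\<^sub>R (d - p F)" unfolding t(4) by (simp add: algebra_simps)
          have "c - p F = (1 / (1 - s)) *\<^sub>R (y - p F)" unfolding e1 using s(2) by simp
          also have "\<dots> = r *\<^sub>R (d - p F)" unfolding e2 by (simp add: r_def)
          finally have "c = d - (1 - r) *\<^sub>R (d - p F)" by (simp add: algebra_simps)
          then have "c \<in> rel_interior F"
            using rel_interior_closure_convex_shrink[OF face_convex p_mem[OF FC] t(3), of "1 - r"] FC r by simp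
          then show False using s(3) by blast
        qed
        have uu: "u = u'"
          using le[OF u(1,2) b(1) u(4) u'(1,2) b'(2) u'(4)] le[OF u'(1,2) b'(1) u'(4) u(1,2) b(2) u(4)] by simp
        have "(1 - u) *\<^sub>R (b - b') = (b - u *\<^sub>R (b - p F)) - (b' - u *\<^sub>R (b' - p F))" by (simp add: algebra_simps)
        also have "\<dots> = 0" using u(4) u'(4) uu by simp
        finally have "b = b'" using u(2) by simp
        then have "b \<in> convex hull (p ` ((S - {F}) \<inter> (T - {G})))"
          using less.hyps[OF _ S' T'] cS cT u(3) u'(3) FG by simp
        then have bI: "b \<in> convex hull (p ` (S \<inter> T))" by (rule mono) auto
        have "(1 - u) *\<^sub>R b + u *\<^sub>R p F \<in> convex hull (p ` (S \<inter> T))"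
          using u(1,2) by (intro convexD[OF convex_convex_hull bI pI]) auto
        then show ?thesis unfolding u(4) by (simp add: algebra_simps)
      qed (use pI in simp)
    qed
  qed
  then show "convex hull (p ` S) \<inter> convex hull (p ` T) \<subseteq> convex hull (p ` (S \<inter> T))" by blast
qed

text \<open>Project radially from \<open>p F\<close> to the relative frontier, whose points lie in
  smaller faces, take a chain there by induction and put \<open>F\<close> on top.\<close>

lemma chain_hull_covers:
  assumes "F \<in> C - {{}}" "y \<in> F"
  shows "\<exists>S\<in>face_chains. (\<forall>A\<in>S. A \<subseteq> F) \<and> y \<in> convex hull (p ` S)"
  using assms
proof (induction "card {T\<in>C - {{}}. T \<subset> F}" arbitrary: F y rule: less_induct)
  case less
  note cells = polytopal_cell_complex[OF C]
  have smaller: "\<exists>T\<in>C - {{}}. T \<subset> F \<and> (\<exists>S\<in>face_chains. (\<forall>A\<in>S. A \<subseteq> T) \<and> z \<in> convex hull (p ` S))"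
    if z: "z \<in> F" "z \<notin> rel_interior F" for z
  proof -
    obtain T where T: "T \<in> C - {{}}" "T \<subseteq> F" "z \<in> rel_interior T" using cell_carrier[OF cells less.prems(1) z(1)] by blast
    have TF: "T \<subset> F" using T z by blast
    have "card {T'\<in>C - {{}}. T' \<subset> T} < card {T\<in>C - {{}}. T \<subset> F}"
      using TF T(1) cells_finite[OF cells] by (intro psubset_card_mono) auto
    then show ?thesis using less.hyps[of T z] T TF rel_interior_subset by blast
  qed
  show ?case
  proof (cases "y \<in> rel_interior F")
    case False
    then show ?thesis using smaller[OF less.prems(2)] by (meson order_trans psubset_imp_subset)
  next
    case yF: True
    have pF: "p F \<in> rel_interior F" using p_mem[OF less.prems(1)] .
    show ?thesis
    proof (cases "y = p F")
      case True
      then show ?thesis using less.prems(1) by (intro bexI[of _ "{F}"]) (auto simp: order_complex_def)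
    next
      case False
      have "bounded F" using C less.prems(1) polytope_imp_bounded unfolding polytopal_complex_def by blast
      moreover have "p F + (y - p F) \<in> affine hull F" using less.prems(2) by (simp add: hull_inc)
      ultimately obtain d where d: "0 < d" "p F + d *\<^sub>R (y - p F) \<in> rel_frontier F"
        using ray_to_rel_frontier[of F "p F" "y - p F"] pF False by auto
      define z where "z = p F + d *\<^sub>R (y - p F)"
      have z: "z \<in> F" "z \<notin> rel_interior F"
        using d(2) cell_closed[OF cells less.prems(1)] by (auto simp: z_def rel_frontier_def)
      \<comment> \<open>The ray passes \<open>y\<close> before it reaches the frontier, since its
        points up to \<open>y\<close> are in the relative interior.\<close>
      have d1: "d > 1"
      proof (rule ccontr)
        assume "\<not> d > 1"
        have "z = y - (1 - d) *\<^sub>R (y - p F)" by (simp add: z_def algebra_simps)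
        moreover have "y - (1 - d) *\<^sub>R (y - p F) \<in> rel_interior F"
        proof (cases "d = 1")
          case False
          then show ?thesis
            using rel_interior_closure_convex_shrink[OF face_convex pF, of y "1 - d"] less.prems d(1) \<open>\<not> d > 1\<close>
              closure_subset by auto
        qed (use yF in simp)
        ultimately show False using z(2) by simp
      qed
      obtain T S where T: "T \<subset> F" and S: "S \<in> face_chains" "\<And>A. A \<in> S \<Longrightarrow> A \<subseteq> T" "z \<in> convex hull (p ` S)"
        using smaller[OF z] by blast
      have chain: "insert F S \<in> face_chains"
        using S(1,2) T less.prems(1) unfolding order_complex_def by blast
      have "(1 - 1 / d) *\<^sub>R p F + (1 / d) *\<^sub>R z \<in> convex hull (p ` insert F S)"
      proof (rule convexD[OF convex_convex_hull])
        show "p F \<in> convex hull (p ` insert F S)" by (simp add: hull_inc)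
        show "z \<in> convex hull (p ` insert F S)" using S(3) hull_mono[of "p ` S" "p ` insert F S"] by blast
      qed (use d1 in auto)
      moreover have "(1 - 1 / d) *\<^sub>R p F + (1 / d) *\<^sub>R z = y" using d1 by (simp add: z_def algebra_simps)
      ultimately show ?thesis using chain S(2) T by (intro bexI[OF _ chain]) auto
    qed
  qed
qed

text \<open>Affine independence makes the faces of a simplex the hulls of subchains, and by
  \<open>chain_hull_Int\<close> intersections are such hulls too.\<close>

lemma derived_polytopal: "polytopal_complex ((\<lambda>S. convex hull (p ` S)) ` face_chains)"
  unfolding polytopal_complex_def
proof (intro conjI ballI allI impI)
  have "finite (C - {{}})" using C unfolding polytopal_complex_def by blast
  then have "finite face_chains" by (rule finite_subset[OF _ finite_Pow_iff[THEN iffD2], rotated]) (auto simp: order_complex_def)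
  then show "finite ((\<lambda>S. convex hull (p ` S)) ` face_chains)" by simp
next
  fix P assume "P \<in> (\<lambda>S. convex hull (p ` S)) ` face_chains"
  then obtain S where S: "S \<in> face_chains" "P = convex hull (p ` S)" by (elim imageE)
  show "polytope P" unfolding S(2) using chain_finite[OF S(1)] by (intro polytope_convex_hull) simp
  fix F assume "F face_of P"
  then obtain c where c: "c \<subseteq> p ` S" "F = convex hull c"
    unfolding S(2) face_of_convex_hull_affine_independent[OF chain_affine_independent[OF S(1)]] by blast
  then obtain S' where "S' \<subseteq> S" "c = p ` S'" by (auto simp: subset_image_iff)
  then show "F \<in> (\<lambda>S. convex hull (p ` S)) ` face_chains"
    using c(2) order_complex_subset[OF S(1)] by blast
next
  fix P Q assume "P \<in> (\<lambda>S. convex hull (p ` S)) ` face_chains" "Q \<in> (\<lambda>S. convex hull (p ` S)) ` face_chains"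
  then obtain S T where ST: "S \<in> face_chains" "P = convex hull (p ` S)" "T \<in> face_chains" "Q = convex hull (p ` T)"
    by (elim imageE)
  have PQ: "P \<inter> Q = convex hull (p ` (S \<inter> T))" using chain_hull_Int ST by simp
  have sub: "p ` (S \<inter> T) \<subseteq> p ` S" "p ` (S \<inter> T) \<subseteq> p ` T" by auto
  have face: "convex hull (p ` (S \<inter> T)) face_of convex hull (p ` R)"
    if "R \<in> face_chains" "p ` (S \<inter> T) \<subseteq> p ` R" for R
    unfolding face_of_convex_hull_affine_independent[OF chain_affine_independent[OF that(1)]]
    by (intro exI[of _ "p ` (S \<inter> T)"] conjI that(2) refl)
  show "P \<inter> Q face_of P" "P \<inter> Q face_of Q"
    unfolding PQ unfolding ST(2,4) by (rule face[OF ST(1) sub(1)], rule face[OF ST(3) sub(2)])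
qed

lemma derived_underlying: "\<Union>((\<lambda>S. convex hull (p ` S)) ` face_chains) = \<Union>C"
proof (intro equalityI subsetI)
  fix y assume "y \<in> \<Union>((\<lambda>S. convex hull (p ` S)) ` face_chains)"
  then obtain S where S: "S \<in> face_chains" "y \<in> convex hull (p ` S)" by blast
  then have "S \<noteq> {}" by auto
  then obtain F where F: "F \<in> S" "\<And>A. A \<in> S \<Longrightarrow> A \<subseteq> F" using chain_top[OF S(1) chain_finite[OF S(1)]] by blast
  then have "y \<in> F" using chain_hull_subset[OF S(1) chain_cell[OF S(1)]] S(2) by blast
  then show "y \<in> \<Union>C" using chain_cell[OF S(1) F(1)] by blast
next
  fix y assume "y \<in> \<Union>C"
  then obtain F where "F \<in> C - {{}}" "y \<in> F" by blast
  then show "y \<in> \<Union>((\<lambda>S. convex hull (p ` S)) ` face_chains)" using chain_hull_covers by blast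
qed

lemma derived_vertex_scheme: "vertex_scheme ((\<lambda>S. convex hull (p ` S)) ` face_chains) = (`) p ` face_chains"
proof -
  have "{v. v extreme_point_of convex hull (p ` S)} = p ` S" if "S \<in> face_chains" for S
    using extreme_point_of_convex_hull_affine_independent[OF chain_affine_independent[OF that]] by blast
  then show ?thesis unfolding vertex_scheme_def image_image by (rule image_cong[OF refl])
qed

end

lemma derived_subdivisionE:
  fixes C :: "'a::euclidean_space set set"
  assumes "derived_subdivision C D"
  obtains p where "\<And>F. F \<in> C \<Longrightarrow> F \<noteq> {} \<Longrightarrow> p F \<in> rel_interior F"
    and "D = (\<lambda>S. convex hull (p ` S)) ` order_complex (C - {{}})"
proof -
  obtain p where p: "\<forall>F\<in>C. F \<noteq> {} \<longrightarrow> p F \<in> rel_interior F"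
    and D: "D = {convex hull (p ` S) | S. S \<subseteq> C - {{}} \<and> (\<forall>A\<in>S. \<forall>B\<in>S. A \<subseteq> B \<or> B \<subseteq> A)}"
    using assms unfolding derived_subdivision_def by blast
  have "D = (\<lambda>S. convex hull (p ` S)) ` order_complex (C - {{}})"
    unfolding D order_complex_def by blast
  then show ?thesis using that p by blast
qed

lemma iter_derived_polytopal:
  assumes "iter_derived r C D" "polytopal_complex C"
  shows "polytopal_complex D \<and> underlying D = underlying C"
  using assms
proof (induction)
  case (iterSuc r C D E)
  then have D: "polytopal_complex D" "underlying D = underlying C" by simp_all
  obtain p where p: "\<And>F. F \<in> D \<Longrightarrow> F \<noteq> {} \<Longrightarrow> p F \<in> rel_interior F"
    and E: "E = (\<lambda>S. convex hull (p ` S)) ` order_complex (D - {{}})"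
    by (rule derived_subdivisionE[OF iterSuc.hyps(2)]) (rule that)
  show ?case
    unfolding E D(2)[symmetric] unfolding underlying_def
    by (rule conjI[OF derived_polytopal[OF D(1) p] derived_underlying[OF D(1) p]])
qed simp

text \<open>The vertex scheme is the order complex of the nonempty faces relabelled by the injective
  \<open>p\<close>, so \<open>cell_complex_nonevasive\<close> applies. Closure under subsets is
  recorded for the passage to collapsibility.\<close>

lemma derived_nonevasive:
  fixes C :: "'a::euclidean_space set set"
  assumes C: "polytopal_complex C" and star: "starlike (underlying C)" and D: "derived_subdivision C D"
  shows "nonevasive (vertex_scheme D)" and "down_closed (vertex_scheme D)"
proof -
  obtain p where p: "\<And>F. F \<in> C \<Longrightarrow> F \<noteq> {} \<Longrightarrow> p F \<in> rel_interior F"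
    and D': "D = (\<lambda>S. convex hull (p ` S)) ` order_complex (C - {{}})"
    using derived_subdivisionE[OF D] by blast
  have vs: "vertex_scheme D = (`) p ` order_complex (C - {{}})"
    unfolding D' by (rule derived_vertex_scheme[OF C p])
  have "\<Union>(C - {{}}) = underlying C" by (auto simp: underlying_def)
  then have "nonevasive (order_complex (C - {{}}))"
    using cell_complex_nonevasive[OF polytopal_cell_complex[OF C]] star by simp
  then show "nonevasive (vertex_scheme D)"
    unfolding vs by (rule nonevasive_image[OF _ p_inj[OF C p] equalityD1[OF Union_order_complex]])
  show "down_closed (vertex_scheme D)"
    unfolding vs down_closed_def
  proof (intro ballI allI impI)
    fix \<sigma> \<tau> assume "\<sigma> \<in> (`) p ` order_complex (C - {{}})" "\<tau> \<subseteq> \<sigma>"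
    then obtain S where S: "S \<in> order_complex (C - {{}})" "\<tau> \<subseteq> p ` S" by blast
    then obtain S' where "S' \<subseteq> S" "\<tau> = p ` S'" by (auto simp: subset_image_iff)
    then show "\<tau> \<in> (`) p ` order_complex (C - {{}})" using order_complex_subset[OF S(1)] by blast
  qed
qed

section \<open>Simplicial complexes in the plane\<close>

text \<open>In terms of reduced cohomology with coefficients in the field of two elements (written as
  Booleans), \<open>connected_asc\<close> is vanishing in degree 0 and \<open>acyclic_asc\<close> vanishing in degrees 0
  and 1.\<close>

definition connected_asc :: "'v set set \<Rightarrow> bool" where
  "connected_asc K \<longleftrightarrow> \<Union>K \<noteq> {} \<and>
     (\<forall>g::'v \<Rightarrow> bool. (\<forall>a b. {a, b} \<in> K \<longrightarrow> g a = g b) \<longrightarrow> (\<forall>a\<in>\<Union>K. \<forall>b\<in>\<Union>K. g a = g b))"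

definition cocycle :: "'v set set \<Rightarrow> ('v \<Rightarrow> 'v \<Rightarrow> bool) \<Rightarrow> bool" where
  "cocycle K f \<longleftrightarrow> (\<forall>a b c. {a, b, c} \<in> K \<longrightarrow> f a c = (f a b \<noteq> f b c))"

definition acyclic_asc :: "'v set set \<Rightarrow> bool" where
  "acyclic_asc K \<longleftrightarrow> connected_asc K \<and>
     (\<forall>f. cocycle K f \<longrightarrow> (\<exists>g::'v \<Rightarrow> bool. \<forall>a b. {a, b} \<in> K \<longrightarrow> f a b = (g a \<noteq> g b)))"

lemma connected_ascD:
  fixes g :: "'v \<Rightarrow> bool"
  assumes "connected_asc K" "\<And>a b. {a, b} \<in> K \<Longrightarrow> g a = g b" "a \<in> \<Union>K" "b \<in> \<Union>K"
  shows "g a = g b"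
  using assms unfolding connected_asc_def by metis

lemma connected_asc_nonempty: "connected_asc K \<Longrightarrow> \<Union>K \<noteq> {}"
  unfolding connected_asc_def by blast

lemma acyclic_connected: "acyclic_asc K \<Longrightarrow> connected_asc K"
  unfolding acyclic_asc_def by blast

lemma acyclic_primitive:
  assumes "acyclic_asc K" "cocycle K f"
  shows "\<exists>g::_ \<Rightarrow> bool. \<forall>a b. {a, b} \<in> K \<longrightarrow> f a b = (g a \<noteq> g b)"
  using assms unfolding acyclic_asc_def by blast

lemma cocycleD: "cocycle K f \<Longrightarrow> {a, b, c} \<in> K \<Longrightarrow> f a c = (f a b \<noteq> f b c)"
  unfolding cocycle_def by blast

lemma cocycle_refl: "cocycle K f \<Longrightarrow> {a} \<in> K \<Longrightarrow> \<not> f a a"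
  using cocycleD[of K f a a a] by simp

lemma cocycle_sym:
  assumes "down_closed K" "cocycle K f" "{a, b} \<in> K"
  shows "f b a = f a b"
proof -
  have "{a} \<in> K" by (rule down_closedD[OF assms(1,3)]) simp
  then have "\<not> f a a" by (rule cocycle_refl[OF assms(2)])
  moreover have "{a, b, a} = {a, b}" by blast
  ultimately show ?thesis using cocycleD[OF assms(2), of a b a] assms(3) by simp
qed

lemma asc_vertex: "down_closed K \<Longrightarrow> a \<in> \<Union>K \<Longrightarrow> {a} \<in> K"
  unfolding down_closed_def by blast

lemma asc_deletion_subset: "asc_deletion v K \<subseteq> K"
  by (auto simp: asc_deletion_def)

lemma asc_deletion_iff: "\<sigma> \<in> asc_deletion v K \<longleftrightarrow> \<sigma> \<in> K \<and> v \<notin> \<sigma>"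
  by (auto simp: asc_deletion_def)

lemma asc_link_iff: "down_closed K \<Longrightarrow> \<sigma> \<in> asc_link v K \<longleftrightarrow> v \<notin> \<sigma> \<and> insert v \<sigma> \<in> K"
  by (auto simp: asc_link_def dest: down_closedD)

lemma asc_link_vertex: "down_closed K \<Longrightarrow> w \<in> \<Union>(asc_link v K) \<longleftrightarrow> w \<noteq> v \<and> {v, w} \<in> K"
  by (metis UnionI asc_link_iff asc_vertex down_closed_link insert_iff singletonD singletonI)

lemma asc_deletion_vertex: "down_closed K \<Longrightarrow> \<Union>(asc_deletion v K) = \<Union>K - {v}"
proof (intro equalityI subsetI)
  fix a assume "down_closed K" "a \<in> \<Union>K - {v}"
  then have "{a} \<in> asc_deletion v K" using asc_vertex[of K a] by (auto simp: asc_deletion_def)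
  then show "a \<in> \<Union>(asc_deletion v K)" by blast
qed (auto simp: asc_deletion_def)

text \<open>A Mayer-Vietoris argument: a primitive on the deletion differs from \<open>f v\<close>
  by a function that is constant along the connected link, and this constant is the value that
  extends the primitive to \<open>v\<close>.\<close>

lemma nonevasive_acyclic:
  assumes "nonevasive K" "down_closed K"
  shows "acyclic_asc K"
  using assms
proof (induction)
  case (point v)
  have edge: "a = v \<and> b = v" if "{a, b} \<in> {{}, {v}}" for a b using that by auto
  have "\<exists>g::_ \<Rightarrow> bool. \<forall>a b. {a, b} \<in> {{}, {v}} \<longrightarrow> f a b = (g a \<noteq> g b)" if "cocycle {{}, {v}} f" for f
    using cocycle_refl[OF that, of v] edge by (intro exI[of _ "\<lambda>_. True"]) auto
  then show ?case unfolding acyclic_asc_def connected_asc_def by auto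
next
  case (step K v)
  note K = step.prems
  have L: "acyclic_asc (asc_link v K)" and D: "acyclic_asc (asc_deletion v K)"
    using step.IH down_closed_link[OF K] down_closed_deletion[OF K] by blast+
  obtain w where w: "w \<in> \<Union>(asc_link v K)" using connected_asc_nonempty[OF acyclic_connected[OF L]] by blast
  have wv: "w \<noteq> v" "{v, w} \<in> K" using w asc_link_vertex[OF K] by blast+
  have DV: "\<Union>(asc_deletion v K) = \<Union>K - {v}" by (rule asc_deletion_vertex[OF K])
  have conn: "connected_asc K"
    unfolding connected_asc_def
  proof (intro conjI allI impI ballI)
    show "\<Union>K \<noteq> {}" using wv by blast
    fix g :: "_ \<Rightarrow> bool" and a b
    assume g: "\<forall>a b. {a, b} \<in> K \<longrightarrow> g a = g b" and ab: "a \<in> \<Union>K" "b \<in> \<Union>K"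
    have "w \<in> \<Union>K - {v}" using wv by blast
    then have "g c = g w" if "c \<in> \<Union>K - {v}" for c
    proof (intro connected_ascD[OF acyclic_connected[OF D], of g c w])
      show "g a = g b" if "{a, b} \<in> asc_deletion v K" for a b using that g by (simp add: asc_deletion_iff)
    qed (use that DV in simp_all)
    moreover have "g v = g w" using g wv by blast
    ultimately have "g c = g w" if "c \<in> \<Union>K" for c using that by (cases "c = v") auto
    then show "g a = g b" using ab by simp
  qed
  have "\<exists>g::_ \<Rightarrow> bool. \<forall>a b. {a, b} \<in> K \<longrightarrow> f a b = (g a \<noteq> g b)" if f: "cocycle K f" for f
  proof -
    have "cocycle (asc_deletion v K) f" using f by (auto simp: cocycle_def asc_deletion_iff)
    then obtain g :: "_ \<Rightarrow> bool" where g: "\<And>a b. {a, b} \<in> asc_deletion v K \<Longrightarrow> f a b = (g a \<noteq> g b)"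
      using acyclic_primitive[OF D] by blast
    have const: "(f v b \<noteq> g b) = (f v w \<noteq> g w)" if b: "b \<in> \<Union>(asc_link v K)" for b
    proof (rule connected_ascD[OF acyclic_connected[OF L] _ b w])
      fix b c assume "{b, c} \<in> asc_link v K"
      then have bc: "{b, c} \<in> asc_deletion v K" "{v, b, c} \<in> K"
        by (auto simp: asc_link_def asc_deletion_def)
      show "(f v b \<noteq> g b) = (f v c \<noteq> g c)" using g[OF bc(1)] cocycleD[OF f bc(2)] by blast
    qed
    define g' where "g' = g(v := (f v w \<noteq> g w))"
    have gv: "f v b = (g' v \<noteq> g' b)" if "{v, b} \<in> K" for b
    proof (cases "b = v")
      case True
      then show ?thesis using cocycle_refl[OF f, of v] that by simp
    next
      case False
      then have "b \<in> \<Union>(asc_link v K)" using that asc_link_vertex[OF K] by blast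
      then show ?thesis using const[of b] False by (simp add: g'_def) blast
    qed
    have "f a b = (g' a \<noteq> g' b)" if ab: "{a, b} \<in> K" for a b
    proof -
      consider "a = v" | "b = v" | "a \<noteq> v" "b \<noteq> v" by blast
      then show ?thesis
      proof cases
        case 1
        then show ?thesis using gv ab by blast
      next
        case 2
        then have "{v, a} \<in> K" using ab by (simp add: insert_commute)
        then show ?thesis using gv[of a] cocycle_sym[OF K f ab] 2 by auto
      next
        case 3
        then have "{a, b} \<in> asc_deletion v K" using ab by (simp add: asc_deletion_iff)
        then show ?thesis using g[of a b] 3 by (simp add: g'_def)
      qed
    qed
    then show ?thesis by blast
  qed
  then show ?case using conn unfolding acyclic_asc_def by blast
qed

text \<open>The same gluing read backwards: a primitive on the link extends a cocycle from the
  deletion over \<open>v\<close>, so that a primitive on \<open>K\<close> can be restricted.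
  Connectedness of the link keeps the deletion from falling apart.\<close>

lemma acyclic_deletion:
  assumes K: "down_closed K" "acyclic_asc K" and L: "acyclic_asc (asc_link v K)"
  shows "acyclic_asc (asc_deletion v K)"
proof -
  obtain w where w: "w \<in> \<Union>(asc_link v K)" using connected_asc_nonempty[OF acyclic_connected[OF L]] by blast
  have wv: "w \<noteq> v" "{v, w} \<in> K" using w asc_link_vertex[OF K(1)] by blast+
  have DV: "\<Union>(asc_deletion v K) = \<Union>K - {v}" by (rule asc_deletion_vertex[OF K(1)])
  have LD: "\<sigma> \<in> asc_deletion v K" if "\<sigma> \<in> asc_link v K" for \<sigma>
    using that by (auto simp: asc_link_def asc_deletion_def)
  have "connected_asc (asc_deletion v K)"
    unfolding connected_asc_def
  proof (intro conjI allI impI ballI)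
    show "\<Union>(asc_deletion v K) \<noteq> {}" unfolding DV using wv by blast
    fix g :: "_ \<Rightarrow> bool" and a b
    assume g: "\<forall>a b. {a, b} \<in> asc_deletion v K \<longrightarrow> g a = g b"
      and ab: "a \<in> \<Union>(asc_deletion v K)" "b \<in> \<Union>(asc_deletion v K)"
    have gw: "g c = g w" if "c \<in> \<Union>(asc_link v K)" for c
    proof (rule connected_ascD[OF acyclic_connected[OF L] _ that w])
      show "g a = g b" if "{a, b} \<in> asc_link v K" for a b using g LD[OF that] by simp
    qed
    define g' where "g' = g(v := g w)"
    have "g' a = g' b"
    proof (rule connected_ascD[OF acyclic_connected[OF K(2)]])
      show "a \<in> \<Union>K" "b \<in> \<Union>K" using ab DV by blast+
      have gv: "g' c = g' v" if "{v, c} \<in> K" for c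
        using gw[of c] that asc_link_vertex[OF K(1), of c v] by (cases "c = v") (auto simp: g'_def)
      fix c d assume cd: "{c, d} \<in> K"
      consider "c = v" | "d = v" | "c \<noteq> v" "d \<noteq> v" by blast
      then show "g' c = g' d"
      proof cases
        case 1
        then show ?thesis using gv[of d] cd by simp
      next
        case 2
        then show ?thesis using gv[of c] cd by (simp add: insert_commute)
      next
        case 3
        then have "{c, d} \<in> asc_deletion v K" using cd by (simp add: asc_deletion_iff)
        then show ?thesis using g 3 by (simp add: g'_def)
      qed
    qed
    then show "g a = g b" using ab unfolding DV by (simp add: g'_def)
  qed
  moreover have "\<exists>g::_ \<Rightarrow> bool. \<forall>a b. {a, b} \<in> asc_deletion v K \<longrightarrow> f a b = (g a \<noteq> g b)"
    if f: "cocycle (asc_deletion v K) f" for f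
  proof -
    have "cocycle (asc_link v K) f" using f LD by (auto simp: cocycle_def)
    then obtain k :: "_ \<Rightarrow> bool" where k: "\<And>a b. {a, b} \<in> asc_link v K \<Longrightarrow> f a b = (k a \<noteq> k b)"
      using acyclic_primitive[OF L] by blast
    \<comment> \<open>On the cone over the link this is the coboundary of \<open>k\<close> with
      value \<open>False\<close> at \<open>v\<close>; the conjunct \<open>b \<noteq> v\<close> keeps
      the degenerate edge at \<open>v\<close> trivial.\<close>
    define f' where "f' a b = (if a = v then b \<noteq> v \<and> k b else if b = v then k a else f a b)" for a b
    have lk: "f a b = (k a \<noteq> k b)" if "{v, a, b} \<in> K" "a \<noteq> v" "b \<noteq> v" for a b
      using that by (intro k) (simp add: asc_link_iff[OF K(1)])
    have "f' a c = (f' a b \<noteq> f' b c)" if abc: "{a, b, c} \<in> K" for a b c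
    proof -
      have "{a, b, c} \<in> asc_deletion v K" if "a \<noteq> v" "b \<noteq> v" "c \<noteq> v"
        using abc that by (simp add: asc_deletion_iff)
      moreover have "f b c = (k b \<noteq> k c)" if "a = v" "b \<noteq> v" "c \<noteq> v"
        using abc that lk by blast
      moreover have "f a c = (k a \<noteq> k c)" if "b = v" "a \<noteq> v" "c \<noteq> v"
        using abc that lk[of a c] by (simp add: insert_commute)
      moreover have "f a b = (k a \<noteq> k b)" if "c = v" "a \<noteq> v" "b \<noteq> v"
        using abc that lk[of a b] by (simp add: insert_commute)
      ultimately show ?thesis
        using cocycleD[OF f, of a b c] unfolding f'_def by (cases "a = v"; cases "b = v"; cases "c = v") auto
    qed
    then have "cocycle K f'" unfolding cocycle_def by blast
    then obtain g :: "_ \<Rightarrow> bool" where g: "\<And>a b. {a, b} \<in> K \<Longrightarrow> f' a b = (g a \<noteq> g b)"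
      using acyclic_primitive[OF K(2)] by blast
    have "f a b = (g a \<noteq> g b)" if "{a, b} \<in> asc_deletion v K" for a b
      using g[of a b] that by (auto simp: asc_deletion_iff f'_def split: if_splits)
    then show ?thesis by blast
  qed
  ultimately show ?thesis unfolding acyclic_asc_def by blast
qed

text \<open>Functions and cocycles on \<open>K'\<close> are pulled back along the simplicial map
  \<open>r\<close>; since \<open>r\<close> fixes the vertices of \<open>K'\<close>, a primitive on
  \<open>K\<close> restricts to one on \<open>K'\<close>.\<close>

lemma acyclic_retract:
  assumes K: "acyclic_asc K" and sub: "K' \<subseteq> K"
    and r: "\<And>\<sigma>. \<sigma> \<in> K \<Longrightarrow> r ` \<sigma> \<in> K'" and id: "\<And>a. a \<in> \<Union>K' \<Longrightarrow> r a = a"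
  shows "acyclic_asc K'"
proof -
  have "connected_asc K'"
    unfolding connected_asc_def
  proof (intro conjI allI impI ballI)
    obtain a \<sigma> where "a \<in> \<sigma>" "\<sigma> \<in> K" using connected_asc_nonempty[OF acyclic_connected[OF K]] by blast
    then show "\<Union>K' \<noteq> {}" using r by blast
    fix g :: "_ \<Rightarrow> bool" and a b
    assume g: "\<forall>a b. {a, b} \<in> K' \<longrightarrow> g a = g b" and ab: "a \<in> \<Union>K'" "b \<in> \<Union>K'"
    have "(g \<circ> r) a = (g \<circ> r) b"
    proof (rule connected_ascD[OF acyclic_connected[OF K]])
      show "(g \<circ> r) a = (g \<circ> r) b" if "{a, b} \<in> K" for a b using g r[OF that] by simp
      show "a \<in> \<Union>K" "b \<in> \<Union>K" using ab sub by blast+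
    qed
    then show "g a = g b" using id ab by simp
  qed
  moreover have "\<exists>g::_ \<Rightarrow> bool. \<forall>a b. {a, b} \<in> K' \<longrightarrow> f a b = (g a \<noteq> g b)" if f: "cocycle K' f" for f
  proof -
    have "cocycle K (\<lambda>a b. f (r a) (r b))"
      unfolding cocycle_def
    proof (intro allI impI)
      fix a b c assume "{a, b, c} \<in> K"
      then have "{r a, r b, r c} \<in> K'" using r[of "{a, b, c}"] by simp
      then show "f (r a) (r c) = (f (r a) (r b) \<noteq> f (r b) (r c))" by (rule cocycleD[OF f])
    qed
    then obtain g :: "_ \<Rightarrow> bool" where g: "\<And>a b. {a, b} \<in> K \<Longrightarrow> f (r a) (r b) = (g a \<noteq> g b)"
      using acyclic_primitive[OF K] by blast
    have "f a b = (g a \<noteq> g b)" if "{a, b} \<in> K'" for a b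
    proof -
      have "r a = a" "r b = b" using that by (auto intro!: id)
      then show ?thesis using g[of a b] that sub by auto
    qed
    then show ?thesis by blast
  qed
  ultimately show ?thesis unfolding acyclic_asc_def by blast
qed

text \<open>Sending each simplex to a chosen vertex of it is a simplicial map, as the images of a
  chain lie in its largest member. Cocycles are pulled back along it, and primitives are read off at
  the singletons.\<close>

lemma acyclic_of_order_complex:
  assumes K: "down_closed K" and oc: "acyclic_asc (order_complex (K - {{}}))"
  shows "acyclic_asc K"
proof -
  define e :: "'a set \<Rightarrow> 'a" where "e \<sigma> = (SOME a. a \<in> \<sigma>)" for \<sigma>
  have e: "e \<sigma> \<in> \<sigma>" if "\<sigma> \<in> K - {{}}" for \<sigma>
    unfolding e_def by (rule someI_ex) (use that in blast)
  have e1: "e {a} = a" for a by (simp add: e_def)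
  have top: "e ` S \<in> K" if S: "S \<in> order_complex (K - {{}})" and fin: "finite S" and ne: "S \<noteq> {}" for S
  proof -
    obtain F where F: "F \<in> S" "\<And>A. A \<in> S \<Longrightarrow> A \<subseteq> F" using chain_top[OF S fin ne] by blast
    have SK: "S \<subseteq> K - {{}}" using S by (simp add: order_complex_def)
    have "e ` S \<subseteq> F" using e F(2) SK by blast
    then show ?thesis using down_closedD[OF K] F(1) SK by blast
  qed
  have edge: "{{a}, \<tau>} \<in> order_complex (K - {{}})" if "\<tau> \<in> K" "a \<in> \<tau>" for a \<tau>
    using that down_closedD[OF K that(1), of "{a}"] by (auto simp: order_complex_def)
  have U: "{a} \<in> \<Union>(order_complex (K - {{}}))" if "a \<in> \<Union>K" for a
    unfolding Union_order_complex using asc_vertex[OF K that] by simp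
  have "connected_asc K"
    unfolding connected_asc_def
  proof (intro conjI allI impI ballI)
    have "K - {{}} \<noteq> {}" using connected_asc_nonempty[OF acyclic_connected[OF oc]] by (simp only: Union_order_complex not_False_eq_True)
    then show "\<Union>K \<noteq> {}" by blast
    fix g :: "_ \<Rightarrow> bool" and a b
    assume g: "\<forall>a b. {a, b} \<in> K \<longrightarrow> g a = g b" and ab: "a \<in> \<Union>K" "b \<in> \<Union>K"
    have "(g \<circ> e) {a} = (g \<circ> e) {b}"
    proof (rule connected_ascD[OF acyclic_connected[OF oc] _ U[OF ab(1)] U[OF ab(2)]])
      fix A B assume "{A, B} \<in> order_complex (K - {{}})"
      then have "{e A, e B} \<in> K" using top[of "{A, B}"] by simp
      then show "(g \<circ> e) A = (g \<circ> e) B" using g by simp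
    qed
    then show "g a = g b" by (simp add: e1)
  qed
  moreover have "\<exists>g::_ \<Rightarrow> bool. \<forall>a b. {a, b} \<in> K \<longrightarrow> f a b = (g a \<noteq> g b)" if f: "cocycle K f" for f
  proof -
    have "cocycle (order_complex (K - {{}})) (\<lambda>A B. f (e A) (e B))"
      unfolding cocycle_def
    proof (intro allI impI)
      fix A B D assume "{A, B, D} \<in> order_complex (K - {{}})"
      then have "{e A, e B, e D} \<in> K" using top[of "{A, B, D}"] by simp
      then show "f (e A) (e D) = (f (e A) (e B) \<noteq> f (e B) (e D))" by (rule cocycleD[OF f])
    qed
    then obtain g :: "_ \<Rightarrow> bool" where g: "\<And>A B. {A, B} \<in> order_complex (K - {{}}) \<Longrightarrow> f (e A) (e B) = (g A \<noteq> g B)"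
      using acyclic_primitive[OF oc] by blast
    have "f a b = (g {a} \<noteq> g {b})" if ab: "{a, b} \<in> K" for a b
    proof -
      \<comment> \<open>An edge is evaluated through its barycentre: \<open>{a}\<close> and
        \<open>{b}\<close> are both joined to \<open>{a, b}\<close> in the order complex, whose
        chosen vertex \<open>?c\<close> is one of the two ends.\<close>
      let ?c = "e {a, b}"
      have c: "?c \<in> {a, b}" using e[of "{a, b}"] ab by simp
      have 1: "f a ?c = (g {a} \<noteq> g {a, b})" "f b ?c = (g {b} \<noteq> g {a, b})"
        using g[OF edge[OF ab, of a]] g[OF edge[OF ab, of b]] by (simp_all add: e1)
      have "{a, ?c, b} = {a, b}" using c by auto
      then have 2: "f a b = (f a ?c \<noteq> f ?c b)" using cocycleD[OF f, of a ?c b] ab by simp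
      have "{b, ?c} \<in> K" by (rule down_closedD[OF K ab]) (use c in auto)
      then have "f ?c b = f b ?c" by (rule cocycle_sym[OF K f])
      then show ?thesis using 1 2 by auto
    qed
    then show ?thesis by (intro exI[of _ "\<lambda>a. g {a}"]) blast
  qed
  ultimately show ?thesis unfolding acyclic_asc_def by blast
qed

lemma connected_asc_neighbour:
  assumes "down_closed K" "connected_asc K" "v \<in> \<Union>K" "\<Union>K \<noteq> {v}"
  shows "\<exists>w. w \<noteq> v \<and> {v, w} \<in> K"
proof (rule ccontr)
  assume no: "\<nexists>w. w \<noteq> v \<and> {v, w} \<in> K"
  obtain u where u: "u \<in> \<Union>K" "u \<noteq> v" using assms(3,4) by blast
  have "(v = v) = (u = v)"
  proof (rule connected_ascD[OF assms(2) _ assms(3) u(1)])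
    show "(a = v) = (b = v)" if "{a, b} \<in> K" for a b
      using no that by (metis insert_commute)
  qed
  then show False using u(2) by simp
qed

text \<open>As no edge jumps over a vertex, the last vertex \<open>m\<close> in the order given by
  \<open>s\<close> has exactly one neighbour \<open>b\<close>; its link is a point and its deletion
  stays connected.\<close>

lemma path_nonevasive:
  fixes s :: "'v \<Rightarrow> real"
  assumes "down_closed K" "finite (\<Union>K)" "\<And>\<sigma>. \<sigma> \<in> K \<Longrightarrow> card \<sigma> \<le> 2" "inj_on s (\<Union>K)"
    and "\<And>a b c. {a, b} \<in> K \<Longrightarrow> c \<in> \<Union>K \<Longrightarrow> \<not> (s a < s c \<and> s c < s b)"
    and "connected_asc K"
  shows "nonevasive K"
  using assms
proof (induction "card (\<Union>K)" arbitrary: K rule: less_induct)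
  case less
  note K = less.prems(1) and fin = less.prems(2) and between = less.prems(5)
  have ne: "\<Union>K \<noteq> {}" using less.prems(6) unfolding connected_asc_def by blast
  have "Max (s ` \<Union>K) \<in> s ` \<Union>K" using fin ne by (intro Max_in) auto
  then obtain m where m: "m \<in> \<Union>K" "s m = Max (s ` \<Union>K)" by (metis imageE)
  have smax: "s a < s m" if "a \<in> \<Union>K" "a \<noteq> m" for a
  proof -
    have "s a \<le> s m" unfolding m(2) using that(1) fin by (intro Max_ge) auto
    moreover have "s a \<noteq> s m" using that m(1) inj_onD[OF less.prems(4)] by blast
    ultimately show ?thesis by simp
  qed
  show ?case
  proof (cases "\<Union>K = {m}")
    case True
    have "{m} \<in> K" by (rule asc_vertex[OF K m(1)])
    then have "K = {{}, {m}}" using True down_closedD[OF K, of "{m}" "{}"] by auto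
    then show ?thesis by (simp add: nonevasive.point)
  next
    case False
    obtain b where b: "b \<noteq> m" "{m, b} \<in> K" using connected_asc_neighbour[OF K less.prems(6) m(1) False] by blast
    have uniq: "c = b" if c: "c \<noteq> m" "{m, c} \<in> K" for c
    proof (rule ccontr)
      assume "c \<noteq> b"
      have V: "b \<in> \<Union>K" "c \<in> \<Union>K" using b c by blast+
      have "s b \<noteq> s c" using inj_onD[OF less.prems(4) _ V] \<open>c \<noteq> b\<close> by blast
      moreover have "\<not> s b < s c"
        using between[of b m c] b V smax[OF V(2) c(1)] by (simp add: insert_commute)
      moreover have "\<not> s c < s b"
        using between[of c m b] c V smax[OF V(1) b(1)] by (simp add: insert_commute)
      ultimately show False by simp
    qed
    have link: "asc_link m K = {{}, {b}}"
    proof (intro equalityI subsetI)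
      fix \<sigma> assume "\<sigma> \<in> asc_link m K"
      then have s: "m \<notin> \<sigma>" "insert m \<sigma> \<in> K" by (simp_all add: asc_link_iff[OF K])
      have "c = b" if "c \<in> \<sigma>" for c
      proof (rule uniq)
        show "c \<noteq> m" using s(1) that by blast
        show "{m, c} \<in> K" by (rule down_closedD[OF K s(2)]) (use that in auto)
      qed
      then show "\<sigma> \<in> {{}, {b}}" by auto
    next
      fix \<sigma> assume "\<sigma> \<in> {{}, {b}}"
      then show "\<sigma> \<in> asc_link m K" using b asc_vertex[OF K m(1)] by (auto simp: asc_link_iff[OF K])
    qed
    have DV: "\<Union>(asc_deletion m K) = \<Union>K - {m}" by (rule asc_deletion_vertex[OF K])
    have "nonevasive (asc_deletion m K)"
    proof (rule less.hyps)
      show "card (\<Union>(asc_deletion m K)) < card (\<Union>K)" unfolding DV by (rule card_Diff1_less[OF fin m(1)])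
      show "down_closed (asc_deletion m K)" by (rule down_closed_deletion[OF K])
      show "finite (\<Union>(asc_deletion m K))" using fin by (simp add: DV)
      show "card \<sigma> \<le> 2" if "\<sigma> \<in> asc_deletion m K" for \<sigma> using that less.prems(3) by (simp add: asc_deletion_iff)
      show "inj_on s (\<Union>(asc_deletion m K))" unfolding DV by (rule inj_on_subset[OF less.prems(4)]) blast
      show "\<not> (s a < s c \<and> s c < s d)" if "{a, d} \<in> asc_deletion m K" "c \<in> \<Union>(asc_deletion m K)" for a d c
        using that between[of a d c] unfolding DV asc_deletion_iff by blast
      show "connected_asc (asc_deletion m K)"
        unfolding connected_asc_def
      proof (intro conjI allI impI ballI)
        show "\<Union>(asc_deletion m K) \<noteq> {}" unfolding DV using b by blast
        fix g :: "_ \<Rightarrow> bool" and x y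
        assume g: "\<forall>a b. {a, b} \<in> asc_deletion m K \<longrightarrow> g a = g b"
          and xy: "x \<in> \<Union>(asc_deletion m K)" "y \<in> \<Union>(asc_deletion m K)"
        have "(g(m := g b)) x = (g(m := g b)) y"
        proof (rule connected_ascD[OF less.prems(6)])
          show "x \<in> \<Union>K" "y \<in> \<Union>K" using xy DV by blast+
          fix c d assume cd: "{c, d} \<in> K"
          consider "c = m" "d = m" | "c = m" "d \<noteq> m" | "d = m" "c \<noteq> m" | "c \<noteq> m" "d \<noteq> m" by blast
          then show "(g(m := g b)) c = (g(m := g b)) d"
          proof cases
            case 2
            then show ?thesis using uniq[of d] cd by simp
          next
            case 3
            then show ?thesis using uniq[of c] cd by (simp add: insert_commute)
          next
            case 4
            then have "{c, d} \<in> asc_deletion m K" using cd by (simp add: asc_deletion_iff)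
            then show ?thesis using g 4 by simp
          qed simp
        qed
        then show "g x = g y" using xy unfolding DV by simp
      qed
    qed
    moreover have "nonevasive (asc_link m K)" unfolding link by (rule nonevasive.point)
    ultimately show ?thesis by (rule nonevasive_link_deletion[rotated])
  qed
qed

section \<open>Planar complexes and their removable vertices\<close>

definition planar_asc :: "'a::euclidean_space set set \<Rightarrow> bool" where
  "planar_asc K \<longleftrightarrow> DIM('a) = 2 \<and> down_closed K \<and> finite (\<Union>K) \<and> (\<forall>\<sigma>\<in>K. card \<sigma> \<le> 3) \<and>
     (\<forall>\<sigma>\<in>K. \<forall>\<tau>\<in>K. convex hull \<sigma> \<inter> convex hull \<tau> = convex hull (\<sigma> \<inter> \<tau>))"

lemma planar_asc_subset: "planar_asc K \<Longrightarrow> K' \<subseteq> K \<Longrightarrow> down_closed K' \<Longrightarrow> planar_asc K'"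
  unfolding planar_asc_def by (meson Union_mono finite_subset subsetD)

lemma common_direction_zero:
  assumes "convex P" "convex Q" "P \<inter> Q = {v}" "u \<in> tangent_cone v P" "u \<in> tangent_cone v Q"
  shows "u = 0"
proof -
  obtain e f where e: "e > 0" "v + e *\<^sub>R u \<in> P" and f: "f > 0" "v + f *\<^sub>R u \<in> Q"
    using assms(4,5) by (auto simp: tangent_cone_def)
  define t where "t = min e f"
  have t: "t > 0" "t \<le> e" "t \<le> f" using e(1) f(1) by (simp_all add: t_def)
  have v: "v \<in> P" "v \<in> Q" using assms(3) by blast+
  have "v + t *\<^sub>R u \<in> P" by (rule convex_point_between[OF assms(1) v(1) e(2)]) (use t in auto)
  moreover have "v + t *\<^sub>R u \<in> Q" by (rule convex_point_between[OF assms(2) v(2) f(2)]) (use t in auto)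
  ultimately have "v + t *\<^sub>R u \<in> {v}" using assms(3) by blast
  then show ?thesis using t(1) by simp
qed

text \<open>Cutting the simplices at a highest vertex \<open>v\<close> with a line just below it identifies the link
  with a subset of that line, along which \<open>s\<close> is a coordinate.\<close>
lemma planar_top_link_nonevasive:
  fixes K :: "'a::euclidean_space set set"
  assumes K: "planar_asc K" and v: "v \<in> \<Union>K" and top: "\<And>w. w \<in> \<Union>K \<Longrightarrow> w \<noteq> v \<Longrightarrow> a \<bullet> w < a \<bullet> v"
    and conn: "connected_asc (asc_link v K)"
  shows "nonevasive (asc_link v K)"
proof -
  have dc: "down_closed K" and fin: "finite (\<Union>K)" and c3: "\<And>\<sigma>. \<sigma> \<in> K \<Longrightarrow> card \<sigma> \<le> 3"
    and hull: "\<And>\<sigma> \<tau>. \<sigma> \<in> K \<Longrightarrow> \<tau> \<in> K \<Longrightarrow> convex hull \<sigma> \<inter> convex hull \<tau> = convex hull (\<sigma> \<inter> \<tau>)"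
    and dim: "DIM('a) = 2"
    using K unfolding planar_asc_def by blast+
  have LV: "w \<in> \<Union>(asc_link v K) \<longleftrightarrow> w \<noteq> v \<and> {v, w} \<in> K" for w by (rule asc_link_vertex[OF dc])
  have low: "a \<bullet> w < a \<bullet> v" if "w \<in> \<Union>(asc_link v K)" for w using top[of w] that LV by blast
  obtain w0 where "w0 \<in> \<Union>(asc_link v K)" using connected_asc_nonempty[OF conn] by blast
  then have a0: "a \<noteq> 0" using low[of w0] by auto
  \<comment> \<open>In the plane \<open>a\<close> and the orthogonal \<open>b\<close> are
    coordinates, so among directions on which \<open>a\<close> is -1 the value of \<open>b\<close>
    determines the direction.\<close>
  obtain b where b: "b \<noteq> 0" "orthogonal a b" using orthogonal_to_vector_exists[of a] dim by auto
  have coord: "u = u'" if "a \<bullet> u = a \<bullet> u'" "b \<bullet> u = b \<bullet> u'" for u u'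
  proof -
    have "pairwise orthogonal {a, b}" using b(2) by (auto simp: pairwise_def orthogonal_commute)
    moreover have "0 \<notin> {a, b}" using a0 b(1) by simp
    ultimately have "independent {a, b}" by (rule pairwise_orthogonal_independent)
    moreover have "a \<noteq> b" using b a0 by (auto simp: orthogonal_def)
    then have "card {a, b} = 2" by simp
    ultimately have "UNIV \<subseteq> span {a, b}"
      using dim by (intro card_ge_dim_independent) simp_all
    then have "u - u' \<in> span {a, b}" by blast
    moreover have "orthogonal (u - u') x" if "x \<in> {a, b}" for x
    proof -
      have "x \<bullet> (u - u') = 0" using that \<open>a \<bullet> u = a \<bullet> u'\<close> \<open>b \<bullet> u = b \<bullet> u'\<close>
        by (auto simp: inner_diff_right)
      then show ?thesis by (simp only: orthogonal_def inner_commute[of _ x])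
    qed
    ultimately have "orthogonal (u - u') (u - u')" by (rule orthogonal_to_span)
    then show ?thesis by (simp add: orthogonal_self)
  qed
  define d where "d w = (1 / (a \<bullet> v - a \<bullet> w)) *\<^sub>R (w - v)" for w
  define s where "s w = b \<bullet> d w" for w
  have ad: "a \<bullet> d w = -1" if "w \<in> \<Union>(asc_link v K)" for w
    using lower_slice_nonempty[of w "{w}" a v] low[OF that] by (simp add: d_def lower_slice_def)
  have dcone: "d w \<in> tangent_cone v (convex hull \<sigma>)" if "w \<in> \<Union>(asc_link v K)" "w \<in> \<sigma>" for w \<sigma>
    using lower_slice_nonempty[of w "convex hull \<sigma>" a v] low[OF that(1)] hull_inc[OF that(2)]
    by (simp add: d_def lower_slice_def)
  have apart: False
    if "\<sigma> \<in> K" "\<tau> \<in> K" "\<sigma> \<inter> \<tau> = {v}" "u \<in> tangent_cone v (convex hull \<sigma>)" "u \<in> tangent_cone v (convex hull \<tau>)"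
      and au: "a \<bullet> u = -1" for \<sigma> \<tau> u
  proof -
    have "convex hull \<sigma> \<inter> convex hull \<tau> = {v}" using hull[OF that(1,2)] that(3) by simp
    then have "u = 0" by (rule common_direction_zero[OF convex_convex_hull convex_convex_hull _ that(4,5)])
    then show False using au by simp
  qed
  show ?thesis
  proof (rule path_nonevasive[where s = s])
    show "down_closed (asc_link v K)" by (rule down_closed_link[OF dc])
    have "asc_link v K \<subseteq> K" by (auto simp: asc_link_def)
    then show "finite (\<Union>(asc_link v K))" by (intro finite_subset[OF Union_mono fin])
    show "card \<sigma> \<le> 2" if s: "\<sigma> \<in> asc_link v K" for \<sigma>
    proof -
      have "v \<notin> \<sigma>" "insert v \<sigma> \<in> K" using s by (simp_all add: asc_link_iff[OF dc])
      moreover have "finite \<sigma>" using s \<open>asc_link v K \<subseteq> K\<close> by (intro finite_subset[OF _ fin]) blast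
      ultimately show ?thesis using c3[of "insert v \<sigma>"] by simp
    qed
    \<comment> \<open>Equal coordinates would give two edges at \<open>v\<close> the same direction,
      although they meet in \<open>v\<close> only.\<close>
    show "inj_on s (\<Union>(asc_link v K))"
    proof (rule inj_onI, rule ccontr)
      fix w w' assume w: "w \<in> \<Union>(asc_link v K)" "w' \<in> \<Union>(asc_link v K)" "s w = s w'" "w \<noteq> w'"
      have "d w = d w'" using coord[of "d w" "d w'"] ad w by (simp add: s_def)
      moreover have "{v, w} \<in> K" "{v, w'} \<in> K" "{v, w} \<inter> {v, w'} = {v}" using w LV by auto
      ultimately show False
        using apart[of "{v, w}" "{v, w'}" "d w"] dcone[OF w(1), of "{v, w}"] dcone[OF w(2), of "{v, w'}"] ad[OF w(1)]
        by simp
    qed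
    \<comment> \<open>For a vertex strictly between the ends of a link edge, the edge from
      \<open>v\<close> would enter the triangle \<open>{v, p, q}\<close>, which it meets in
      \<open>v\<close> only.\<close>
    show "\<not> (s p < s c \<and> s c < s q)" if pq: "{p, q} \<in> asc_link v K" and c: "c \<in> \<Union>(asc_link v K)" for p q c
    proof
      assume lt: "s p < s c \<and> s c < s q"
      have p: "p \<in> \<Union>(asc_link v K)" and q: "q \<in> \<Union>(asc_link v K)" using pq by blast+
      define l where "l = (s c - s p) / (s q - s p)"
      have l: "0 \<le> l" "l \<le> 1" using lt by (auto simp: l_def field_simps)
      have sl: "s c = s p + l * (s q - s p)" using lt by (simp add: l_def)
      let ?T = "convex hull {v, p, q}"
      have "d c = (1 - l) *\<^sub>R d p + l *\<^sub>R d q"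
      proof (rule coord)
        show "a \<bullet> d c = a \<bullet> ((1 - l) *\<^sub>R d p + l *\<^sub>R d q)" using ad[OF p] ad[OF q] ad[OF c] by (simp add: inner_add_right)
        show "b \<bullet> d c = b \<bullet> ((1 - l) *\<^sub>R d p + l *\<^sub>R d q)"
          using sl unfolding s_def by (simp add: inner_add_right algebra_simps)
      qed
      moreover have "polyhedron (tangent_cone v ?T)"
        by (intro polyhedron_tangent_cone polyhedron_convex_hull) (simp_all add: hull_inc)
      then have "convex (tangent_cone v ?T)" by (rule polyhedron_imp_convex)
      then have "(1 - l) *\<^sub>R d p + l *\<^sub>R d q \<in> tangent_cone v ?T"
        using dcone[OF p, of "{v, p, q}"] dcone[OF q, of "{v, p, q}"] l by (intro convexD) auto
      ultimately have "d c \<in> tangent_cone v ?T" by simp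
      moreover have "d c \<in> tangent_cone v (convex hull {v, c})" by (rule dcone[OF c]) simp
      moreover have "{v, p, q} \<in> K" "{v, c} \<in> K" using pq c LV by (auto simp: asc_link_iff[OF dc])
      moreover have "{v, p, q} \<inter> {v, c} = {v}" using lt c LV by auto
      ultimately show False using apart ad[OF c] by blast
    qed
    show "connected_asc (asc_link v K)" by (rule conn)
  qed
qed

lemma not_connected_link:
  assumes "\<not> connected_asc L" "\<Union>L \<noteq> {}"
  obtains g :: "'v \<Rightarrow> bool" and a b where "\<And>a b. {a, b} \<in> L \<Longrightarrow> g a = g b" "a \<in> \<Union>L" "b \<in> \<Union>L" "g a \<noteq> g b"
  using assms unfolding connected_asc_def by blast

text \<open>Two vertices are asked for so that the induction works at a cut vertex \<open>v\<close>:
  in each piece one of them differs from \<open>v\<close>, and its link in the piece is its link in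
  \<open>K\<close>.\<close>

lemma planar_two_vertices:
  fixes K :: "'a::euclidean_space set set"
  assumes "planar_asc K" "acyclic_asc K" "\<And>z. \<Union>K \<noteq> {z}"
    and "\<And>x y. x \<in> \<Union>K \<Longrightarrow> y \<in> \<Union>K \<Longrightarrow> a \<bullet> x = a \<bullet> y \<Longrightarrow> x = y"
  shows "\<exists>v\<in>\<Union>K. \<exists>w\<in>\<Union>K. v \<noteq> w \<and> nonevasive (asc_link v K) \<and> nonevasive (asc_link w K)"
  using assms
proof (induction "card (\<Union>K)" arbitrary: K rule: less_induct)
  case less
  note K = less.prems(1) and ac = less.prems(2) and gen = less.prems(4)
  have dc: "down_closed K" and fin: "finite (\<Union>K)" using K unfolding planar_asc_def by blast+
  have nb: "\<exists>w. w \<noteq> v \<and> {v, w} \<in> K" if "v \<in> \<Union>K" for v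
    by (rule connected_asc_neighbour[OF dc acyclic_connected[OF ac] that less.prems(3)])
  show ?case
  proof (cases "\<exists>v\<in>\<Union>K. \<not> connected_asc (asc_link v K)")
    case False
    have extreme: "\<exists>v\<in>\<Union>K. (\<forall>w\<in>\<Union>K. w \<noteq> v \<longrightarrow> c \<bullet> w < c \<bullet> v) \<and> nonevasive (asc_link v K)"
      if c: "c = a \<or> c = - a" for c
    proof -
      let ?M = "(\<lambda>w. c \<bullet> w) ` \<Union>K"
      have "\<Union>K \<noteq> {}" by (rule connected_asc_nonempty[OF acyclic_connected[OF ac]])
      then have "Max ?M \<in> ?M" using fin by (intro Max_in) auto
      then obtain v where v: "v \<in> \<Union>K" "c \<bullet> v = Max ?M" by (metis imageE)
      have top: "c \<bullet> w < c \<bullet> v" if w: "w \<in> \<Union>K" "w \<noteq> v" for w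
      proof -
        have "c \<bullet> w \<le> c \<bullet> v" unfolding v(2) using w(1) fin by (intro Max_ge) auto
        moreover have "c \<bullet> w \<noteq> c \<bullet> v" using gen[OF w(1) v(1)] w(2) c by auto
        ultimately show ?thesis by simp
      qed
      have conn: "connected_asc (asc_link v K)" using False v(1) by blast
      have "nonevasive (asc_link v K)" by (rule planar_top_link_nonevasive[OF K v(1) top conn])
      then show ?thesis using v(1) top by blast
    qed
    obtain v where v: "v \<in> \<Union>K" "\<And>w. w \<in> \<Union>K \<Longrightarrow> w \<noteq> v \<Longrightarrow> a \<bullet> w < a \<bullet> v" "nonevasive (asc_link v K)"
      using extreme[of a] by blast
    obtain w where w: "w \<in> \<Union>K" "\<And>u. u \<in> \<Union>K \<Longrightarrow> u \<noteq> w \<Longrightarrow> - a \<bullet> u < - a \<bullet> w" "nonevasive (asc_link w K)"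
      using extreme[of "- a"] by blast
    have "v \<noteq> w"
    proof
      assume "v = w"
      obtain u where u: "u \<noteq> v" "{v, u} \<in> K" using nb[OF v(1)] by blast
      then have uK: "u \<in> \<Union>K" by blast
      show False using v(2)[OF uK u(1)] w(2)[OF uK] u(1) \<open>v = w\<close> by simp
    qed
    then show ?thesis using v w by blast
  next
    case True
    then obtain v where v: "v \<in> \<Union>K" "\<not> connected_asc (asc_link v K)" by blast
    have LV: "w \<in> \<Union>(asc_link v K) \<longleftrightarrow> w \<noteq> v \<and> {v, w} \<in> K" for w by (rule asc_link_vertex[OF dc])
    have Lne: "\<Union>(asc_link v K) \<noteq> {}" using nb[OF v(1)] LV by blast
    obtain g0 :: "'a \<Rightarrow> bool" and p q where g0: "\<And>a b. {a, b} \<in> asc_link v K \<Longrightarrow> g0 a = g0 b"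
      and p: "p \<in> \<Union>(asc_link v K)" and q: "q \<in> \<Union>(asc_link v K)" and pq: "g0 p \<noteq> g0 q"
      by (rule not_connected_link[OF v(2) Lne]) (rule that)
    \<comment> \<open>This cocycle is supported on the edges from \<open>v\<close> to one part of
      its disconnected link. Its primitive \<open>g\<close> is constant along edges avoiding
      \<open>v\<close> but differs at \<open>p\<close> and \<open>q\<close>, so a local cut at
      \<open>v\<close> is a global one.\<close>
    define f where "f x y = (if x = v then y \<noteq> v \<and> g0 y else y = v \<and> g0 x)" for x y
    have "f x z = (f x y \<noteq> f y z)" if xyz: "{x, y, z} \<in> K" for x y z
    proof -
      have lk: "g0 b = g0 c" if "{v, b, c} \<in> K" "b \<noteq> v" "c \<noteq> v" for b c
        using that by (intro g0) (simp add: asc_link_iff[OF dc])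
      have "g0 y = g0 z" if "x = v" "y \<noteq> v" "z \<noteq> v" using lk[of y z] xyz that by simp
      moreover have "g0 x = g0 z" if "y = v" "x \<noteq> v" "z \<noteq> v"
        using lk[of x z] xyz that by (simp add: insert_commute)
      moreover have "g0 x = g0 y" if "z = v" "x \<noteq> v" "y \<noteq> v"
        using lk[of x y] xyz that by (simp add: insert_commute)
      ultimately show ?thesis unfolding f_def by (cases "x = v"; cases "y = v"; cases "z = v") simp_all
    qed
    then have "cocycle K f" unfolding cocycle_def by blast
    then obtain g :: "'a \<Rightarrow> bool" where g: "\<And>x y. {x, y} \<in> K \<Longrightarrow> f x y = (g x \<noteq> g y)"
      using acyclic_primitive[OF ac] by blast
    have same: "g x = g y" if "{x, y} \<in> K" "x \<noteq> v" "y \<noteq> v" for x y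
      using g[OF that(1)] that(2,3) by (simp add: f_def)
    have differ: "g p \<noteq> g q"
      using g[of v p] g[of v q] p q pq LV unfolding f_def by auto
    define A where "A i = {\<sigma>\<in>K. \<forall>w\<in>\<sigma>. w = v \<or> g w = i}" for i
    have part: "\<exists>w\<in>\<Union>K. w \<noteq> v \<and> g w = i \<and> nonevasive (asc_link w K)" for i
    proof -
      have sub: "A i \<subseteq> K" by (auto simp: A_def)
      have dcA: "down_closed (A i)" using dc unfolding down_closed_def A_def by blast
      have vA: "{v} \<in> A i" "{} \<in> A i" using asc_vertex[OF dc v(1)] down_closedD[OF dc] by (auto simp: A_def)
      \<comment> \<open>Sending the other side to \<open>v\<close> retracts \<open>K\<close> to the
        piece \<open>A i\<close>, which is therefore acyclic too.\<close>
      define r where "r w = (if g w = i then w else v)" for w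
      have acA: "acyclic_asc (A i)"
      proof (rule acyclic_retract[OF ac sub])
        fix \<sigma> assume s: "\<sigma> \<in> K"
        show "r ` \<sigma> \<in> A i"
        proof (cases "\<forall>w\<in>\<sigma>. w = v \<or> g w = i")
          case True
          then have "r ` \<sigma> = \<sigma>" unfolding r_def by force
          then show ?thesis using s True by (simp add: A_def)
        next
          case False
          then obtain w where w: "w \<in> \<sigma>" "w \<noteq> v" "g w \<noteq> i" by blast
          have "r x = v" if "x \<in> \<sigma>" for x
          proof (cases "x = v")
            case False
            have "{x, w} \<in> K" by (rule down_closedD[OF dc s]) (use that w in auto)
            then show ?thesis using same[of x w] False w by (simp add: r_def)
          qed (simp add: r_def)
          then have "r ` \<sigma> \<subseteq> {v}" by blast
          then show ?thesis using down_closedD[OF dcA vA(1)] by blast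
        qed
      next
        fix w assume "w \<in> \<Union>(A i)"
        then show "r w = w" by (auto simp: A_def r_def)
      qed
      obtain b c where b: "b \<in> \<Union>(asc_link v K)" "g b = i" and c: "c \<in> \<Union>(asc_link v K)" "g c \<noteq> i"
        using p q differ by metis
      have bA: "b \<in> \<Union>(A i)" "v \<in> \<Union>(A i)" "b \<noteq> v"
        using b LV[of b] vA(1) unfolding A_def by blast+
      have cA: "c \<notin> \<Union>(A i)" "c \<in> \<Union>K" using c LV[of c] unfolding A_def by blast+
      have UA: "\<Union>(A i) \<subseteq> \<Union>K" using sub by blast
      obtain w where w: "w \<in> \<Union>(A i)" "w \<noteq> v" "nonevasive (asc_link w (A i))"
      proof -
        have "\<exists>x\<in>\<Union>(A i). \<exists>y\<in>\<Union>(A i). x \<noteq> y \<and> nonevasive (asc_link x (A i)) \<and> nonevasive (asc_link y (A i))"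
        proof (rule less.hyps)
          show "card (\<Union>(A i)) < card (\<Union>K)" using UA cA by (intro psubset_card_mono[OF fin]) blast
          show "planar_asc (A i)" by (rule planar_asc_subset[OF K sub dcA])
          show "acyclic_asc (A i)" by (rule acA)
          show "\<Union>(A i) \<noteq> {z}" for z using bA by (metis singletonD)
          show "x = y" if "x \<in> \<Union>(A i)" "y \<in> \<Union>(A i)" "a \<bullet> x = a \<bullet> y" for x y
            using gen that UA by blast
        qed
        then show ?thesis using that by metis
      qed
      have gw: "g w = i" using w(1,2) by (auto simp: A_def)
      have "asc_link w (A i) = asc_link w K"
      proof (intro equalityI subsetI)
        fix \<sigma> assume "\<sigma> \<in> asc_link w K"
        then have s: "w \<notin> \<sigma>" "insert w \<sigma> \<in> K" by (simp_all add: asc_link_iff[OF dc])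
        have "x = v \<or> g x = i" if "x \<in> \<sigma>" for x
        proof (cases "x = v")
          case False
          have "{x, w} \<in> K" by (rule down_closedD[OF dc s(2)]) (use that in auto)
          then show ?thesis using same[of x w] False w(2) gw by simp
        qed simp
        then have "insert w \<sigma> \<in> A i" using s(2) gw by (simp add: A_def)
        then show "\<sigma> \<in> asc_link w (A i)" using s(1) by (simp add: asc_link_iff[OF dcA])
      next
        fix \<sigma> assume "\<sigma> \<in> asc_link w (A i)"
        then show "\<sigma> \<in> asc_link w K" using sub unfolding asc_link_def by blast
      qed
      then have "nonevasive (asc_link w K)" using w(3) by simp
      then show ?thesis using w(1,2) gw UA by blast
    qed
    obtain w w' where "w \<in> \<Union>K" "w' \<in> \<Union>K" "g w = True" "g w' = False"
      "nonevasive (asc_link w K)" "nonevasive (asc_link w' K)"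
      using part[of True] part[of False] by metis
    moreover from this have "w \<noteq> w'" by metis
    ultimately show ?thesis by blast
  qed
qed

lemma planar_acyclic_nonevasive:
  fixes K :: "'a::euclidean_space set set"
  assumes "planar_asc K" "acyclic_asc K"
    and "\<And>x y. x \<in> \<Union>K \<Longrightarrow> y \<in> \<Union>K \<Longrightarrow> a \<bullet> x = a \<bullet> y \<Longrightarrow> x = y"
  shows "nonevasive K"
  using assms
proof (induction "card (\<Union>K)" arbitrary: K rule: less_induct)
  case less
  note K = less.prems(1) and ac = less.prems(2)
  have dc: "down_closed K" and fin: "finite (\<Union>K)" using K unfolding planar_asc_def by blast+
  show ?case
  proof (cases "\<exists>z. \<Union>K = {z}")
    case True
    then obtain z where z: "\<Union>K = {z}" by blast
    then have "{z} \<in> K" using asc_vertex[OF dc, of z] by simp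
    then have "K = {{}, {z}}" using z down_closedD[OF dc, of "{z}" "{}"] by auto
    then show ?thesis by (simp add: nonevasive.point)
  next
    case False
    then obtain v where v: "v \<in> \<Union>K" "nonevasive (asc_link v K)"
      using planar_two_vertices[OF K ac _ less.prems(3)] by blast
    have DV: "\<Union>(asc_deletion v K) = \<Union>K - {v}" by (rule asc_deletion_vertex[OF dc])
    \<comment> \<open>Non-evasiveness of the link makes it acyclic, which is what lets acyclicity
      pass to the deletion.\<close>
    have L: "acyclic_asc (asc_link v K)" by (rule nonevasive_acyclic[OF v(2) down_closed_link[OF dc]])
    have "nonevasive (asc_deletion v K)"
    proof (rule less.hyps)
      show "card (\<Union>(asc_deletion v K)) < card (\<Union>K)" unfolding DV by (rule card_Diff1_less[OF fin v(1)])
      show "planar_asc (asc_deletion v K)"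
        by (rule planar_asc_subset[OF K asc_deletion_subset down_closed_deletion[OF dc]])
      show "acyclic_asc (asc_deletion v K)" by (rule acyclic_deletion[OF dc ac L])
      show "x = y" if "x \<in> \<Union>(asc_deletion v K)" "y \<in> \<Union>(asc_deletion v K)" "a \<bullet> x = a \<bullet> y" for x y
        using less.prems(3) that unfolding DV by blast
    qed
    then show ?thesis by (rule nonevasive_link_deletion[OF v(2)])
  qed
qed

lemma extreme_points_simplex:
  assumes "n simplex P"
  shows "\<not> affine_dependent {v. v extreme_point_of P}" "P = convex hull {v. v extreme_point_of P}"
    "int (card {v. v extreme_point_of P}) = n + 1"
proof -
  obtain V where V: "\<not> affine_dependent V" "int (card V) = n + 1" "P = convex hull V"
    using assms unfolding simplex_def by blast
  have "{v. v extreme_point_of P} = V"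
    unfolding V(3) using extreme_point_of_convex_hull_affine_independent[OF V(1)] by blast
  then show "\<not> affine_dependent {v. v extreme_point_of P}" "P = convex hull {v. v extreme_point_of P}"
    "int (card {v. v extreme_point_of P}) = n + 1"
    using V by simp_all
qed

section \<open>Vertex schemes of geometric simplicial complexes\<close>

context
  fixes C :: "'a::euclidean_space set set"
  assumes C: "simplicial_complex C"
begin

lemma simplicial_polytopal: "polytopal_complex C"
  using C unfolding simplicial_complex_def by blast

lemma vertex_scheme_independent: "\<sigma> \<in> vertex_scheme C \<Longrightarrow> \<not> affine_dependent \<sigma>"
  and vertex_scheme_hull: "\<sigma> \<in> vertex_scheme C \<Longrightarrow> convex hull \<sigma> \<in> C"
  and hull_extreme_points: "P \<in> C \<Longrightarrow> convex hull {v. v extreme_point_of P} = P"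
  and vertex_scheme_card: "\<sigma> \<in> vertex_scheme C \<Longrightarrow> card \<sigma> \<le> DIM('a) + 1"
proof -
  have s: "\<exists>n. n simplex P" if "P \<in> C" for P using C that unfolding simplicial_complex_def by blast
  show h: "convex hull {v. v extreme_point_of P} = P" if "P \<in> C" for P
    using s[OF that] extreme_points_simplex(2) by metis
  show "\<not> affine_dependent \<sigma>" if "\<sigma> \<in> vertex_scheme C"
    using that s extreme_points_simplex(1) unfolding vertex_scheme_def by blast
  show "convex hull \<sigma> \<in> C" if "\<sigma> \<in> vertex_scheme C"
    using that h unfolding vertex_scheme_def by force
  show "card \<sigma> \<le> DIM('a) + 1" if \<sigma>: "\<sigma> \<in> vertex_scheme C"
  proof -
    obtain P n where P: "\<sigma> = {v. v extreme_point_of P}" "n simplex P"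
      using \<sigma> s unfolding vertex_scheme_def by blast
    have "n \<le> int DIM('a)" using aff_dim_simplex[OF P(2)] aff_dim_le_DIM[of P] by simp
    then show ?thesis using extreme_points_simplex(3)[OF P(2)] P(1) by simp
  qed
qed

lemma vertex_scheme_down_closed: "down_closed (vertex_scheme C)"
  unfolding down_closed_def
proof (intro ballI allI impI)
  fix \<sigma> \<tau> assume s: "\<sigma> \<in> vertex_scheme C" and t: "\<tau> \<subseteq> \<sigma>"
  note ind = vertex_scheme_independent[OF s]
  have "convex hull \<tau> face_of convex hull \<sigma>"
    unfolding face_of_convex_hull_affine_independent[OF ind] using t by blast
  then have "convex hull \<tau> \<in> C"
    using vertex_scheme_hull[OF s] simplicial_polytopal unfolding polytopal_complex_def by blast
  moreover have "\<not> affine_dependent \<tau>" using ind t affine_dependent_subset by blast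
  then have "{v. v extreme_point_of convex hull \<tau>} = \<tau>"
    using extreme_point_of_convex_hull_affine_independent by blast
  ultimately show "\<tau> \<in> vertex_scheme C" unfolding vertex_scheme_def by (metis image_eqI)
qed

text \<open>The intersection is a face of both simplices, hence the hull of a subset of each vertex
  set; both subsets are its set of extreme points and so coincide.\<close>

lemma vertex_scheme_hull_Int:
  assumes "\<sigma> \<in> vertex_scheme C" "\<tau> \<in> vertex_scheme C"
  shows "convex hull \<sigma> \<inter> convex hull \<tau> = convex hull (\<sigma> \<inter> \<tau>)"
proof
  show "convex hull (\<sigma> \<inter> \<tau>) \<subseteq> convex hull \<sigma> \<inter> convex hull \<tau>" by (simp add: hull_mono)
  let ?I = "convex hull \<sigma> \<inter> convex hull \<tau>"
  have f: "?I face_of convex hull \<sigma>" "?I face_of convex hull \<tau>"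
    using simplicial_polytopal vertex_scheme_hull assms unfolding polytopal_complex_def by blast+
  obtain c where c: "c \<subseteq> \<sigma>" "?I = convex hull c"
    using f(1) unfolding face_of_convex_hull_affine_independent[OF vertex_scheme_independent[OF assms(1)]] by blast
  obtain c' where c': "c' \<subseteq> \<tau>" "?I = convex hull c'"
    using f(2) unfolding face_of_convex_hull_affine_independent[OF vertex_scheme_independent[OF assms(2)]] by blast
  have "\<not> affine_dependent c" "\<not> affine_dependent c'"
    using affine_dependent_subset vertex_scheme_independent assms c(1) c'(1) by blast+
  then have "c = c'"
    using extreme_point_of_convex_hull_affine_independent c(2) c'(2) by (metis set_eqI)
  then have "c \<subseteq> \<sigma> \<inter> \<tau>" using c(1) c'(1) by blast
  then show "?I \<subseteq> convex hull (\<sigma> \<inter> \<tau>)" unfolding c(2) by (rule hull_mono)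
qed

lemma vertex_scheme_finite: "finite (\<Union>(vertex_scheme C))"
proof -
  have "finite C" using simplicial_polytopal unfolding polytopal_complex_def by blast
  moreover have "finite \<sigma>" if "\<sigma> \<in> vertex_scheme C" for \<sigma>
    using vertex_scheme_independent[OF that] aff_independent_finite by blast
  ultimately show ?thesis by (auto simp: vertex_scheme_def)
qed

text \<open>Convex hulls identify the nonempty faces of the vertex scheme with those of
  \<open>C\<close>, whose order complex is non-evasive; acyclicity then descends from the order
  complex to the scheme.\<close>

lemma vertex_scheme_acyclic:
  assumes "starlike (underlying C)"
  shows "acyclic_asc (vertex_scheme C)"
proof -
  let ?K = "vertex_scheme C"
  have "\<Union>(C - {{}}) = underlying C" by (auto simp: underlying_def)
  then have ne: "nonevasive (order_complex (C - {{}}))"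
    using cell_complex_nonevasive[OF polytopal_cell_complex[OF simplicial_polytopal]] assms by simp
  have img: "(\<lambda>\<sigma>. convex hull \<sigma>) ` (?K - {{}}) = C - {{}}"
  proof (intro equalityI subsetI)
    fix P assume P: "P \<in> C - {{}}"
    let ?V = "{v. v extreme_point_of P}"
    have "convex hull ?V = P" using hull_extreme_points P by blast
    moreover have "?V \<in> ?K" using P by (simp add: vertex_scheme_def)
    moreover have "?V \<noteq> {}" using calculation(1) P by auto
    ultimately show "P \<in> (\<lambda>\<sigma>. convex hull \<sigma>) ` (?K - {{}})"
      by (intro image_eqI[of _ _ ?V]) auto
  next
    fix P assume "P \<in> (\<lambda>\<sigma>. convex hull \<sigma>) ` (?K - {{}})"
    then obtain \<sigma> where "\<sigma> \<in> ?K" "\<sigma> \<noteq> {}" "P = convex hull \<sigma>" by blast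
    then show "P \<in> C - {{}}" using vertex_scheme_hull by simp
  qed
  have "nonevasive (order_complex (?K - {{}}))"
  proof (rule order_complex_image[where f = "\<lambda>\<sigma>. convex hull \<sigma>"])
    show "nonevasive (order_complex ((\<lambda>\<sigma>. convex hull \<sigma>) ` (?K - {{}})))" using ne by (simp only: img)
    show "convex hull A \<subseteq> convex hull B \<longleftrightarrow> A \<subseteq> B" if "A \<in> ?K - {{}}" "B \<in> ?K - {{}}" for A B
    proof
      assume "convex hull A \<subseteq> convex hull B"
      then have "convex hull A = convex hull (A \<inter> B)" using vertex_scheme_hull_Int[of A B] that by blast
      moreover have "\<not> affine_dependent A" "\<not> affine_dependent (A \<inter> B)"
        using vertex_scheme_independent[of A] that affine_dependent_subset[of "A \<inter> B" A] by blast+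
      ultimately have "A = A \<inter> B"
        using extreme_point_of_convex_hull_affine_independent by (metis set_eqI)
      then show "A \<subseteq> B" by blast
    qed (rule hull_mono)
  qed
  then show ?thesis
    by (rule acyclic_of_order_complex[OF vertex_scheme_down_closed
          nonevasive_acyclic[OF _ order_complex_down_closed]])
qed

lemma planar_simplicial_nonevasive:
  assumes "DIM('a) = 2" "starlike (underlying C)"
  shows "nonevasive (vertex_scheme C)"
proof -
  let ?V = "\<Union>(vertex_scheme C)"
  \<comment> \<open>A functional vanishing on no difference of distinct vertices separates all
    vertices.\<close>
  let ?W = "(\<lambda>(x, y). x - y) ` (?V \<times> ?V) - {0}"
  have "finite ?W" using vertex_scheme_finite by simp
  moreover have "0 \<notin> ?W" by simp
  ultimately have "\<exists>a. \<forall>w\<in>?W. a \<bullet> w \<noteq> 0" by (rule exists_generic_functional)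
  then obtain a where a: "\<forall>w\<in>?W. a \<bullet> w \<noteq> 0" ..
  show ?thesis
  proof (rule planar_acyclic_nonevasive[where a = a])
    show "planar_asc (vertex_scheme C)"
      unfolding planar_asc_def
    proof (intro conjI ballI)
      show "card \<sigma> \<le> 3" if "\<sigma> \<in> vertex_scheme C" for \<sigma>
        using vertex_scheme_card[OF that] assms(1) by simp
      show "convex hull \<sigma> \<inter> convex hull \<tau> = convex hull (\<sigma> \<inter> \<tau>)"
        if "\<sigma> \<in> vertex_scheme C" "\<tau> \<in> vertex_scheme C" for \<sigma> \<tau>
        by (rule vertex_scheme_hull_Int[OF that])
    qed (rule assms(1) vertex_scheme_down_closed vertex_scheme_finite)+
    show "acyclic_asc (vertex_scheme C)" by (rule vertex_scheme_acyclic[OF assms(2)])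
    show "x = y" if "x \<in> ?V" "y \<in> ?V" "a \<bullet> x = a \<bullet> y" for x y
    proof (rule ccontr)
      assume "x \<noteq> y"
      then have "x - y \<in> ?W"
        using that(1,2) by (intro DiffI image_eqI[of _ _ "(x, y)"] SigmaI) simp_all
      then have "a \<bullet> (x - y) \<noteq> 0" using a by (rule bspec[rotated])
      then show False using that(3) by (simp add: inner_diff_right)
    qed
  qed
qed

end

theorem theorem2p2:
  fixes C :: "(real^'n) set set"
  assumes "(CARD('n) \<ge> 3 \<and> polytopal_complex C) \<or>
           (CARD('n) = 2 \<and> simplicial_complex C)"
    and "starlike (underlying C)"
  shows "\<forall>D. iter_derived (CARD('n) - 2) C D \<longrightarrow>
           nonevasive (vertex_scheme D) \<and> collapsible (vertex_scheme D)"
proof (intro allI impI)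
  fix D assume D: "iter_derived (CARD('n) - 2) C D"
  have "nonevasive (vertex_scheme D) \<and> down_closed (vertex_scheme D)"
    using assms(1)
  proof
    assume C: "CARD('n) \<ge> 3 \<and> polytopal_complex C"
    \<comment> \<open>At least one subdivision is performed: the last one gives non-evasiveness, the
      \<open>r\<close> before it keep the complex polytopal and its underlying set
      star-shaped.\<close>
    obtain r where "CARD('n) - 2 = Suc r" using C by (metis Suc_diff_le Suc_1 numeral_3_eq_3 diff_Suc_Suc numeral_2_eq_2)
    then obtain B where B: "iter_derived r C B" "derived_subdivision B D"
      using D by (metis iter_derived.cases nat.distinct(1) nat.inject)
    have "polytopal_complex B" "underlying B = underlying C"
      using iter_derived_polytopal[OF B(1)] C by blast+
    then show ?thesis using derived_nonevasive[OF _ _ B(2)] assms(2) by simp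
  next
    assume C: "CARD('n) = 2 \<and> simplicial_complex C"
    \<comment> \<open>The number of subdivisions is zero here.\<close>
    then have "D = C" using D by (auto elim: iter_derived.cases)
    then show ?thesis
      using planar_simplicial_nonevasive vertex_scheme_down_closed C assms(2) by auto
  qed
  then show "nonevasive (vertex_scheme D) \<and> collapsible (vertex_scheme D)"
    using nonevasive_imp_collapsible by blast
qed

end
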